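(* Let $n\ge 3$ and $1\le k\le n$ be integers. Let $V_k(\mathbb{R}^n)$ be the Stiefel manifold of orthonormal $k$-frames in $\mathbb{R}^n$ with its free action of the group $W_k=(\mathbb{Z}/2)^k\rtimes\mathfrak{S}_k$ by sign changes and permutations of the frame vectors. Then $$g_{W_k}(V_k(\mathbb{R}^n))=\operatorname{cat}\big(V_k(\mathbb{R}^n)/W_k\big)=\dim V_k(\mathbb{R}^n)+1=nk-\frac{k(k+1)}{2}+1.$$
   Context: $\mathfrak{S}_k$ denotes the symmetric group on $k$ letters. The group $W_k=(\mathbb{Z}/2)^k\rtimes\mathfrak{S}_k$ is the group of signed permutation matrices in $\mathrm{O}(k)$. For $g=(\gamma_{ij})\in \mathrm{O}(k)$ put $(v_1,\ldots,v_k)\cdot g=\big(\sum_j v_j\gamma_{j1},\ldots,\sum_j v_j\gamma_{jk}\big)$; $W_k$ acts on $V_k(\mathbb{R}^n)$ from the left by $g\cdot v:=v\cdot g^{-1}$. Thus the $i$-th generator of $(\mathbb{Z}/2)^k$ replaces $v_i$ by $-v_i$, and $\mathfrak{S}_k$ permutes the vectors of the frame. Schwarz genus: for a finite group $G$ and a free $G$-space $X$, $g_G(X)$ is the smallest number $m$ such that $X$ can be covered by $m$ open $G$-invariant subsets $X_1,\ldots,X_m$ such that for every $i$ there exists a (continuous) $G$-equivariant map $X_i\to G$, where $G$ is discrete and acts on itself by left translations. Lusternik--Schnirelmann category (unnormalized): $\operatorname{cat} X$ is the smallest integer $m$ such that $X$ can be covered by $m$ open subsets $X_1,\ldots,X_m$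 for which all inclusions $X_i\to X$ are nullhomotopic (so a contractible space has category $1$). *)

theory Defs
  imports "HOL-Analysis.Analysis" "HOL-Algebra.Group_Action" "HOL-Library.Extended_Nat"
begin

section \<open>Group actions on spaces and Schwarz genus\<close>

definition free_G_space ::
    "('g, 'm) monoid_scheme \<Rightarrow> 'x topology \<Rightarrow> ('g \<Rightarrow> 'x \<Rightarrow> 'x) \<Rightarrow> bool" where
  "free_G_space G X \<phi> \<longleftrightarrow>
     group_action G (topspace X) \<phi> \<and>
     (\<forall>g\<in>carrier G. continuous_map X X (\<phi> g)) \<and>
     (\<forall>x\<in>topspace X. stabilizer G \<phi> x = {\<one>\<^bsub>G\<^esub>})"

definition G_invariant ::
    "('g, 'm) monoid_scheme \<Rightarrow> ('g \<Rightarrow> 'x \<Rightarrow> 'x) \<Rightarrow> 'x set \<Rightarrow> bool" where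
  "G_invariant G \<phi> U \<longleftrightarrow> (\<forall>g\<in>carrier G. \<forall>x\<in>U. \<phi> g x \<in> U)"

definition equivariant_map_to_group ::
    "('g, 'm) monoid_scheme \<Rightarrow> 'x topology \<Rightarrow> ('g \<Rightarrow> 'x \<Rightarrow> 'x) \<Rightarrow> ('x \<Rightarrow> 'g) \<Rightarrow> bool" where
  "equivariant_map_to_group G X \<phi> f \<longleftrightarrow>
     continuous_map X (discrete_topology (carrier G)) f \<and>
     (\<forall>g\<in>carrier G. \<forall>x\<in>topspace X. f (\<phi> g x) = g \<otimes>\<^bsub>G\<^esub> f x)"

text \<open>Genus and category are extended natural numbers: the infimum of the empty set, that is, the
  case in which no finite cover of the required kind exists, is \<open>\<infinity>\<close>.\<close>

definition schwarz_genus ::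
    "('g, 'm) monoid_scheme \<Rightarrow> 'x topology \<Rightarrow> ('g \<Rightarrow> 'x \<Rightarrow> 'x) \<Rightarrow> enat" where
  "schwarz_genus G X \<phi> =
     Inf {enat m | m. \<exists>U :: nat \<Rightarrow> 'x set.
            (\<Union>i<m. U i) = topspace X \<and>
            (\<forall>i<m. openin X (U i) \<and> G_invariant G \<phi> (U i) \<and>
                   (\<exists>f. equivariant_map_to_group G (subtopology X (U i)) \<phi> f))}"

section \<open>Orbit space, Lusternik--Schnirelmann category, dimension\<close>

definition orbit_space ::
    "('g, 'm) monoid_scheme \<Rightarrow> 'x topology \<Rightarrow> ('g \<Rightarrow> 'x \<Rightarrow> 'x) \<Rightarrow> 'x set topology" where
  "orbit_space G X \<phi> =
     topology (\<lambda>V. V \<subseteq> orbits G (topspace X) \<phi> \<and>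
                   openin X {x \<in> topspace X. orbit G \<phi> x \<in> V})"

lemma openin_orbit_space:
  "openin (orbit_space G X \<phi>) V \<longleftrightarrow>
     V \<subseteq> orbits G (topspace X) \<phi> \<and> openin X {x \<in> topspace X. orbit G \<phi> x \<in> V}"
proof -
  have "istopology (\<lambda>V. V \<subseteq> orbits G (topspace X) \<phi> \<and>
                        openin X {x \<in> topspace X. orbit G \<phi> x \<in> V})"
    unfolding istopology_def
  proof (intro conjI allI impI)
    fix S T
    assume S: "S \<subseteq> orbits G (topspace X) \<phi> \<and> openin X {x \<in> topspace X. orbit G \<phi> x \<in> S}"
      and T: "T \<subseteq> orbits G (topspace X) \<phi> \<and> openin X {x \<in> topspace X. orbit G \<phi> x \<in> T}"
    show "S \<inter> T \<subseteq> orbits G (topspace X) \<phi>" using S by blast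
    have "{x \<in> topspace X. orbit G \<phi> x \<in> S \<inter> T} =
          {x \<in> topspace X. orbit G \<phi> x \<in> S} \<inter> {x \<in> topspace X. orbit G \<phi> x \<in> T}" by blast
    then show "openin X {x \<in> topspace X. orbit G \<phi> x \<in> S \<inter> T}" using S T by auto
  next
    fix \<K>
    assume K: "\<forall>S\<in>\<K>. S \<subseteq> orbits G (topspace X) \<phi> \<and> openin X {x \<in> topspace X. orbit G \<phi> x \<in> S}"
    show "\<Union> \<K> \<subseteq> orbits G (topspace X) \<phi>" using K by blast
    have "{x \<in> topspace X. orbit G \<phi> x \<in> \<Union> \<K>} =
          (\<Union>S\<in>\<K>. {x \<in> topspace X. orbit G \<phi> x \<in> S})" by blast
    then show "openin X {x \<in> topspace X. orbit G \<phi> x \<in> \<Union> \<K>}" using K by auto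
  qed
  then show ?thesis unfolding orbit_space_def by simp
qed

lemma topspace_orbit_space: "topspace (orbit_space G X \<phi>) = orbits G (topspace X) \<phi>"
proof -
  have "{x \<in> topspace X. orbit G \<phi> x \<in> orbits G (topspace X) \<phi>} = topspace X"
    by (auto simp: orbits_def)
  then have "openin (orbit_space G X \<phi>) (orbits G (topspace X) \<phi>)"
    by (simp add: openin_orbit_space)
  then have "orbits G (topspace X) \<phi> \<subseteq> topspace (orbit_space G X \<phi>)"
    by (rule openin_subset)
  moreover have "topspace (orbit_space G X \<phi>) \<subseteq> orbits G (topspace X) \<phi>"
    using openin_topspace[of "orbit_space G X \<phi>"] unfolding openin_orbit_space by (rule conjunct1)
  ultimately show ?thesis by blast
qed

lemma quotient_map_orbit_space: "quotient_map X (orbit_space G X \<phi>) (orbit G \<phi>)"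
  unfolding quotient_map_def topspace_orbit_space openin_orbit_space
  by (auto simp: orbits_def)

definition ls_cat :: "'x topology \<Rightarrow> enat" where
  "ls_cat X =
     Inf {enat m | m. \<exists>U :: nat \<Rightarrow> 'x set.
            (\<Union>i<m. U i) = topspace X \<and>
            (\<forall>i<m. openin X (U i) \<and>
                   (\<exists>c. homotopic_with (\<lambda>_. True) (subtopology X (U i)) X id (\<lambda>_. c)))}"

definition topological_manifold :: "nat \<Rightarrow> 'x topology \<Rightarrow> bool" where
  "topological_manifold d X \<longleftrightarrow>
     Hausdorff_space X \<and> second_countable X \<and>
     (\<forall>x\<in>topspace X. \<exists>U V. openin X U \<and> x \<in> U \<and> openin (Euclidean_space d) V \<and>
        subtopology X U homeomorphic_space subtopology (Euclidean_space d) V)"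

text \<open>Meaningful for nonempty manifolds, where the dimension is unique by invariance of domain.\<close>

definition manifold_dim :: "'x topology \<Rightarrow> nat" where
  "manifold_dim X = (THE d. topological_manifold d X)"

section \<open>Stiefel manifolds and signed permutations\<close>

text \<open>A \<open>k\<close>-tuple of vectors in \<open>\<real>\<^sup>n\<close> is an element \<open>v\<close> of \<^typ>\<open>real^'n^'k\<close> with \<open>n = CARD('n)\<close> and
  \<open>k = CARD('k)\<close>; its \<open>i\<close>-th vector is the row \<open>v $ i\<close>.\<close>

definition stiefel :: "(real^'n^'k) set" where
  "stiefel = {v. \<forall>i j. v $ i \<bullet> v $ j = (if i = j then 1 else 0)}"

definition stiefel_space :: "(real^'n^'k) topology" where
  "stiefel_space = top_of_set stiefel"

text \<open>The matrix with entry \<open>\<epsilon> i\<close> at the places \<open>(i, \<sigma> i)\<close> and zeros elsewhere.\<close>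

definition signed_perm_matrix :: "('k \<Rightarrow> real) \<Rightarrow> ('k \<Rightarrow> 'k) \<Rightarrow> real^'k^'k" where
  "signed_perm_matrix \<epsilon> \<sigma> = (\<chi> i j. if j = \<sigma> i then \<epsilon> i else 0)"

definition signed_perm_group :: "(real^'k^'k) monoid" where
  "signed_perm_group =
     \<lparr>carrier = {signed_perm_matrix \<epsilon> \<sigma> | \<epsilon> \<sigma>. (\<forall>i. \<epsilon> i \<in> {1, -1}) \<and> bij \<sigma>},
      mult = (**),
      one = mat 1\<rparr>"

definition frame_right_mult :: "real^'n^'k \<Rightarrow> real^'k^'k \<Rightarrow> real^'n^'k" where
  "frame_right_mult v g = (\<chi> i. \<Sum>j\<in>UNIV. g $ j $ i *\<^sub>R v $ j)"

text \<open>The restriction to frames only serves to make the action extensional, as required by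
  \<^locale>\<open>group_action\<close>.\<close>

definition frame_action :: "real^'k^'k \<Rightarrow> real^'n^'k \<Rightarrow> real^'n^'k" where
  "frame_action g = (\<lambda>v\<in>stiefel. frame_right_mult v (matrix_inv g))"

lemma topspace_stiefel_space [simp]: "topspace stiefel_space = stiefel"
  by (simp add: stiefel_space_def)

lemma signed_perm_mult:
  "signed_perm_matrix \<epsilon> \<sigma> ** signed_perm_matrix \<delta> \<tau> =
     signed_perm_matrix (\<lambda>i. \<epsilon> i * \<delta> (\<sigma> i)) (\<tau> \<circ> \<sigma>)"
proof -
  have "(\<Sum>k\<in>UNIV. (if k = \<sigma> i then \<epsilon> i else 0) * (if j = \<tau> k then \<delta> k else 0)) =
        (if j = \<tau> (\<sigma> i) then \<epsilon> i * \<delta> (\<sigma> i) else 0)" for i j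
  proof -
    have "(\<Sum>k\<in>UNIV. (if k = \<sigma> i then \<epsilon> i else 0) * (if j = \<tau> k then \<delta> k else 0)) =
          (\<Sum>k\<in>UNIV. if k = \<sigma> i then \<epsilon> i * (if j = \<tau> k then \<delta> k else 0) else 0)"
      by (rule sum.cong) auto
    then show ?thesis by simp
  qed
  then show ?thesis
    by (simp add: signed_perm_matrix_def matrix_matrix_mult_def vec_eq_iff)
qed

lemma signed_perm_one: "mat 1 = signed_perm_matrix (\<lambda>_. 1) id"
  by (auto simp: signed_perm_matrix_def mat_def vec_eq_iff)

lemma signed_perm_orthogonal:
  assumes "\<forall>i. \<epsilon> i \<in> {1, -1}" "bij \<sigma>"
  shows "orthogonal_matrix (signed_perm_matrix \<epsilon> \<sigma>)"
    and "transpose (signed_perm_matrix \<epsilon> \<sigma>) =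
           signed_perm_matrix (\<lambda>i. \<epsilon> (inv_into UNIV \<sigma> i)) (inv_into UNIV \<sigma>)"
proof -
  show tr: "transpose (signed_perm_matrix \<epsilon> \<sigma>) =
              signed_perm_matrix (\<lambda>i. \<epsilon> (inv_into UNIV \<sigma> i)) (inv_into UNIV \<sigma>)"
    using assms(2)
    by (auto simp: signed_perm_matrix_def transpose_def vec_eq_iff bij_inv_eq_iff bij_is_inj)
  have sq: "\<epsilon> i * \<epsilon> i = 1" for i using assms(1)[rule_format, of i] by auto
  show "orthogonal_matrix (signed_perm_matrix \<epsilon> \<sigma>)"
    unfolding orthogonal_matrix tr signed_perm_mult signed_perm_one
    using sq surj_iff[THEN iffD1, OF bij_is_surj[OF assms(2)]] by simp
qed

lemma group_signed_perm_group: "group signed_perm_group"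
proof (rule groupI)
  fix x y :: "real^'k^'k"
  assume "x \<in> carrier signed_perm_group" "y \<in> carrier signed_perm_group"
  then obtain \<epsilon> \<sigma> \<delta> \<tau> where *: "x = signed_perm_matrix \<epsilon> \<sigma>" "\<forall>i. \<epsilon> i \<in> {1, -1}" "bij \<sigma>"
    "y = signed_perm_matrix \<delta> \<tau>" "\<forall>i. \<delta> i \<in> {1, -1}" "bij \<tau>"
    by (auto simp: signed_perm_group_def)
  have "\<forall>i. \<epsilon> i * \<delta> (\<sigma> i) \<in> {1, -1}"
  proof
    fix i show "\<epsilon> i * \<delta> (\<sigma> i) \<in> {1, -1}" using *(2)[rule_format, of i] *(5)[rule_format, of "\<sigma> i"] by auto
  qed
  moreover have "bij (\<tau> \<circ> \<sigma>)" using * bij_comp by blast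
  ultimately show "x \<otimes>\<^bsub>signed_perm_group\<^esub> y \<in> carrier signed_perm_group"
    unfolding *(1,4) signed_perm_group_def by (simp add: signed_perm_mult) blast
next
  show "\<one>\<^bsub>signed_perm_group\<^esub> \<in> carrier (signed_perm_group :: (real^'k^'k) monoid)"
    unfolding signed_perm_group_def by (simp add: signed_perm_one) (metis bij_id)
next
  fix x :: "real^'k^'k"
  assume "x \<in> carrier signed_perm_group"
  then obtain \<epsilon> \<sigma> where *: "x = signed_perm_matrix \<epsilon> \<sigma>" "\<forall>i. \<epsilon> i \<in> {1, -1}" "bij \<sigma>"
    by (auto simp: signed_perm_group_def)
  have "transpose x \<in> carrier signed_perm_group"
    unfolding *(1) signed_perm_orthogonal(2)[OF *(2,3)] signed_perm_group_def
    using *(2) bij_imp_bij_inv[OF *(3)] by fastforce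
  moreover have "transpose x ** x = mat 1"
    using signed_perm_orthogonal(1)[OF *(2,3)] *(1) by (simp add: orthogonal_matrix)
  ultimately show "\<exists>y\<in>carrier signed_perm_group. y \<otimes>\<^bsub>signed_perm_group\<^esub> x = \<one>\<^bsub>signed_perm_group\<^esub>"
    by (auto simp: signed_perm_group_def)
qed (auto simp: signed_perm_group_def matrix_mul_assoc)

lemma frame_action_eq_matrix_mult:
  assumes "g \<in> carrier signed_perm_group" "v \<in> stiefel"
  shows "frame_action g v = g ** v"
proof -
  have o: "orthogonal_matrix g"
    using assms(1) signed_perm_orthogonal(1) by (auto simp: signed_perm_group_def)
  have "matrix_inv g = transpose g"
  proof -
    have "transpose g ** g = mat 1" "g ** transpose g = mat 1"
      using o by (auto simp: orthogonal_matrix_def)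
    then have "matrix_inv g ** g = mat 1"
      unfolding matrix_inv_def by (metis (mono_tags, lifting) someI_ex)
    have "matrix_inv g = matrix_inv g ** (g ** transpose g)"
      by (simp add: \<open>g ** transpose g = mat 1\<close>)
    also have "\<dots> = transpose g"
      by (simp add: matrix_mul_assoc \<open>matrix_inv g ** g = mat 1\<close>)
    finally show ?thesis .
  qed
  then show ?thesis
    using assms(2)
    by (simp add: frame_action_def frame_right_mult_def transpose_def matrix_matrix_mult_def vec_eq_iff)
qed

lemma frame_action_signed_perm:
  assumes "\<forall>i. \<epsilon> i \<in> {1, -1}" "bij \<sigma>" "v \<in> stiefel"
  shows "frame_action (signed_perm_matrix \<epsilon> \<sigma>) v $ i = \<epsilon> i *\<^sub>R v $ \<sigma> i"
proof -
  have "signed_perm_matrix \<epsilon> \<sigma> \<in> carrier signed_perm_group"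
    using assms by (auto simp: signed_perm_group_def)
  moreover have "(\<Sum>k\<in>UNIV. (if k = \<sigma> i then \<epsilon> i else 0) * v $ k $ j) = \<epsilon> i * v $ \<sigma> i $ j" for j
  proof -
    have "(\<Sum>k\<in>UNIV. (if k = \<sigma> i then \<epsilon> i else 0) * v $ k $ j) =
          (\<Sum>k\<in>UNIV. if k = \<sigma> i then \<epsilon> i * v $ k $ j else 0)" by (rule sum.cong) auto
    then show ?thesis by simp
  qed
  ultimately show ?thesis
    using assms(3)
    by (simp add: frame_action_eq_matrix_mult signed_perm_matrix_def matrix_matrix_mult_def vec_eq_iff)
qed

lemma stiefel_iff: "v \<in> stiefel \<longleftrightarrow> v ** transpose v = mat 1"
  by (simp add: stiefel_def matrix_matrix_mult_def transpose_def mat_def vec_eq_iff inner_vec_def)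

lemma finite_signed_perm_group: "finite (carrier (signed_perm_group :: (real^'k^'k) monoid))"
proof -
  have "carrier (signed_perm_group :: (real^'k^'k) monoid) \<subseteq>
          (\<lambda>(\<epsilon>, \<sigma>). signed_perm_matrix \<epsilon> \<sigma>) ` ((UNIV \<rightarrow>\<^sub>E {1, -1}) \<times> UNIV)"
    by (auto simp: signed_perm_group_def image_iff PiE_UNIV_domain)
  moreover have "finite ((UNIV :: 'k set) \<rightarrow>\<^sub>E {1, -1 :: real})" by (rule finite_PiE) auto
  ultimately show ?thesis by (meson finite_SigmaI finite_code finite_imageI finite_subset)
qed

lemma free_G_space_stiefel:
  "free_G_space signed_perm_group (stiefel_space :: (real^'n^'k) topology) frame_action"
proof -
  let ?G = "signed_perm_group :: (real^'k^'k) monoid"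
  let ?S = "stiefel :: (real^'n^'k) set"
  interpret G: group ?G by (rule group_signed_perm_group)
  have G [simp]: "mult ?G = (**)" "one ?G = mat 1"
    by (simp_all add: signed_perm_group_def)
  have orth: "orthogonal_matrix g" if "g \<in> carrier ?G" for g
    using that signed_perm_orthogonal(1) by (auto simp: signed_perm_group_def)
  have inS: "g ** v \<in> ?S" if "g \<in> carrier ?G" "v \<in> ?S" for g v
  proof -
    have "(g ** v) ** transpose (g ** v) = g ** (v ** transpose v) ** transpose g"
      by (simp add: matrix_transpose_mul matrix_mul_assoc)
    then show ?thesis
      using that orth[OF that(1)] by (simp add: stiefel_iff orthogonal_matrix_def)
  qed
  have Bij: "frame_action g \<in> Bij ?S" if g: "g \<in> carrier ?G" for g
  proof -
    have inv: "inv\<^bsub>?G\<^esub> g \<in> carrier ?G" using g by simp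
    have l: "inv\<^bsub>?G\<^esub> g ** g = mat 1" and r: "g ** inv\<^bsub>?G\<^esub> g = mat 1"
      using G.l_inv[OF g] G.r_inv[OF g] by simp_all
    have "bij_betw (frame_action g) ?S ?S"
      by (rule bij_betw_byWitness[where f' = "\<lambda>v. inv\<^bsub>?G\<^esub> g ** v"])
        (use g inv inS l r in \<open>auto simp: frame_action_eq_matrix_mult matrix_mul_assoc\<close>)
    then show ?thesis by (auto simp: Bij_def frame_action_def)
  qed
  have "frame_action (g ** h) = compose ?S (frame_action g) (frame_action h)"
    if g: "g \<in> carrier ?G" "h \<in> carrier ?G" for g h
  proof
    fix v :: "real^'n^'k"
    have "g ** h \<in> carrier ?G" using G.m_closed[OF g] by simp
    then show "frame_action (g ** h) v = compose ?S (frame_action g) (frame_action h) v"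
      using g inS
      by (cases "v \<in> ?S")
        (simp_all add: compose_def frame_action_eq_matrix_mult matrix_mul_assoc,
         simp add: frame_action_def)
  qed
  then have "frame_action \<in> hom ?G (BijGroup ?S)"
    using Bij by (auto simp: hom_def BijGroup_def)
  then have act: "group_action ?G ?S frame_action"
    by (simp add: group_action_def group_hom_def group_hom_axioms_def group_BijGroup
        group_signed_perm_group)
  have cont: "continuous_map stiefel_space stiefel_space (frame_action g :: real^'n^'k \<Rightarrow> _)"
    if g: "g \<in> carrier ?G" for g
  proof -
    have "continuous_on ?S (\<lambda>v. g ** v)"
      unfolding matrix_matrix_mult_def by (intro continuous_intros)
    then have "continuous_on ?S (frame_action g)"
      by (rule continuous_on_eq) (simp add: g frame_action_eq_matrix_mult)
    then show ?thesis
      using Bij[OF g] by (auto simp: stiefel_space_def Bij_def bij_betw_def)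
  qed
  have "stabilizer ?G frame_action v = {mat 1}" if v: "v \<in> ?S" for v
  proof -
    have "g = mat 1" if g: "g \<in> carrier ?G" "frame_action g v = v" for g
    proof -
      have "g ** v = v" using g v by (simp add: frame_action_eq_matrix_mult)
      then have "g ** (v ** transpose v) = v ** transpose v" by (metis matrix_mul_assoc)
      then show ?thesis using v by (simp add: stiefel_iff)
    qed
    moreover have "mat 1 \<in> carrier ?G" using G.one_closed by simp
    moreover from this have "frame_action (mat 1) v = v"
      using v by (simp add: frame_action_eq_matrix_mult)
    ultimately show ?thesis unfolding stabilizer_def by blast
  qed
  with act cont show ?thesis by (simp add: free_G_space_def)
qed

end

theory Submission
  imports Defs "HOL-Library.Z2" "HOL-Homology.Invariance_of_Domain"
begin

text \<open>
  Write \<open>d = n k - k (k + 1) / 2\<close>. The proof shows \<open>d + 1 \<le> genus \<le> cat \<le> d + 1\<close>.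

  Only the subgroup \<open>(Z/2)\<^sup>k\<close> is needed for the lower bound. A cover by \<open>d\<close> sets with equivariant maps
  to the group yields, through the row signs of these maps, \<open>d\<close> functions without common zero on the
  Stiefel manifold, of which \<open>n - i\<close> are odd in the \<open>i\<close>-th vector and even in the others. Together
  with the \<open>k (k - 1) / 2\<close> functions \<open>x\<^sub>i \<bullet> x\<^sub>j\<close> this is a system of \<open>k (n - 1)\<close> functions on
  \<open>(S\<^sup>n\<^sup>-\<^sup>1)\<^sup>k\<close>. Its number of zeros up to sign, modulo 2, is the coefficient of \<open>\<Prod>t\<^sub>i\<^sup>n\<^sup>-\<^sup>1\<close> in
  \<open>\<Prod>t\<^sub>i\<^sup>n\<^sup>-\<^sup>i \<Prod>(t\<^sub>i + t\<^sub>j)\<close>, which is 1. The count is carried out in the mod 2 complex of tuples of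
  nearby points: the cells of the product of spheres are iterated cones, and the functions act
  through Alexander--Spanier cochains recording their changes of sign. Chains are never formed;
  a cell is represented by the functional that evaluates cochains on it.

  For the middle inequality a nullhomotopy on the orbit space is lifted to the covering.

  For the upper bound, finitely many balls whose images in the orbit space are nullhomotopic are
  given radii in general position, so that no point lies on more than \<open>d\<close> of the bounding spheres.
  The points lying on exactly \<open>m\<close> of them are contained in a disjoint union of open sets, each
  of which is contained in one of the (slightly enlarged) balls; \<open>m = 0, \<dots>, d\<close> gives \<open>d + 1\<close> sets.
\<close>

section \<open>Cells made of small tuples of points\<close>

text \<open>The functions produced by a cover are only continuous, so their zeros cannot be counted
  by transversality. The polynomial coefficient enters through Stokes instead. Let
  \<open>e(a)\<close> be the product cell of dimensions \<open>a i\<close>, whose boundary mod 2 is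
  the sum over \<open>i\<close> of \<open>(1 + g i) e(a - 1_i)\<close>. If the label
  \<open>s\<close> changes under \<open>g i\<close> exactly for \<open>i\<close> in \<open>T\<close>
  and \<open>w\<close> is an invariant cocycle, then the product of the coboundary of
  \<open>s\<close> with \<open>w\<close> has on \<open>e(a)\<close> the value
  \<open>sum over i in T of w(e(a - 1_i))\<close>. So each label acts as a factor
  \<open>sum over i in T of t_i\<close>. A nonzero value yields one small tuple on which all labels
  change, and there all functions are almost zero. Labels of signs are not continuous, hence
  cochains on finite tuples of close points. Two obstacles shape the upper bound. Distances to
  orbits are Lipschitz but not smooth, so levels in general position come from counting boxes and
  not from Sard's theorem. Disjoint pieces must be contracted to one common point, but for
  \<open>k = n\<close> the Stiefel manifold is disconnected; the quotient is connected because an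
  average of determinants over all sign choices is nonzero.\<close>

fun cobd :: "('x list \<Rightarrow> bit) \<Rightarrow> 'x list \<Rightarrow> bit" where
  "cobd \<phi> [] = 0"
| "cobd \<phi> (x # xs) = \<phi> xs + cobd (\<lambda>ys. \<phi> (x # ys)) xs"

text \<open>The transpose of the prism operator for one step of a homotopy, from \<open>f\<close> to \<open>f'\<close>.\<close>

fun prism :: "('x \<Rightarrow> 'x) \<Rightarrow> ('x \<Rightarrow> 'x) \<Rightarrow> ('x list \<Rightarrow> bit) \<Rightarrow> 'x list \<Rightarrow> bit" where
  "prism f f' \<phi> [] = 0"
| "prism f f' \<phi> (x # xs) = \<phi> (f x # map f' (x # xs)) + prism f f' (\<lambda>ys. \<phi> (f x # ys)) xs"

declare add_bit_eq_xor [simp del] mult_bit_eq_and [simp del]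

lemma bit_add_self [simp]: "a + a = (0::bit)"
  by (cases a) simp_all

lemma bit_add_self_left [simp]: "a + (a + b) = (b::bit)"
  by (cases a; cases b) simp_all

lemma cobd_add: "cobd (\<lambda>xs. \<phi> xs + \<psi> xs) xs = cobd \<phi> xs + cobd \<psi> xs"
  by (induction xs arbitrary: \<phi> \<psi>) (simp_all add: ac_simps)

lemma cobd_zero: "cobd (\<lambda>xs. 0) xs = 0"
  by (induction xs) simp_all

lemma cobd_sum: "cobd (\<lambda>xs. \<Sum>l\<in>A. \<phi> l xs) xs = (\<Sum>l\<in>A. cobd (\<phi> l) xs)"
  by (induction A rule: infinite_finite_induct) (simp_all add: cobd_zero cobd_add)

lemma cobd_map: "cobd (\<lambda>xs. \<phi> (map f xs)) xs = cobd \<phi> (map f xs)"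
  by (induction xs arbitrary: \<phi>) simp_all

lemma prism_add: "prism f f' (\<lambda>xs. \<phi> xs + \<psi> xs) xs = prism f f' \<phi> xs + prism f f' \<psi> xs"
  by (induction xs arbitrary: \<phi> \<psi>) (simp_all add: ac_simps)

lemma prism_map:
  assumes "\<And>x. g (f x) = f (g x)" "\<And>x. g (f' x) = f' (g x)"
  shows "prism f f' (\<lambda>xs. \<phi> (map g xs)) xs = prism f f' \<phi> (map g xs)"
  by (induction xs arbitrary: \<phi>) (simp_all add: assms comp_def)

text \<open>Dual of the boundary formula of a prism: mod 2 the inner faces cancel in pairs and the
  two ends remain.\<close>

lemma prism_cobd:
  "cobd (prism f f' \<phi>) xs + prism f f' (cobd \<phi>) xs = \<phi> (map f xs) + \<phi> (map f' xs)"
proof (induction xs arbitrary: \<phi>)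
  case (Cons x xs)
  let ?\<rho> = "\<lambda>ys. \<phi> (f x # ys)"
  have "cobd (\<lambda>ys. prism f f' \<phi> (x # ys)) xs
      = cobd (\<lambda>ys. \<phi> (f x # f' x # ys)) (map f' xs) + cobd (prism f f' ?\<rho>) xs"
    using cobd_map[of "\<lambda>ys. \<phi> (f x # f' x # ys)" f' xs] by (simp add: cobd_add)
  moreover have "prism f f' (\<lambda>ys. cobd \<phi> (f x # ys)) xs = prism f f' \<phi> xs + prism f f' (cobd ?\<rho>) xs"
    by (simp add: prism_add)
  ultimately show ?case using Cons.IH[of ?\<rho>] by (simp add: ac_simps)
qed simp

lemma bit_telescope: "(\<Sum>l<L. a l + a (Suc l)) = a 0 + (a L :: bit)"
  by (induction L) (simp_all add: ac_simps)

text \<open>Here \<open>g i\<close> is the sign change of factor \<open>i\<close>, and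
  \<open>h i b 0, ..., h i b L\<close> are the stages of a contraction of factor \<open>i\<close> to
  its vertex number \<open>b\<close>. By \<open>h_L\<close> the last stage forgets the sign of that
  factor, which has become constant. The contraction is cut into finitely many stages so that each
  single prism can be made small.\<close>

locale small_chains =
  fixes g :: "'i \<Rightarrow> 'x \<Rightarrow> 'x" and h :: "'i \<Rightarrow> nat \<Rightarrow> nat \<Rightarrow> 'x \<Rightarrow> 'x" and L :: nat and p :: 'x
  assumes g_g: "g i (g i x) = x" and g_comm: "g i (g j x) = g j (g i x)"
    and h_0: "h i b 0 x = x" and h_L: "h i b L (g i x) = h i b L x"
    and h_g: "i \<noteq> j \<Longrightarrow> g j (h i b l x) = h i b l (g j x)"
begin

definition symm :: "'i \<Rightarrow> ('x list \<Rightarrow> bit) \<Rightarrow> 'x list \<Rightarrow> bit" where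
  "symm i \<phi> = (\<lambda>xs. \<phi> xs + \<phi> (map (g i) xs))"

definition cone :: "'i \<Rightarrow> nat \<Rightarrow> ('x list \<Rightarrow> bit) \<Rightarrow> 'x list \<Rightarrow> bit" where
  "cone i b \<phi> = (\<lambda>xs. \<Sum>l<L. prism (h i b l) (h i b (Suc l)) \<phi> xs)"

text \<open>Transpose of the recursion \<open>e(b+1) = cone (e(b) + g e(b))\<close>: a hemisphere is
  a cone over the sphere formed by two copies of the preceding one. Acting on cochains reverses the
  order of the operators.\<close>

fun cap :: "'i \<Rightarrow> nat \<Rightarrow> ('x list \<Rightarrow> bit) \<Rightarrow> 'x list \<Rightarrow> bit" where
  "cap i 0 \<phi> = \<phi>"
| "cap i (Suc b) \<phi> = cap i b (symm i (cone i (Suc b) \<phi>))"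

text \<open>The list is consumed from the cochain side, so its head is the factor attached last to
  the base point \<open>p\<close>.\<close>

fun eval_cell :: "'i list \<Rightarrow> ('i \<Rightarrow> nat) \<Rightarrow> ('x list \<Rightarrow> bit) \<Rightarrow> bit" where
  "eval_cell [] a \<phi> = \<phi> [p]"
| "eval_cell (i # is) a \<phi> = eval_cell is a (cap i (a i) \<phi>)"

lemma symm_add: "symm i (\<lambda>xs. \<phi> xs + \<psi> xs) = (\<lambda>xs. symm i \<phi> xs + symm i \<psi> xs)"
  by (simp add: symm_def ac_simps)

lemma cone_add: "cone i b (\<lambda>xs. \<phi> xs + \<psi> xs) = (\<lambda>xs. cone i b \<phi> xs + cone i b \<psi> xs)"
  by (simp add: cone_def prism_add sum.distrib)

lemma cap_add: "cap i b (\<lambda>xs. \<phi> xs + \<psi> xs) = (\<lambda>xs. cap i b \<phi> xs + cap i b \<psi> xs)"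
  by (induction b arbitrary: \<phi> \<psi>) (simp_all add: cone_add symm_add)

lemma eval_cell_add: "eval_cell is a (\<lambda>xs. \<phi> xs + \<psi> xs) = eval_cell is a \<phi> + eval_cell is a \<psi>"
  by (induction "is" arbitrary: \<phi> \<psi>) (simp_all add: cap_add)

lemma symm_symm_self: "symm i (symm i \<phi>) = (\<lambda>xs. 0)"
  by (simp add: symm_def fun_eq_iff comp_def g_g ac_simps)

lemma symm_commute: "symm i (symm j \<phi>) = symm j (symm i \<phi>)"
proof -
  have "map (g i) (map (g j) xs) = map (g j) (map (g i) xs)" for xs
    by (simp add: g_comm)
  then show ?thesis by (simp add: symm_def fun_eq_iff ac_simps del: map_map)
qed

lemma cone_symm: "j \<noteq> i \<Longrightarrow> cone i b (symm j \<phi>) = symm j (cone i b \<phi>)"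
  unfolding symm_def cone_def
  by (simp add: prism_add sum.distrib prism_map h_g fun_eq_iff)

lemma cap_symm: "j \<noteq> i \<Longrightarrow> cap i b (symm j \<phi>) = symm j (cap i b \<phi>)"
  by (induction b arbitrary: \<phi>) (simp_all add: cone_symm symm_commute[of i j])

lemma cobd_symm: "cobd (symm i \<phi>) = symm i (cobd \<phi>)"
  by (simp add: symm_def fun_eq_iff cobd_add cobd_map)

lemma cobd_cone: "cobd (cone i b \<phi>) xs + cone i b (cobd \<phi>) xs = \<phi> xs + \<phi> (map (h i b L) xs)"
proof -
  have "cobd (cone i b \<phi>) xs + cone i b (cobd \<phi>) xs
     = (\<Sum>l<L. \<phi> (map (h i b l) xs) + \<phi> (map (h i b (Suc l)) xs))"
    by (simp add: cone_def cobd_sum prism_cobd flip: sum.distrib)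
  also have "\<dots> = \<phi> (map (h i b 0) xs) + \<phi> (map (h i b L) xs)"
    by (rule bit_telescope)
  finally show ?thesis by (simp add: h_0 map_idI)
qed

text \<open>Symmetrizing removes the far end of the cone: the last stage agrees on \<open>x\<close>
  and \<open>g i x\<close>, so its two contributions cancel mod 2. Only the base of the cone is
  left.\<close>

lemma symm_cone_cobd: "symm i (cone i b (cobd \<phi>)) = (\<lambda>xs. cobd (symm i (cone i b \<phi>)) xs + symm i \<phi> xs)"
proof
  fix xs
  have *: "cone i b (cobd \<phi>) xs = cobd (cone i b \<phi>) xs + (\<phi> xs + \<phi> (map (h i b L) xs))" for xs
    using cobd_cone[of i b \<phi> xs] by (metis bit_add_self_left)
  have "\<phi> (map (\<lambda>x. h i b L (g i x)) xs) = \<phi> (map (h i b L) xs)" by (simp add: h_L)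
  then show "symm i (cone i b (cobd \<phi>)) xs = cobd (symm i (cone i b \<phi>)) xs + symm i \<phi> xs"
    by (simp add: cobd_symm) (simp only: symm_def * ac_simps comp_def map_map bit_add_self bit_add_self_left add_0_right)
qed

lemma cap_zero: "cap i b (\<lambda>xs. 0) = (\<lambda>xs. 0)"
  using cap_add[of i b "\<lambda>_. 0" "\<lambda>_. 0"] by simp

lemma eval_cell_zero: "eval_cell is a (\<lambda>xs. 0) = 0"
  using eval_cell_add[of "is" a "\<lambda>_. 0" "\<lambda>_. 0"] by simp

text \<open>The first summand carries the boundary of what the cell is attached to, the second one
  the base of the last cone. The boundary of that base inside factor \<open>i\<close> drops out
  because \<open>symm i\<close> squares to zero mod 2.\<close>

lemma cap_cobd:
  "cap i b (cobd \<phi>) = (\<lambda>xs. cobd (cap i b \<phi>) xs + (if b = 0 then 0 else cap i (b - 1) (symm i \<phi>) xs))"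
proof (induction b arbitrary: \<phi>)
  case (Suc b)
  let ?c = "symm i (cone i (Suc b) \<phi>)"
  have "cap i (Suc b) (cobd \<phi>) = (\<lambda>xs. cap i b (cobd ?c) xs + cap i b (symm i \<phi>) xs)"
    by (simp add: symm_cone_cobd cap_add)
  also have "cap i b (cobd ?c) = cobd (cap i b ?c)"
    unfolding Suc.IH[of ?c] symm_symm_self cap_zero by simp
  finally show ?case by simp
qed simp

lemma eval_cell_cong: "(\<And>j. j \<in> set is \<Longrightarrow> a j = a' j) \<Longrightarrow> eval_cell is a \<phi> = eval_cell is a' \<phi>"
  by (induction "is" arbitrary: \<phi>) simp_all

lemma cap_Nil: "\<phi> [] = 0 \<Longrightarrow> cap i b \<phi> [] = 0"
  by (induction b arbitrary: \<phi>) (simp_all add: symm_def cone_def)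

text \<open>The equivariant cell structure of a product of spheres, as seen by cochains.\<close>

lemma eval_cell_cobd:
  assumes "distinct is" "\<phi> [] = 0"
  shows "eval_cell is a (cobd \<phi>)
    = (\<Sum>j\<in>{j \<in> set is. a j \<noteq> 0}. eval_cell is (a(j := a j - 1)) (symm j \<phi>))"
  using assms
proof (induction "is" arbitrary: \<phi>)
  case Nil
  then show ?case by simp
next
  case (Cons i "is")
  then have i: "i \<notin> set is" and "distinct is" by auto
  \<comment> \<open>The complex is augmented, \<open>cobd \<phi> [x] = \<phi> []\<close>; without a
    value 0 on the empty tuple the base point would contribute a boundary.\<close>
  have "cap i (a i) \<phi> [] = 0" using Cons.prems(2) by (rule cap_Nil)
  then have "eval_cell is a (cobd (cap i (a i) \<phi>))
    = (\<Sum>j\<in>{j \<in> set is. a j \<noteq> 0}. eval_cell is (a(j := a j - 1)) (symm j (cap i (a i) \<phi>)))"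
    by (rule Cons.IH[OF \<open>distinct is\<close>])
  also have "\<dots> = (\<Sum>j\<in>{j \<in> set is. a j \<noteq> 0}. eval_cell (i # is) (a(j := a j - 1)) (symm j \<phi>))"
  proof (rule sum.cong)
    fix j assume "j \<in> {j \<in> set is. a j \<noteq> 0}"
    then have "j \<noteq> i" using i by auto
    then show "eval_cell is (a(j := a j - 1)) (symm j (cap i (a i) \<phi>))
        = eval_cell (i # is) (a(j := a j - 1)) (symm j \<phi>)"
      by (simp add: cap_symm)
  qed simp
  finally have tl: "eval_cell is a (cobd (cap i (a i) \<phi>)) = \<dots>" .
  have hd: "eval_cell is a (cap i (a i - 1) (symm i \<phi>)) = eval_cell (i # is) (a(i := a i - 1)) (symm i \<phi>)"
    using i by (simp, intro eval_cell_cong) auto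
  have split: "{j \<in> set (i # is). a j \<noteq> 0} = {j \<in> set is. a j \<noteq> 0} \<union> (if a i = 0 then {} else {i})"
    by auto
  have "eval_cell (i # is) a (cobd \<phi>) = eval_cell is a (cobd (cap i (a i) \<phi>))
      + (if a i = 0 then 0 else eval_cell is a (cap i (a i - 1) (symm i \<phi>)))"
    by (simp add: cap_cobd eval_cell_add eval_cell_zero)
  then show ?case
    unfolding split tl hd using i by (cases "a i = 0") (simp_all del: eval_cell.simps add: add.commute fun_upd_def)
qed

end

section \<open>Cup products of coboundaries of labels\<close>

lemma cobd_mult: "cobd (\<lambda>xs. c * \<phi> xs) xs = c * cobd \<phi> xs"
  by (induction xs arbitrary: \<phi>) (simp_all add: distrib_left)

lemma cobd_cobd: "cobd (cobd \<phi>) xs = 0"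
  by (induction xs arbitrary: \<phi>) (simp_all add: cobd_add)

text \<open>The Alexander--Spanier cup product of the coboundaries of the labels. The empty product
  is the unit cochain, 1 on single points and 0 on tuples of any other length.\<close>

fun odd_cochain :: "(('x \<Rightarrow> bit) list) \<Rightarrow> 'x list \<Rightarrow> bit" where
  "odd_cochain [] xs = (if length xs = 1 then 1 else 0)"
| "odd_cochain (s # ss) (x # y # xs) = (s x + s y) * odd_cochain ss (y # xs)"
| "odd_cochain (s # ss) [] = 0"
| "odd_cochain (s # ss) [x] = 0"

lemma odd_cochain_Nil [simp]: "odd_cochain ss [] = 0"
  by (cases ss) simp_all

text \<open>Leibniz rule: for closed \<open>w\<close> the coboundary of the product of
  \<open>s\<close> with \<open>w\<close> is the product of the coboundary of \<open>s\<close> with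
  \<open>w\<close>. Closedness then follows from \<open>cobd_cobd\<close>, so both claims go through
  one induction, with \<open>step\<close> passing from the first to the second.\<close>

lemma cobd_odd_cochain:
  "cobd (odd_cochain ss) xs = 0"
  "odd_cochain (s # ss) = cobd (\<lambda>xs. s (hd xs) * odd_cochain ss xs)"
proof -
  have step: "odd_cochain (s # ss) = cobd (\<lambda>xs. s (hd xs) * odd_cochain ss xs)"
    if "\<And>xs. cobd (odd_cochain ss) xs = 0" for s and ss :: "('x \<Rightarrow> bit) list"
  proof
    fix xs :: "'x list"
    show "odd_cochain (s # ss) xs = cobd (\<lambda>xs. s (hd xs) * odd_cochain ss xs) xs"
    proof (cases xs)
      case (Cons x ys)
      have "cobd (\<lambda>ys. odd_cochain ss (x # ys)) ys = odd_cochain ss ys"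
        using that[of "x # ys"] by (metis bit_add_self_left add.right_neutral cobd.simps(2))
      then show ?thesis
        using Cons by (cases ys) (simp_all add: cobd_mult distrib_right ac_simps)
    qed simp
  qed
  have cl: "cobd (odd_cochain ss) xs = 0" for xs and ss :: "('x \<Rightarrow> bit) list"
  proof (induction ss arbitrary: xs)
    case Nil
    show ?case
    proof (cases xs)
      case (Cons x ys)
      then show ?thesis by (cases ys; cases "tl ys") (simp_all add: cobd_zero)
    qed simp
  next
    case (Cons s ss)
    then show ?case by (simp add: step cobd_cobd)
  qed
  show "cobd (odd_cochain ss) xs = 0" by (rule cl)
  show "odd_cochain (s # ss) = cobd (\<lambda>xs. s (hd xs) * odd_cochain ss xs)" by (rule step) (rule cl)
qed

lemma odd_cochain_changes:
  "odd_cochain ss xs \<noteq> 0 \<Longrightarrow> s \<in> set ss \<Longrightarrow> \<exists>x\<in>set xs. \<exists>y\<in>set xs. s x \<noteq> s y"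
proof (induction ss xs rule: odd_cochain.induct)
  case (2 s' ss x y xs)
  then have ne: "s' x + s' y \<noteq> 0" "odd_cochain ss (y # xs) \<noteq> 0" by auto
  have "s' x \<noteq> s' y"
  proof
    assume "s' x = s' y"
    then show False using ne(1) by simp
  qed
  then show ?case
    using 2(1)[OF ne(2)] 2(3) by (metis list.set_intros set_ConsD)
qed auto

text \<open>A constant shift of a label cancels in each difference \<open>s x + s y\<close>.\<close>

lemma odd_cochain_map:
  assumes "\<And>s. s \<in> set ss \<Longrightarrow> \<exists>c. \<forall>x\<in>set xs. s (g x) = s x + c"
  shows "odd_cochain ss (map g xs) = odd_cochain ss xs"
  using assms
proof (induction ss xs rule: odd_cochain.induct)
  case (2 s ss x y xs)
  obtain c where "\<forall>z\<in>set (x # y # xs). s (g z) = s z + c" using 2(2)[of s] by auto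
  then have "s (g x) + s (g y) = s x + s y" by (simp add: ac_simps)
  moreover have "odd_cochain ss (map g (y # xs)) = odd_cochain ss (y # xs)"
  proof (rule 2(1))
    show "\<exists>c. \<forall>x\<in>set (y # xs). s (g x) = s x + c" if "s \<in> set ss" for s
      using 2(2)[of s] that by auto
  qed
  ultimately show ?case by simp
qed auto

lemma prism_cong:
  assumes "\<And>ys. \<lbrakk>length ys = Suc (length xs); set ys \<subseteq> f ` set xs \<union> f' ` set xs\<rbrakk> \<Longrightarrow> \<phi> ys = \<phi>' ys"
  shows "prism f f' \<phi> xs = prism f f' \<phi>' xs"
  using assms
proof (induction xs arbitrary: \<phi> \<phi>')
  case (Cons x xs)
  have "\<phi> (f x # map f' (x # xs)) = \<phi>' (f x # map f' (x # xs))"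
    by (rule Cons.prems) auto
  moreover have "prism f f' (\<lambda>ys. \<phi> (f x # ys)) xs = prism f f' (\<lambda>ys. \<phi>' (f x # ys)) xs"
    by (rule Cons.IH, rule Cons.prems) auto
  ultimately show ?case by simp
qed simp

text \<open>More than an odd coefficient: every factor leaves exactly one index whose exponent can
  be lowered, so the expansion has a single path to the monomial and no sum has to be
  evaluated.\<close>

fun reduces :: "'i list \<Rightarrow> 'i set list \<Rightarrow> ('i \<Rightarrow> nat) \<Rightarrow> bool" where
  "reduces is [] a \<longleftrightarrow> (\<forall>i\<in>set is. a i = 0)"
| "reduces is (T # Ts) a \<longleftrightarrow> (\<exists>j. {i \<in> set is. i \<in> T \<and> a i \<noteq> 0} = {j} \<and> reduces is Ts (a(j := a j - 1)))"

text \<open>\<open>D a\<close> plays the role of the product of skeleta of dimensions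
  \<open>a i\<close>, \<open>B\<close> bounds these dimensions, and \<open>K\<close> bounds the
  displacement by one stage. Stages and sign changes do not increase distances, so the diameter of a
  tuple grows only through the passage between consecutive stages.\<close>

locale small_cells = small_chains g h L p
  for g :: "'i \<Rightarrow> 'x::metric_space \<Rightarrow> 'x" and h L p +
  fixes D :: "('i \<Rightarrow> nat) \<Rightarrow> 'x set" and B :: nat and K :: real
  assumes p_D: "p \<in> D (\<lambda>_. 0)" and g_D: "x \<in> D a \<Longrightarrow> g i x \<in> D a"
    and h_D: "x \<in> D a \<Longrightarrow> a i < B \<Longrightarrow> l \<le> L \<Longrightarrow> h i (Suc (a i)) l x \<in> D (a(i := Suc (a i)))"
    and g_dist: "dist (g i x) (g i y) \<le> dist x y"
    and h_dist: "x \<in> D a \<Longrightarrow> y \<in> D a \<Longrightarrow> l \<le> L \<Longrightarrow> dist (h i b l x) (h i b l y) \<le> dist x y"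
    and h_step: "x \<in> D a \<Longrightarrow> l < L \<Longrightarrow> dist (h i b l x) (h i b (Suc l) x) \<le> K"
begin

text \<open>A tuple of \<open>n + 1\<close> points arises from one point by \<open>n\<close> prisms,
  and each prism adds one point and at most \<open>K\<close> to the diameter.\<close>

definition small :: "('i \<Rightarrow> nat) \<Rightarrow> nat \<Rightarrow> 'x list \<Rightarrow> bool" where
  "small a n xs \<longleftrightarrow> length xs = Suc n \<and> set xs \<subseteq> D a \<and> (\<forall>x\<in>set xs. \<forall>y\<in>set xs. dist x y \<le> n * K)"

lemma small_map_g: "small a n xs \<Longrightarrow> small a n (map (g i) xs)"
  using g_D g_dist unfolding small_def by (auto, meson order_trans)

lemma small_step:
  assumes xs: "small a n xs" and B: "a i < B" and l: "l < L" and ys: "length ys = Suc (length xs)"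
    "set ys \<subseteq> h i (Suc (a i)) l ` set xs \<union> h i (Suc (a i)) (Suc l) ` set xs"
  shows "small (a(i := Suc (a i))) (Suc n) ys"
proof -
  let ?h = "\<lambda>l. h i (Suc (a i)) l"
  have D: "x \<in> D a" if "x \<in> set xs" for x using xs that by (auto simp: small_def)
  have xy: "dist x y \<le> n * K" if "x \<in> set xs" "y \<in> set xs" for x y using xs that by (auto simp: small_def)
  have K: "0 \<le> K" using h_step[OF p_D l] zero_le_dist order_trans by blast
  have 1: "dist (?h l' x) (?h l' y) \<le> n * K" if "x \<in> set xs" "y \<in> set xs" "l' \<le> L" for x y l'
    using h_dist[OF D D that(3)] that xy order_trans by blast
  have 2: "dist (?h l x) (?h (Suc l) y) \<le> n * K + K" if "x \<in> set xs" "y \<in> set xs" for x y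
    using dist_triangle[of "?h l x" "?h (Suc l) y" "?h (Suc l) x"] h_step[OF D l] 1[of x y "Suc l"] that l
    by (smt (verit, ccfv_SIG) Suc_leI)
  have "dist x y \<le> Suc n * K" if "x \<in> set ys" "y \<in> set ys" for x y
  proof -
    have "x \<in> ?h l ` set xs \<union> ?h (Suc l) ` set xs" "y \<in> ?h l ` set xs \<union> ?h (Suc l) ` set xs"
      using that ys by auto
    then obtain u v where "u \<in> set xs" "v \<in> set xs"
      "x = ?h l u \<or> x = ?h (Suc l) u" "y = ?h l v \<or> y = ?h (Suc l) v"
      by auto
    then have "dist x y \<le> n * K + K"
      using 1[of u v l] 1[of u v "Suc l"] 2[of u v] 2[of v u] l K by (auto simp: dist_commute)
    then show ?thesis by (simp add: algebra_simps)
  qed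
  moreover have "set ys \<subseteq> D (a(i := Suc (a i)))"
    using ys(2) h_D[OF D B] l by fastforce
  ultimately show ?thesis using ys(1) xs by (simp add: small_def)
qed

lemma cap_cong:
  assumes "\<And>ys. small (a(i := b)) (n + b) ys \<Longrightarrow> \<phi> ys = \<phi>' ys" "small a n xs" "a i = 0" "b \<le> B"
  shows "cap i b \<phi> xs = cap i b \<phi>' xs"
  using assms(1,4)
proof (induction b arbitrary: \<phi> \<phi>')
  case 0
  moreover have "a(i := 0) = a" using assms(3) by auto
  ultimately show ?case using assms(2) by (metis add_0_right cap.simps(1))
next
  case (Suc b)
  have cone: "cone i (Suc b) \<phi> ys = cone i (Suc b) \<phi>' ys" if "small (a(i := b)) (n + b) ys" for ys
    unfolding cone_def
  proof (intro sum.cong refl prism_cong)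
    fix l zs
    assume "l \<in> {..<L}" "length zs = Suc (length ys)"
      "set zs \<subseteq> h i (Suc b) l ` set ys \<union> h i (Suc b) (Suc l) ` set ys"
    then have "small ((a(i := b))(i := Suc b)) (Suc (n + b)) zs"
      using small_step[OF that, of i l zs] Suc.prems(2) by simp
    then show "\<phi> zs = \<phi>' zs" by (intro Suc.prems(1)) (simp only: fun_upd_upd add_Suc_right)
  qed
  have "cap i b (symm i (cone i (Suc b) \<phi>)) xs = cap i b (symm i (cone i (Suc b) \<phi>')) xs"
  proof (rule Suc.IH)
    fix ys assume ys: "small (a(i := b)) (n + b) ys"
    then show "symm i (cone i (Suc b) \<phi>) ys = symm i (cone i (Suc b) \<phi>') ys"
      unfolding symm_def using cone[OF ys] cone[OF small_map_g[OF ys]] by (simp only:)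
  qed (use Suc.prems(2) in simp)
  then show ?case by simp
qed

text \<open>This replaces the support of a chain: evaluation cannot distinguish cochains that agree
  on small tuples. Factors outside the list have not been built yet and keep dimension 0.\<close>

lemma eval_cell_small_cong:
  assumes "distinct is" "\<And>i. i \<in> set is \<Longrightarrow> a i \<le> B"
    and "\<And>xs. small (\<lambda>j. if j \<in> set is then a j else 0) (sum a (set is)) xs \<Longrightarrow> \<phi> xs = \<phi>' xs"
  shows "eval_cell is a \<phi> = eval_cell is a \<phi>'"
  using assms
proof (induction "is" arbitrary: \<phi> \<phi>')
  case Nil
  then show ?case using p_D by (simp add: small_def)
next
  case (Cons i "is")
  let ?a = "\<lambda>j. if j \<in> set is then a j else 0"
  have i: "i \<notin> set is" using Cons.prems by simp
  have e: "?a(i := a i) = (\<lambda>j. if j \<in> set (i # is) then a j else 0)" by auto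
  have "cap i (a i) \<phi> xs = cap i (a i) \<phi>' xs" if "small ?a (sum a (set is)) xs" for xs
  proof (rule cap_cong[OF _ that])
    fix ys assume "small (?a(i := a i)) (sum a (set is) + a i) ys"
    moreover have "sum a (set is) + a i = sum a (set (i # is))" using i by simp
    ultimately show "\<phi> ys = \<phi>' ys" unfolding e by (intro Cons.prems(3)) simp
  qed (use i Cons.prems(2) in simp_all)
  then have "eval_cell is a (cap i (a i) \<phi>) = eval_cell is a (cap i (a i) \<phi>')"
    using Cons.prems(1,2) by (intro Cons.IH) simp_all
  then show ?case by simp
qed

text \<open>The remaining product \<open>w\<close> is invariant under \<open>g i\<close> on each
  small tuple, so symmetrizing \<open>s\<close> times \<open>w\<close> gives
  \<open>(s (g i x) + s x) w\<close>, which is \<open>w\<close> for \<open>i\<close> in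
  \<open>T\<close> and 0 otherwise. Of the boundary cells only those with \<open>i\<close> in
  \<open>T\<close> survive, and \<open>reduces\<close> leaves one of them.\<close>

lemma eval_cell_odd_cochain:
  assumes "distinct is" "reduces is Ts a" "\<And>i. i \<in> set is \<Longrightarrow> a i \<le> B"
    and "list_all2 (\<lambda>s T. \<forall>a. \<forall>x\<in>D a. \<forall>i. s (g i x) = s x + of_bool (i \<in> T)) ss Ts"
  shows "eval_cell is a (odd_cochain ss) = 1"
  using assms(4,2,3)
proof (induction arbitrary: a rule: list_all2_induct)
  case Nil
  have "eval_cell is a \<phi> = \<phi> [p]" for \<phi>
    using Nil by (induction "is" arbitrary: \<phi>) simp_all
  then show ?case by simp
next
  case (Cons s ss T Ts)
  obtain j where j: "{i \<in> set is. i \<in> T \<and> a i \<noteq> 0} = {j}" "reduces is Ts (a(j := a j - 1))"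
    using Cons.prems by auto
  let ?\<phi> = "\<lambda>xs. s (hd xs) * odd_cochain ss xs"
  have sy: "eval_cell is a' (symm i ?\<phi>) = (if i \<in> T then eval_cell is a' (odd_cochain ss) else 0)"
    if "\<And>i. i \<in> set is \<Longrightarrow> a' i \<le> B" for i a'
  proof -
    have "symm i ?\<phi> xs = (if i \<in> T then odd_cochain ss xs else 0)"
      if xs: "small b n xs" for b n xs
    proof -
      have D: "set xs \<subseteq> D b" "xs \<noteq> []" using xs by (auto simp: small_def)
      have "odd_cochain ss (map (g i) xs) = odd_cochain ss xs"
      proof (rule odd_cochain_map)
        fix s' assume "s' \<in> set ss"
        then obtain m where m: "m < length ss" "s' = ss ! m" by (auto simp: in_set_conv_nth)
        then have "\<forall>x\<in>set xs. s' (g i x) = s' x + of_bool (i \<in> Ts ! m)"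
          using list_all2_nthD[OF Cons.hyps(2), of m] D(1) by blast
        then show "\<exists>c. \<forall>x\<in>set xs. s' (g i x) = s' x + c" by blast
      qed
      moreover have "s (g i (hd xs)) = s (hd xs) + of_bool (i \<in> T)"
        using Cons.hyps(1) D hd_in_set by blast
      ultimately show ?thesis
        using D(2) by (auto simp: symm_def hd_map distrib_right)
    qed
    then have "eval_cell is a' (symm i ?\<phi>) = eval_cell is a' (\<lambda>xs. if i \<in> T then odd_cochain ss xs else 0)"
      by (intro eval_cell_small_cong assms that) blast
    then show ?thesis by (auto simp: eval_cell_zero)
  qed
  have "eval_cell is a (odd_cochain (s # ss))
    = (\<Sum>i\<in>{i \<in> set is. a i \<noteq> 0}. eval_cell is (a(i := a i - 1)) (symm i ?\<phi>))"
    unfolding cobd_odd_cochain(2) by (intro eval_cell_cobd assms) simp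
  also have "\<dots> = (\<Sum>i\<in>{i \<in> set is. i \<in> T \<and> a i \<noteq> 0}. eval_cell is (a(i := a i - 1)) (odd_cochain ss))"
  proof -
    have "eval_cell is (a(i := a i - 1)) (symm i ?\<phi>)
        = (if i \<in> T then eval_cell is (a(i := a i - 1)) (odd_cochain ss) else 0)" for i
      by (rule sy) (use Cons.prems(2) in \<open>auto simp: le_diff_conv intro: le_SucI\<close>)
    then show ?thesis by (intro sum.mono_neutral_cong_right) (auto split: if_splits)
  qed
  also have "\<dots> = eval_cell is (a(j := a j - 1)) (odd_cochain ss)"
    unfolding j(1) by (simp add: fun_upd_def)
  also have "\<dots> = 1"
    by (rule Cons.IH[OF j(2)]) (use Cons.prems(2) in \<open>auto simp: le_diff_conv intro: le_SucI\<close>)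
  finally show ?case .
qed

text \<open>If the product vanished on all small tuples its value on the cell would be 0 and not 1.
  A tuple on which a product of differences is nonzero contains a change of every label.\<close>

theorem small_tuple_all_change:
  fixes ss :: "('x \<Rightarrow> bit) list"
  assumes "distinct is" "reduces is Ts a" "\<And>i. i \<in> set is \<Longrightarrow> a i \<le> B"
    and "list_all2 (\<lambda>s T. \<forall>a. \<forall>x\<in>D a. \<forall>i. s (g i x) = s x + of_bool (i \<in> T)) ss Ts"
  shows "\<exists>xs. small (\<lambda>j. if j \<in> set is then a j else 0) (sum a (set is)) xs \<and>
    (\<forall>s\<in>set ss. \<exists>x\<in>set xs. \<exists>y\<in>set xs. s x \<noteq> s y)"
proof -
  let ?a = "\<lambda>j. if j \<in> set is then a j else 0"
  have "\<exists>xs. small ?a (sum a (set is)) xs \<and> odd_cochain ss xs \<noteq> 0"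
  proof (rule ccontr)
    assume "\<not> ?thesis"
    then have "odd_cochain ss xs = 0" if "small ?a (sum a (set is)) xs" for xs
      using that by blast
    then have "eval_cell is a (odd_cochain ss) = eval_cell is a (\<lambda>xs. 0)"
      using assms(3) by (intro eval_cell_small_cong[OF assms(1)]) auto
    then show False using eval_cell_odd_cochain[OF assms] by (simp add: eval_cell_zero)
  qed
  then show ?thesis using odd_cochain_changes by blast
qed

end

section \<open>A Borsuk--Ulam theorem for products of spheres\<close>

definition flip_row :: "'k \<Rightarrow> real^'n^'k \<Rightarrow> real^'n^'k" where
  "flip_row i x = (\<chi> j. if j = i then - (x $ j) else x $ j)"

lemma flip_row_flip_row [simp]: "flip_row i (flip_row i x) = x"
  by (simp add: flip_row_def vec_eq_iff)

lemma dist_flip_row: "dist (flip_row i x) (flip_row i y) = dist x (y :: real^'n^'k)"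
proof -
  have *: "dist (flip_row i x) (flip_row i y) \<le> dist x y" for x y :: "real^'n^'k"
    unfolding dist_norm
    by (rule norm_le_componentwise_cart) (simp add: flip_row_def norm_minus_commute)
  from *[of x y] *[of "flip_row i x" "flip_row i y"] show ?thesis by simp
qed

definition slide_row :: "'k \<Rightarrow> real^'n \<Rightarrow> real \<Rightarrow> real^'n^'k \<Rightarrow> real^'n^'k" where
  "slide_row i u t x = (\<chi> j. if j = i then (1 - t) *\<^sub>R x $ j + t *\<^sub>R u else x $ j)"

text \<open>Spheres of the 1-norm make the cones straight: if the coordinate of the apex vanishes on
  \<open>x\<close>, the segment from \<open>x\<close> to that unit vector stays on the sphere, and
  no normalization spoils the distance estimates.\<close>

definition octahedral_product :: "(real^'n^'k) set" where
  "octahedral_product = {x. \<forall>i. (\<Sum>c\<in>UNIV. \<bar>x $ i $ c\<bar>) = 1}"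

lemma compact_octahedral_product: "compact (octahedral_product :: (real^'n^'k) set)"
proof -
  have "closed (octahedral_product :: (real^'n^'k) set)"
    unfolding octahedral_product_def
    by (intro closed_Collect_all closed_Collect_eq continuous_intros)
  moreover have "norm x \<le> CARD('k)" if "x \<in> octahedral_product" for x :: "real^'n^'k"
  proof -
    have "norm x \<le> (\<Sum>i\<in>UNIV. norm (x $ i))" by (simp add: norm_vec_def L2_set_le_sum)
    also have "\<dots> \<le> (\<Sum>i\<in>(UNIV::'k set). 1)"
    proof (rule sum_mono)
      fix i
      show "norm (x $ i) \<le> 1"
        using norm_le_l1_cart[of "x $ i"] that by (simp add: octahedral_product_def)
    qed
    finally show ?thesis by simp
  qed
  then have "bounded (octahedral_product :: (real^'n^'k) set)" by (auto intro: boundedI)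
  ultimately show ?thesis by (simp add: compact_eq_bounded_closed)
qed

lemma flip_row_octahedral: "x \<in> octahedral_product \<Longrightarrow> flip_row i x \<in> octahedral_product"
  by (simp add: octahedral_product_def flip_row_def)

lemma norm_axis_vec: "norm (axis i r :: 'a::real_normed_vector^'k) = norm r"
proof -
  have "(\<Sum>j\<in>UNIV. (norm ((axis i r :: 'a^'k) $ j))\<^sup>2) = (\<Sum>j\<in>UNIV. if j = i then (norm r)\<^sup>2 else 0)"
    by (rule sum.cong) (auto simp: axis_def)
  then show ?thesis by (simp add: norm_vec_def L2_set_def)
qed

lemma slide_row_diff: "slide_row i u t x - slide_row i u (t + s) x = axis i (s *\<^sub>R (x $ i - u))"
  by (auto simp: slide_row_def vec_eq_iff axis_def algebra_simps)

text \<open>The set for \<open>a\<close> consists of the points whose row \<open>i\<close> lives in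
  the first \<open>a i + 1\<close> coordinates, so the next apex is a coordinate that is still zero.
  The rows have norm at most 1, a segment to an apex has length at most 2, and one of
  \<open>L\<close> stages moves a point by at most \<open>2 / L\<close>.\<close>

lemma octahedral_small_cells:
  fixes en :: "nat \<Rightarrow> 'n::finite" and idn :: "'n \<Rightarrow> nat"
  assumes idn: "\<forall>b<CARD('n). idn (en b) = b" and L: "0 < L"
  shows "small_cells (flip_row :: 'k::finite \<Rightarrow> real^'n^'k \<Rightarrow> _)
    (\<lambda>i b l. slide_row i (axis (en b) 1) (real l / real L)) L (\<chi> i. axis (en 0) 1)
    (\<lambda>a. {x \<in> octahedral_product. \<forall>i c. idn c > a i \<longrightarrow> x $ i $ c = 0}) (CARD('n) - 1) (2 / real L)"
proof (standard, goal_cases)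
  case (1 i x) then show ?case by (simp add: flip_row_def vec_eq_iff)
next
  case (2 i j x) then show ?case by (simp add: flip_row_def vec_eq_iff)
next
  case (3 i b x) then show ?case by (simp add: slide_row_def vec_eq_iff)
next
  case (4 i b x) then show ?case using L by (simp add: slide_row_def flip_row_def vec_eq_iff)
next
  case (5 i j b l x) then show ?case by (simp add: slide_row_def flip_row_def vec_eq_iff)
next
  case 6
  have "(\<Sum>c\<in>UNIV. \<bar>axis (en 0) 1 $ c\<bar>) = (1::real)"
    by (simp add: axis_def if_distrib[of abs] cong: if_cong)
  moreover have "idn c \<noteq> 0 \<Longrightarrow> c \<noteq> en 0" for c using idn by auto
  ultimately show ?case by (auto simp: octahedral_product_def) (simp add: axis_def)
next
  case (7 x a i) then show ?case by (auto simp: flip_row_octahedral) (auto simp: flip_row_def)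
next
  case (8 x a i l)
  let ?b = "Suc (a i)" and ?t = "real l / real L"
  have b: "idn (en ?b) = ?b" using 8(2) idn by simp
  have t: "0 \<le> ?t" "?t \<le> 1" using 8(3) L by auto
  have x: "(\<Sum>c\<in>UNIV. \<bar>x $ j $ c\<bar>) = 1" "\<And>c. idn c > a j \<Longrightarrow> x $ j $ c = 0" for j
    using 8(1) by (auto simp: octahedral_product_def)
  have "(\<Sum>c\<in>UNIV. \<bar>(1 - ?t) * x $ i $ c + ?t * axis (en ?b) 1 $ c\<bar>)
     = (\<Sum>c\<in>UNIV. (1 - ?t) * \<bar>x $ i $ c\<bar> + ?t * (if c = en ?b then 1 else 0))"
  proof (rule sum.cong)
    fix c
    show "\<bar>(1 - ?t) * x $ i $ c + ?t * axis (en ?b) 1 $ c\<bar> = (1 - ?t) * \<bar>x $ i $ c\<bar> + ?t * (if c = en ?b then 1 else 0)"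
      using t x(2)[of i "en ?b"] b by (auto simp: axis_def abs_mult)
  qed simp
  also have "\<dots> = (1 - ?t) * 1 + ?t * 1"
    unfolding sum.distrib sum_distrib_left[symmetric] x by simp
  finally have "(\<Sum>c\<in>UNIV. \<bar>slide_row i (axis (en ?b) 1) ?t x $ j $ c\<bar>) = 1" for j
    using x(1)[of j] by (simp add: slide_row_def)
  moreover have "slide_row i (axis (en ?b) 1) ?t x $ j $ c = 0" if "(a(i := ?b)) j < idn c" for j c
  proof (cases "j = i")
    case True
    then have "c \<noteq> en ?b" using that b by auto
    then show ?thesis using True that x(2)[of i c] by (simp add: slide_row_def axis_def)
  next
    case False
    then show ?thesis using that x(2)[of j c] by (simp add: slide_row_def)
  qed
  ultimately show ?case by (simp add: octahedral_product_def)
next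
  case (9 i x y) then show ?case by (simp add: dist_flip_row)
next
  case (10 x a y l i b)
  let ?t = "real l / real L"
  have t: "0 \<le> ?t" "?t \<le> 1" using 10(3) L by auto
  have "norm (slide_row i (axis (en b) 1) ?t x - slide_row i (axis (en b) 1) ?t y) \<le> norm (x - y)"
  proof (rule norm_le_componentwise_cart)
    fix j
    have "(1 - ?t) * norm ((x - y) $ j) \<le> 1 * norm ((x - y) $ j)"
      using t by (intro mult_right_mono) auto
    then have "norm ((1 - ?t) *\<^sub>R (x $ j - y $ j)) \<le> norm (x $ j - y $ j)"
      using t by simp
    then show "norm ((slide_row i (axis (en b) 1) ?t x - slide_row i (axis (en b) 1) ?t y) $ j) \<le> norm ((x - y) $ j)"
      by (cases "j = i") (simp_all add: slide_row_def scaleR_diff_right)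
  qed
  then show ?case by (simp add: dist_norm)
next
  case (11 x a l i b)
  have "norm (x $ i) \<le> 1"
    using 11(1) norm_le_l1_cart[of "x $ i"] by (simp add: octahedral_product_def)
  then have n: "norm (x $ i - axis (en b) 1) \<le> 2"
    using norm_triangle_ineq4[of "x $ i" "axis (en b) 1"] by (simp add: norm_axis_vec)
  have "slide_row i (axis (en b) 1) (real l / real L) x - slide_row i (axis (en b) 1) (real (Suc l) / real L) x
     = axis i ((1 / real L) *\<^sub>R (x $ i - axis (en b) 1))"
    using slide_row_diff[of i "axis (en b) 1" "real l / real L" x "1 / real L"]
    by (simp add: add_divide_distrib add.commute)
  then show ?case using n L by (simp add: dist_norm norm_axis_vec divide_right_mono)
qed

definition half_label :: "'a::real_normed_vector \<Rightarrow> bit" where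
  "half_label u = (if u = (SOME w. w \<in> {u, - u}) then 1 else 0)"

lemma half_label_minus: "u \<noteq> 0 \<Longrightarrow> half_label (- u) = half_label u + 1"
proof -
  assume u: "u \<noteq> 0"
  have "(SOME w. w \<in> {u, - u}) \<in> {u, - u}" by (rule someI[of _ u]) simp
  moreover have "{- u, - (- u)} = {u, - u}" by auto
  moreover have "u \<noteq> - u" 
  proof
    assume "u = - u"
    then have "2 *\<^sub>R u = 0" by (simp add: scaleR_2 eq_neg_iff_add_eq_0)
    then show False using u by simp
  qed
  ultimately show ?thesis unfolding half_label_def by (simp only:) auto
qed

text \<open>Parity labels compatible with a sign character. On the zero set of the function, where its
  sign is of no use, they come from an arbitrary choice of one vector in each pair \<open>{u, - u}\<close>.\<close>

definition sign_label :: "'k::finite set \<Rightarrow> (real^'n^'k \<Rightarrow> real) \<Rightarrow> real^'n^'k \<Rightarrow> bit" where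
  "sign_label T F x = (if F x > 0 then 1 else if F x < 0 then 0 else (\<Sum>i\<in>T. half_label (x $ i)))"

lemma sign_label_flip:
  assumes "F (flip_row i x) = (if i \<in> T then - F x else F x)" "x $ i \<noteq> 0"
  shows "sign_label T F (flip_row i x) = sign_label T F x + of_bool (i \<in> T)"
proof -
  have "(\<Sum>j\<in>T. half_label (flip_row i x $ j)) = (\<Sum>j\<in>T. half_label (x $ j) + (if j = i then 1 else 0))"
    by (rule sum.cong) (use half_label_minus[OF assms(2)] in \<open>auto simp: flip_row_def\<close>)
  then have "(\<Sum>j\<in>T. half_label (flip_row i x $ j)) = (\<Sum>j\<in>T. half_label (x $ j)) + of_bool (i \<in> T)"
    by (simp add: sum.distrib)
  then show ?thesis using assms(1) by (auto simp: sign_label_def)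
qed

text \<open>In either case \<open>F x\<close> is bounded by the oscillation of \<open>F\<close>; the
  second alternative covers two zeros that were labelled differently by the arbitrary
  choice.\<close>

lemma sign_label_change:
  "sign_label T F x \<noteq> sign_label T F y \<Longrightarrow> \<bar>F x\<bar> \<le> \<bar>F x - F y\<bar> \<or> F x = 0 \<and> F y = 0"
  by (auto simp: sign_label_def split: if_splits)

lemma octahedral_row_nonzero: "x \<in> octahedral_product \<Longrightarrow> x $ i \<noteq> 0"
proof
  assume "x \<in> octahedral_product" "x $ i = 0"
  then have "(\<Sum>c\<in>UNIV. \<bar>x $ i $ c\<bar>) = 1" unfolding octahedral_product_def by blast
  with \<open>x $ i = 0\<close> show False by simp
qed

text \<open>The mod 2 Bezout count: \<^const>\<open>reduces\<close> certifies that the product of the linear forms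
  \<open>\<Sum>i\<in>T. t i\<close> contains the monomial \<open>\<Prod>i. t i ^ (n - 1)\<close> with odd coefficient.\<close>

theorem product_borsuk_ulam:
  fixes Fs :: "(real^'n::finite^'k::finite \<Rightarrow> real) list"
  assumes "distinct is" "set is = UNIV" "reduces is Ts (\<lambda>_. CARD('n) - 1)"
    and Fs: "list_all2 (\<lambda>F T. continuous_on octahedral_product F \<and>
      (\<forall>x\<in>octahedral_product. \<forall>i. F (flip_row i x) = (if i \<in> T then - F x else F x))) Fs Ts"
  shows "\<exists>x\<in>octahedral_product. \<forall>F\<in>set Fs. F x = 0"
proof (rule ccontr)
  assume neg: "\<not> ?thesis"
  let ?Y = "octahedral_product :: (real^'n^'k) set"
  obtain idn :: "'n \<Rightarrow> nat" where idn: "bij_betw idn UNIV {0..<CARD('n)}"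
    using ex_bij_betw_finite_nat[of "UNIV :: 'n set"] by auto
  define en where "en = inv_into UNIV idn"
  have en: "\<forall>b<CARD('n). idn (en b) = b"
    using idn by (auto simp: en_def bij_betw_def intro!: f_inv_into_f)
  note cells = octahedral_small_cells[OF en]
  have Y0: "(\<chi> i. axis (en 0) 1) \<in> ?Y"
    using small_cells.p_D[OF cells[of 1]] by auto
  have contF: "continuous_on ?Y F" if "F \<in> set Fs" for F
    using Fs that unfolding list_all2_conv_all_nth by (metis in_set_conv_nth)
  define S where "S x = (\<Sum>F\<leftarrow>Fs. \<bar>F x\<bar>)" for x
  have contS: "continuous_on ?Y S"
    unfolding S_def using contF by (induction Fs) (auto intro!: continuous_intros)
  obtain x0 where x0: "x0 \<in> ?Y" "\<And>x. x \<in> ?Y \<Longrightarrow> S x0 \<le> S x"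
    using continuous_attains_inf[OF compact_octahedral_product _ contS] Y0 by blast
  define \<eta> where "\<eta> = S x0"
  have \<eta>: "\<eta> > 0"
  proof -
    obtain F where "F \<in> set Fs" "F x0 \<noteq> 0" using neg x0(1) by blast
    then have "0 < \<bar>F x0\<bar>" "\<bar>F x0\<bar> \<le> S x0"
      unfolding S_def by (auto intro!: member_le_sum_list)
    then show ?thesis by (simp add: \<eta>_def)
  qed
  \<comment> \<open>Chosen so that values of at most \<open>2 * e\<close> for all functions add up
    to less than the minimum \<open>\<eta>\<close> of their absolute sum.\<close>
  define e where "e = \<eta> / (2 * real (length Fs) + 1)"
  have e: "e > 0" using \<eta> by (simp add: e_def)
  have "\<exists>\<delta>>0. \<forall>F\<in>set Gs. \<forall>x\<in>?Y. \<forall>y\<in>?Y. dist x y < \<delta> \<longrightarrow> \<bar>F x - F y\<bar> < e"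
    if "set Gs \<subseteq> set Fs" for Gs
    using that
  proof (induction Gs)
    case Nil show ?case by (auto intro: exI[of _ 1])
  next
    case (Cons G Gs)
    then obtain \<delta> where d: "\<delta> > 0" "\<forall>F\<in>set Gs. \<forall>x\<in>?Y. \<forall>y\<in>?Y. dist x y < \<delta> \<longrightarrow> \<bar>F x - F y\<bar> < e" by auto
    have "uniformly_continuous_on ?Y G"
      using Cons.prems by (intro compact_uniformly_continuous contF compact_octahedral_product) auto
    then obtain \<delta>' where d': "\<delta>' > 0" "\<forall>x\<in>?Y. \<forall>y\<in>?Y. dist x y < \<delta>' \<longrightarrow> \<bar>G x - G y\<bar> < e"
      using e unfolding uniformly_continuous_on_def by (metis dist_commute dist_real_def)
    show ?case using d d' by (intro exI[of _ "min \<delta> \<delta>'"]) auto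
  qed
  then obtain \<delta> where d: "\<delta> > 0"
    "\<And>F x y. F \<in> set Fs \<Longrightarrow> x \<in> ?Y \<Longrightarrow> y \<in> ?Y \<Longrightarrow> dist x y < \<delta> \<Longrightarrow> \<bar>F x - F y\<bar> < e"
    by blast
  define N where "N = (\<Sum>i\<in>set is. CARD('n) - 1)"
  \<comment> \<open>The top cell takes \<open>N\<close> prisms with stages of length
    \<open>2 / L\<close>, so its tuples have diameter below \<open>\<delta>\<close>.\<close>
  obtain L :: nat where L: "real N * 2 / \<delta> < real L" using reals_Archimedean2 by blast
  have L0: "0 < L"
  proof -
    have "0 \<le> real N * 2 / \<delta>" using d(1) by simp
    then show ?thesis using L by linarith
  qed
  have small: "real N * (2 / real L) < \<delta>" using L L0 d(1) by (simp add: field_simps)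
  interpret C: small_cells flip_row "\<lambda>i b l. slide_row i (axis (en b) 1) (real l / real L)" L
    "\<chi> i. axis (en 0) 1" "\<lambda>a. {x \<in> ?Y. \<forall>i c. idn c > a i \<longrightarrow> x $ i $ c = 0}" "CARD('n) - 1" "2 / real L"
    by (rule cells[OF L0])
  define ss where "ss = map2 sign_label Ts Fs"
  have len: "length Fs = length Ts" using Fs by (rule list_all2_lengthD)
  have ss: "list_all2 (\<lambda>s T. \<forall>a. \<forall>x\<in>{x \<in> ?Y. \<forall>i c. idn c > a i \<longrightarrow> x $ i $ c = 0}.
      \<forall>i. s (flip_row i x) = s x + of_bool (i \<in> T)) ss Ts"
    using Fs len unfolding list_all2_conv_all_nth ss_def
    by (simp add: sign_label_flip octahedral_row_nonzero)
  obtain xs where xs: "C.small (\<lambda>j. if j \<in> set is then CARD('n) - 1 else 0) N xs"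
    "\<And>s. s \<in> set ss \<Longrightarrow> \<exists>x\<in>set xs. \<exists>y\<in>set xs. s x \<noteq> s y"
    using C.small_tuple_all_change[OF assms(1,3) _ ss] unfolding N_def by auto
  have xsY: "set xs \<subseteq> ?Y" and xsd: "\<And>x y. x \<in> set xs \<Longrightarrow> y \<in> set xs \<Longrightarrow> dist x y < \<delta>"
    and "xs \<noteq> []"
    using xs(1) small unfolding C.small_def by (auto, meson le_less_trans)
  then obtain z where z: "z \<in> set xs" by (cases xs) auto
  have Fz: "\<bar>F z\<bar> \<le> 2 * e" if F: "F \<in> set Fs" for F
  proof -
    obtain m where m: "m < length Fs" "F = Fs ! m" using F by (auto simp: in_set_conv_nth)
    then have "sign_label (Ts ! m) F = ss ! m" "m < length ss"
      using len by (simp_all add: ss_def)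
    then have "sign_label (Ts ! m) F \<in> set ss" by simp
    then obtain x y where xy: "x \<in> set xs" "y \<in> set xs" "sign_label (Ts ! m) F x \<noteq> sign_label (Ts ! m) F y"
      using xs(2) by blast
    have "\<bar>F x - F y\<bar> < e" using d(2)[OF F, of x y] xy(1,2) xsY xsd by blast
    then have "\<bar>F x\<bar> \<le> e"
      using sign_label_change[OF xy(3)] e by linarith
    moreover have "\<bar>F z - F x\<bar> < e" using d(2)[OF F, of z x] xy z xsY xsd by blast
    ultimately show ?thesis by linarith
  qed
  have "S z \<le> 2 * e * length Fs"
    unfolding S_def using sum_list_mono[of Fs "\<lambda>F. \<bar>F z\<bar>" "\<lambda>_. 2 * e"] Fz
    by (simp add: sum_list_triv mult.commute)
  also have "\<dots> < \<eta>"
  proof -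
    have "\<eta> = e * (2 * real (length Fs) + 1)" by (simp add: e_def)
    then show ?thesis using e by (simp add: algebra_simps)
  qed
  finally show False using x0(2)[of z] z xsY by (auto simp: \<eta>_def)
qed

section \<open>The lower bound for the genus\<close>

lemma closed_stiefel: "closed (stiefel :: (real^'n^'k) set)"
  unfolding stiefel_def
  by (intro closed_Collect_all closed_Collect_eq continuous_intros)

lemma reduces_replicate:
  assumes "j \<in> set is" "r \<le> a j" "reduces is Ts (a(j := a j - r))"
  shows "reduces is (replicate r {j} @ Ts) a"
  using assms
proof (induction r arbitrary: a)
  case (Suc r)
  let ?a = "a(j := a j - 1)"
  have "?a(j := ?a j - r) = a(j := a j - Suc r)" by auto
  then have "reduces is (replicate r {j} @ Ts) ?a"
    using Suc.prems by (intro Suc.IH) (simp_all add: fun_upd_def)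
  moreover have "{i \<in> set is. i \<in> {j} \<and> a i \<noteq> 0} = {j}" using Suc.prems by auto
  ultimately show ?case by auto
qed (simp add: fun_upd_def)

text \<open>With indices counted from 0, the single factors lower the exponent of index
  \<open>a\<close> from \<open>n - 1\<close> to \<open>a\<close>. In the row of pairs starting at
  \<open>m\<close> the exponent of \<open>m\<close> has already reached 0, so each pair
  \<open>{m, b}\<close> has to lower \<open>b\<close>. After that row the exponents are
  \<open>idk i - Suc m\<close>, and the next row starts in the same situation.\<close>

lemma reduces_singles_pairs:
  fixes idk :: "'k::finite \<Rightarrow> nat" and ek :: "nat \<Rightarrow> 'k"
  assumes isU: "set is = UNIV" and kn: "CARD('k) \<le> n"
    and ek: "\<And>a. a < CARD('k) \<Longrightarrow> idk (ek a) = a" "\<And>i. ek (idk i) = i" "\<And>i. idk i < CARD('k)"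
  shows "reduces is (concat (map (\<lambda>a. replicate (n - 1 - a) {ek a}) [0..<CARD('k)])
    @ concat (map (\<lambda>a. map (\<lambda>b. {ek a, ek b}) [Suc a..<CARD('k)]) [0..<CARD('k)])) (\<lambda>_. n - 1)"
proof -
  let ?k = "CARD('k)"
  have eki: "i = ek a \<longleftrightarrow> idk i = a" if "a < ?k" for i a using ek that by metis
  define pairs where "pairs m = concat (map (\<lambda>a. map (\<lambda>b. {ek a, ek b}) [Suc a..<?k]) [m..<?k])" for m
  have row: "reduces is (map (\<lambda>b. {ek m, ek b}) [b'..<?k] @ Ts) (\<lambda>i. if idk i < b' then idk i - Suc m else idk i - m)"
    if "m < b'" "b' \<le> ?k" "reduces is Ts (\<lambda>i. idk i - Suc m)" for m b' Ts
    using that(2,1)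
  proof (induction b' rule: inc_induct)
    case base
    then show ?case using that(3) ek(3) by simp
  next
    case (step b)
    let ?a = "\<lambda>i. if idk i < b then idk i - Suc m else idk i - m"
    have "{i \<in> set is. i \<in> {ek m, ek b} \<and> ?a i \<noteq> 0} = {ek b}"
      using step ek(1)[of m] ek(1)[of b] by (auto simp: isU)
    moreover have "?a(ek b := ?a (ek b) - 1) = (\<lambda>i. if idk i < Suc b then idk i - Suc m else idk i - m)"
      using step ek(1)[of b] eki[of b] by (auto simp: fun_eq_iff less_Suc_eq)
    moreover have "[b..<?k] = b # [Suc b..<?k]" using step by (simp add: upt_conv_Cons)
    ultimately show ?case using step by (auto simp: fun_upd_def)
  qed
  have pairs: "reduces is (pairs m) (\<lambda>i. idk i - m)" if "m \<le> ?k" for m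
    using that
  proof (induction m rule: inc_induct)
    case base
    then show ?case using ek(3) by (simp add: pairs_def less_imp_le)
  next
    case (step m)
    have "pairs m = map (\<lambda>b. {ek m, ek b}) [Suc m..<?k] @ pairs (Suc m)"
      using step by (simp add: pairs_def upt_conv_Cons)
    moreover have "(\<lambda>i. if idk i < Suc m then idk i - Suc m else idk i - m) = (\<lambda>i. idk i - m)"
      by auto
    ultimately show ?case using row[of m "Suc m" "pairs (Suc m)"] step by simp
  qed
  have "reduces is (concat (map (\<lambda>a. replicate (n - 1 - a) {ek a}) [m..<?k]) @ pairs 0)
      (\<lambda>i. if idk i < m then idk i else n - 1)" if "m \<le> ?k" for m
    using that
  proof (induction m rule: inc_induct)
    case base
    then show ?case using ek(3) pairs[of 0] by simp
  next
    case (step m)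
    let ?a = "\<lambda>i. if idk i < m then idk i else n - 1"
    have "?a(ek m := ?a (ek m) - (n - 1 - m)) = (\<lambda>i. if idk i < Suc m then idk i else n - 1)"
      using step ek(1)[of m] eki[of m] kn by (auto simp: fun_eq_iff less_Suc_eq)
    then have "reduces is (replicate (n - 1 - m) {ek m} @
        (concat (map (\<lambda>a. replicate (n - 1 - a) {ek a}) [Suc m..<?k]) @ pairs 0)) ?a"
      using step kn ek(1)[of m] by (intro reduces_replicate) (auto simp: isU fun_upd_def)
    then show ?case using step by (simp add: upt_conv_Cons)
  qed
  from this[of 0] show ?thesis by (simp add: pairs_def)
qed

lemma sum_list_stiefel_dim:
  assumes "k \<le> n"
  shows "(\<Sum>a\<leftarrow>[0..<k]. n - 1 - a) = n * k - k * (k + 1) div 2"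
  using assms
proof (induction k)
  case (Suc k)
  have "even (k * (k + 1))" by simp
  moreover have "k * (k + 1) \<le> n * k * 2" using Suc.prems by (intro order_trans[OF mult_le_mono2[of "k + 1" n k]]) simp_all
  ultimately show ?case
    using Suc by (auto simp: algebra_simps elim!: evenE) 
qed simp

lemma infdist_image_isometry:
  "(\<And>x y. dist (\<phi> x) (\<phi> y) = dist x y) \<Longrightarrow> infdist (\<phi> x) (\<phi> ` S) = infdist x S"
  by (simp add: infdist_def image_image)

definition flip_matrix :: "'k \<Rightarrow> real^'k^'k" where
  "flip_matrix i = signed_perm_matrix (\<lambda>j. if j = i then - 1 else 1) id"

lemma flip_matrix_carrier: "flip_matrix i \<in> carrier signed_perm_group"
  by (auto simp: flip_matrix_def signed_perm_group_def intro!: exI[of _ id] exI)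

lemma frame_action_flip: "v \<in> stiefel \<Longrightarrow> frame_action (flip_matrix i) v = flip_row i v"
  by (auto simp: flip_matrix_def frame_action_signed_perm flip_row_def vec_eq_iff)

lemma flip_row_stiefel: "v \<in> stiefel \<Longrightarrow> flip_row i v \<in> stiefel"
  by (auto simp: stiefel_def flip_row_def)

text \<open>The row sum reads off the sign of row \<open>i\<close> whatever the permutation is; it
  turns a map to the group into functions that are odd in one vector and even in the others.\<close>

lemma signed_perm_row_sum:
  assumes "M \<in> carrier signed_perm_group"
  shows "(\<Sum>c\<in>UNIV. M $ i $ c) \<noteq> 0"
proof -
  obtain \<epsilon> \<sigma> where "M = signed_perm_matrix \<epsilon> \<sigma>" "\<epsilon> i \<in> {1, -1}"
    using assms by (auto simp: signed_perm_group_def)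
  then show ?thesis by (auto simp: signed_perm_matrix_def)
qed

lemma flip_matrix_row_sum:
  "(\<Sum>c\<in>UNIV. (flip_matrix j ** M) $ i $ c) = (if i = j then - (\<Sum>c\<in>UNIV. M $ i $ c) else (\<Sum>c\<in>UNIV. M $ i $ c))"
proof -
  have "(\<Sum>k\<in>UNIV. (if k = i then if i = j then - 1 else 1 else 0) * M $ k $ c)
      = (if i = j then - 1 else 1) * M $ i $ c" for c
  proof -
    have "(\<Sum>k\<in>UNIV. (if k = i then if i = j then - 1 else 1 else 0) * M $ k $ c)
      = (\<Sum>k\<in>UNIV. if k = i then (if i = j then - 1 else 1) * M $ k $ c else 0)"
      by (rule sum.cong) auto
    then show ?thesis by simp
  qed
  then show ?thesis
    by (simp add: flip_matrix_def signed_perm_matrix_def matrix_matrix_mult_def sum_negf)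
qed

definition normalize_rows :: "real^'n^'k \<Rightarrow> real^'n^'k" where
  "normalize_rows x = (\<chi> i. (1 / norm (x $ i)) *\<^sub>R x $ i)"

lemma continuous_on_normalize_rows: "continuous_on octahedral_product normalize_rows"
  unfolding normalize_rows_def
  by (intro continuous_intros) (simp add: octahedral_row_nonzero)

lemma normalize_rows_flip: "normalize_rows (flip_row i x) = flip_row i (normalize_rows x)"
  by (auto simp: normalize_rows_def flip_row_def vec_eq_iff)

text \<open>The sign of row \<open>sg ! l\<close> of \<open>f l\<close> lives on \<open>U l\<close>
  only. A difference of distances to complements extends it to a continuous function on all frames
  that has no zero in \<open>U l\<close>. Hence a common zero which is a frame lies in no member of
  the cover.\<close>

theorem stiefel_no_small_cover:
  fixes U :: "nat \<Rightarrow> (real^'n::finite^'k::finite) set"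
  defines "V \<equiv> stiefel_space :: (real^'n^'k) topology"
  assumes kn: "CARD('k) \<le> CARD('n)" and m: "m \<le> CARD('n) * CARD('k) - CARD('k) * (CARD('k) + 1) div 2"
    and cover: "(\<Union>i<m. U i) = topspace V"
    and U: "\<And>i. i < m \<Longrightarrow> openin V (U i)" "\<And>i. i < m \<Longrightarrow> G_invariant signed_perm_group frame_action (U i)"
    and f: "\<And>i. i < m \<Longrightarrow> equivariant_map_to_group signed_perm_group (subtopology V (U i)) frame_action (f i)"
  shows False
proof -
  let ?n = "CARD('n)" and ?k = "CARD('k)"
  let ?G = "signed_perm_group :: (real^'k^'k) monoid"
  let ?S = "stiefel :: (real^'n^'k) set"
  let ?Y = "octahedral_product :: (real^'n^'k) set"
  obtain idk :: "'k \<Rightarrow> nat" where idk: "bij_betw idk UNIV {0..<?k}"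
    using ex_bij_betw_finite_nat[of "UNIV :: 'k set"] by auto
  define ek where "ek = inv_into UNIV idk"
  have ek: "\<And>a. a < ?k \<Longrightarrow> idk (ek a) = a" "\<And>i. ek (idk i) = i" "\<And>i. idk i < ?k"
    using idk by (auto simp: ek_def bij_betw_def intro!: f_inv_into_f)
  obtain "is" :: "'k list" where isl: "distinct is" "set is = UNIV"
    using finite_distinct_list[of "UNIV :: 'k set"] by auto
  \<comment> \<open>Index \<open>a\<close>, counted from 0, is used \<open>n - 1 - a\<close> times;
    the length of the list is the dimension, so there is one entry for every member of the
    cover.\<close>
  define sg where "sg = concat (map (\<lambda>a. replicate (?n - 1 - a) (ek a)) [0..<?k])"
  define pl where "pl = concat (map (\<lambda>a. map (\<lambda>b. (ek a, ek b)) [Suc a..<?k]) [0..<?k])"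
  have red: "reduces is (map (\<lambda>i. {i}) sg @ map (\<lambda>(i, j). {i, j}) pl) (\<lambda>_. ?n - 1)"
    using reduces_singles_pairs[OF isl(2) kn ek]
    by (simp add: sg_def pl_def map_concat comp_def)
  have len: "length sg = ?n * ?k - ?k * (?k + 1) div 2"
    using sum_list_stiefel_dim[OF kn] by (simp add: sg_def length_concat comp_def)
  have pl_ne: "i \<noteq> j" if ij: "(i, j) \<in> set pl" for i j
  proof -
    obtain a b where "i = ek a" "j = ek b" "a < b" "b < ?k"
      using ij by (auto simp: pl_def)
    then show ?thesis using ek(1)[of a] ek(1)[of b] by auto
  qed
  have pl_all: "(i, j) \<in> set pl \<or> (j, i) \<in> set pl" if "i \<noteq> j" for i j
  proof -
    have *: "(i, j) \<in> set pl" if "idk i < idk j" for i j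
      using that ek(2)[of i] ek(2)[of j] ek(3)[of i] ek(3)[of j]
      by (auto simp: pl_def intro!: bexI[of _ "idk i"] image_eqI[of _ _ "idk j"])
    have "idk i \<noteq> idk j" using that ek(2) by metis
    then show ?thesis using * by (meson linorder_neqE_nat)
  qed
  \<comment> \<open>For \<open>l\<close> not below \<open>m\<close> the sets are empty, and the
    function \<open>F l\<close> built from them is identically zero; this allows covers with fewer
    than \<open>length sg\<close> members.\<close>
  define A where "A s l i = (if l < m then {v \<in> U l. 0 < s * (\<Sum>c\<in>UNIV. f l v $ i $ c)} else {})" for s :: real and l i
  have US: "U l \<subseteq> ?S" if "l < m" for l using openin_subset[OF U(1)[OF that]] by (simp add: V_def)
  have fU: "f l v \<in> carrier ?G" if "l < m" "v \<in> U l" for l v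
  proof -
    have "continuous_map (subtopology V (U l)) (discrete_topology (carrier ?G)) (f l)"
      using f[OF that(1)] by (simp add: equivariant_map_to_group_def)
    then show ?thesis using that US by (auto simp: continuous_map_def V_def Pi_iff)
  qed
  have fl: "flip_row j v \<in> U l" "f l (flip_row j v) = flip_matrix j ** f l v" if "l < m" "v \<in> U l" for l j v
  proof -
    have v: "v \<in> ?S" using that US by auto
    show "flip_row j v \<in> U l"
      using U(2)[OF that(1)] flip_matrix_carrier that(2) frame_action_flip[OF v]
      unfolding G_invariant_def by metis
    have eq: "\<forall>g\<in>carrier ?G. f l (frame_action g v) = g \<otimes>\<^bsub>?G\<^esub> f l v"
      using f[OF that(1)] that v US by (auto simp: equivariant_map_to_group_def V_def)
    then show "f l (flip_row j v) = flip_matrix j ** f l v"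
      using bspec[OF eq flip_matrix_carrier[of j]] frame_action_flip[OF v, of j]
      by (simp add: signed_perm_group_def)
  qed
  have A_open: "openin (top_of_set ?S) (A s l i)" for s l i
  proof (cases "l < m")
    case True
    have "continuous_map (subtopology V (U l)) (discrete_topology (carrier ?G)) (f l)"
      using f[OF True] by (simp add: equivariant_map_to_group_def)
    then have "openin (subtopology V (U l)) {v \<in> topspace (subtopology V (U l)). f l v \<in> {M \<in> carrier ?G. 0 < s * (\<Sum>c\<in>UNIV. M $ i $ c)}}"
      by (rule openin_continuous_map_preimage) auto
    moreover have "{v \<in> topspace (subtopology V (U l)). f l v \<in> {M \<in> carrier ?G. 0 < s * (\<Sum>c\<in>UNIV. M $ i $ c)}} = A s l i"
      using True fU US by (auto simp: A_def V_def)
    ultimately show ?thesis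
      using openin_trans_full[OF _ U(1)[OF True]] by (simp add: V_def stiefel_space_def)
  qed (simp add: A_def)
  have A_flip: "flip_row j ` A s l i = A (if i = j then - s else s) l i" for s l i j
  proof -
    have *: "flip_row j v \<in> A (if i = j then - s else s) l i" if "v \<in> A s l i" for v s
      using that fl[of l v j] by (auto simp: A_def flip_matrix_row_sum split: if_splits)
    show ?thesis
    proof (intro equalityI subsetI)
      fix v assume "v \<in> A (if i = j then - s else s) l i"
      then have "flip_row j v \<in> A s l i" using *[of v "if i = j then - s else s"] by (simp split: if_splits)
      then show "v \<in> flip_row j ` A s l i" by (metis flip_row_flip_row image_eqI)
    qed (use * in auto)
  qed
  have S_flip: "flip_row j ` ?S = ?S" for j
    using flip_row_stiefel by (metis flip_row_flip_row image_eqI image_subsetI subsetI subset_antisym)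
  have inj_flip: "inj (flip_row j :: real^'n^'k \<Rightarrow> _)" for j by (metis flip_row_flip_row injI)
  define E where "E s l i v = infdist v (?S - A s l i)" for s l i v
  have E_flip: "E s l i (flip_row j v) = E (if i = j then - s else s) l i v" for s l i j v
  proof -
    have "?S - A s l i = flip_row j ` (?S - A (if i = j then - s else s) l i)"
      unfolding image_set_diff[OF inj_flip] S_flip A_flip by auto
    then show ?thesis unfolding E_def using infdist_image_isometry[of "flip_row j", OF dist_flip_row] by metis
  qed
  define F where "F l x = E 1 l (sg ! l) (normalize_rows x) - E (- 1) l (sg ! l) (normalize_rows x)" for l x
  let ?Fs = "map F [0..<length sg] @ map (\<lambda>(i, j) x. x $ i \<bullet> x $ j) pl"
  have "list_all2 (\<lambda>F T. continuous_on ?Y F \<and>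
      (\<forall>x\<in>?Y. \<forall>i. F (flip_row i x) = (if i \<in> T then - F x else F x))) ?Fs
      (map (\<lambda>i. {i}) sg @ map (\<lambda>(i, j). {i, j}) pl)"
  proof (rule list_all2_appendI)
    show "list_all2 (\<lambda>F T. continuous_on ?Y F \<and>
      (\<forall>x\<in>?Y. \<forall>i. F (flip_row i x) = (if i \<in> T then - F x else F x))) (map F [0..<length sg]) (map (\<lambda>i. {i}) sg)"
      unfolding list_all2_conv_all_nth
    proof (intro conjI allI impI)
      fix l assume l: "l < length (map F [0..<length sg])"
      have "continuous_on ?Y (F l)"
        unfolding F_def E_def by (intro continuous_intros continuous_on_infdist continuous_on_normalize_rows)
      then show "continuous_on ?Y (map F [0..<length sg] ! l)" using l by simp
      have "F l (flip_row i x) = (if i \<in> {sg ! l} then - F l x else F l x)" for i x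
        by (simp add: F_def normalize_rows_flip E_flip)
      then show "\<forall>x\<in>?Y. \<forall>i. (map F [0..<length sg] ! l) (flip_row i x) =
          (if i \<in> map (\<lambda>i. {i}) sg ! l then - (map F [0..<length sg] ! l) x else (map F [0..<length sg] ! l) x)"
        using l by simp
    qed simp
    show "list_all2 (\<lambda>F T. continuous_on ?Y F \<and>
      (\<forall>x\<in>?Y. \<forall>i. F (flip_row i x) = (if i \<in> T then - F x else F x)))
      (map (\<lambda>(i, j) x. x $ i \<bullet> x $ j) pl) (map (\<lambda>(i, j). {i, j}) pl)"
      unfolding list.rel_map list_all2_same
      using pl_ne by (force simp: flip_row_def intro!: continuous_intros)
  qed
  from product_borsuk_ulam[OF isl red this] obtain x where
    x: "x \<in> ?Y" "\<And>l. l < length sg \<Longrightarrow> F l x = 0" "\<And>i j. (i, j) \<in> set pl \<Longrightarrow> x $ i \<bullet> x $ j = 0"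
    by fastforce
  define v where "v = normalize_rows x"
  have orth: "x $ i \<bullet> x $ j = 0" if "i \<noteq> j" for i j
    using pl_all[OF that] x(3) by (metis inner_commute)
  have v: "v \<in> ?S"
    using orth octahedral_row_nonzero[OF x(1)]
    by (auto simp: v_def normalize_rows_def stiefel_def norm_eq_sqrt_inner[symmetric] power2_norm_eq_inner[symmetric] power2_eq_square)
  then obtain l where l: "l < m" "v \<in> U l" using cover by (auto simp: V_def)
  define i where "i = sg ! l"
  have E: "E 1 l i v = E (- 1) l i v"
    using x(2)[of l] l m len by (simp add: F_def v_def i_def)
  have A_pos: "E s l i v > 0" if "v \<in> A s l i" for s
  proof -
    have "closed (?S - A s l i)"
      using A_open closedin_diff[OF closedin_subset_topspace] closed_stiefel
      by (metis closedin_closed_trans closedin_diff closedin_topspace topspace_euclidean_subtopology)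
    \<comment> \<open>The complement must be nonempty, because \<open>infdist\<close> to the empty
      set is 0 by convention; the flipped frame lies in it.\<close>
    moreover have "flip_row i v \<in> A (- s) l i" using A_flip[of i s l i] that by auto
    then have "flip_row i v \<in> ?S - A s l i"
      using flip_row_stiefel[OF v] by (auto simp: A_def split: if_splits)
    ultimately show ?thesis
      unfolding E_def using that infdist_pos_not_in_closed[of "?S - A s l i" v] by auto
  qed
  have zero: "E s l i v = 0" if "v \<notin> A s l i" for s
    unfolding E_def using v that by (intro infdist_zero) auto
  have "v \<in> A 1 l i \<or> v \<in> A (- 1) l i"
    using signed_perm_row_sum[OF fU[OF l], of i] l by (auto simp: A_def)
  moreover have "\<not> (v \<in> A 1 l i \<and> v \<in> A (- 1) l i)" by (auto simp: A_def split: if_splits)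
  ultimately show False using A_pos zero E by (metis less_irrefl)
qed

corollary stiefel_genus_ge:
  fixes V :: "(real^'n::finite^'k::finite) topology"
  assumes "CARD('k) \<le> CARD('n)" "V = stiefel_space"
  shows "enat (CARD('n) * CARD('k) - CARD('k) * (CARD('k) + 1) div 2 + 1)
    \<le> schwarz_genus signed_perm_group V frame_action"
  unfolding schwarz_genus_def
proof (rule Inf_greatest)
  fix N assume "N \<in> {enat m | m. \<exists>U :: nat \<Rightarrow> (real^'n^'k) set.
            (\<Union>i<m. U i) = topspace V \<and>
            (\<forall>i<m. openin V (U i) \<and> G_invariant signed_perm_group frame_action (U i) \<and>
                   (\<exists>f. equivariant_map_to_group signed_perm_group (subtopology V (U i)) frame_action f))}"
  then obtain m U where m: "N = enat m" "(\<Union>i<m. U i) = topspace V"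
    "\<forall>i<m. openin V (U i) \<and> G_invariant signed_perm_group frame_action (U i) \<and>
                   (\<exists>f. equivariant_map_to_group signed_perm_group (subtopology V (U i)) frame_action f)"
    by blast
  then obtain f where "\<forall>i<m. equivariant_map_to_group signed_perm_group (subtopology V (U i)) frame_action (f i)"
    by metis
  then have "\<not> m \<le> CARD('n) * CARD('k) - CARD('k) * (CARD('k) + 1) div 2"
    using stiefel_no_small_cover[of m U f] m assms by blast
  then show "enat (CARD('n) * CARD('k) - CARD('k) * (CARD('k) + 1) div 2 + 1) \<le> N"
    using m(1) by simp
qed

section \<open>Charts of the Stiefel manifold\<close>

lemma matrix_ring_simps:
  fixes A A' :: "real^'m^'l" and B B' :: "real^'n^'m"
  shows "(A + A') ** B = A ** B + A' ** B" "A ** (B + B') = A ** B + A ** B'"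
    "(A - A') ** B = A ** B - A' ** B" "A ** (B - B') = A ** B - A ** B'"
    "(- A) ** B = - (A ** B)" "A ** (- B) = - (A ** B)" "0 ** B = 0" "A ** 0 = (0 :: real^'n^'l)"
  by (simp_all add: matrix_matrix_mult_def vec_eq_iff sum.distrib sum_subtractf sum_negf algebra_simps)

lemma matrix_scaleR:
  fixes A :: "real^'m^'l" and B :: "real^'n^'m"
  shows "(c *\<^sub>R A) ** B = c *\<^sub>R (A ** B)" "A ** (c *\<^sub>R B) = c *\<^sub>R (A ** B)"
  by (simp_all add: matrix_matrix_mult_def vec_eq_iff sum_distrib_left algebra_simps)

lemma transpose_simps:
  fixes A B :: "real^'n^'m"
  shows "transpose (A + B) = transpose A + transpose B" "transpose (A - B) = transpose A - transpose B"
    "transpose (- A) = - transpose A" "transpose 0 = (0 :: real^'n^'m)"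
  by (simp_all add: transpose_def vec_eq_iff)

lemma norm_matrix_vector_le: "norm (M *v v) \<le> norm M * norm (v :: real^'n)"
proof -
  have "norm (M *v v) \<le> norm (\<chi> i. norm (M $ i) * norm v)"
  proof (rule norm_le_componentwise_cart)
    fix i
    show "norm ((M *v v) $ i) \<le> norm ((\<chi> i. norm (M $ i) * norm v) $ i)"
      using Cauchy_Schwarz_ineq2[of "M $ i" v] by (simp add: matrix_vector_mul_component)
  qed
  also have "(\<chi> i. norm (M $ i) * norm v) = norm v *\<^sub>R (\<chi> i. norm (M $ i))"
    by (simp add: vec_eq_iff)
  also have "norm \<dots> = norm M * norm v"
    unfolding norm_scaleR norm_vec_def[of M] norm_vec_def[of "\<chi> i. norm (M $ i)"] by simp
  finally show ?thesis .
qed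

lemma inverse_matrix:
  fixes C :: "real^'k^'k"
  assumes "invertible C"
  shows "matrix_inv C ** C = mat 1" "C ** matrix_inv C = mat 1"
  using assms unfolding invertible_def matrix_inv_def by (metis (mono_tags, lifting) someI_ex)+

lemma inverse_matrix_unique:
  fixes C :: "real^'k^'k"
  assumes "B ** C = mat 1"
  shows "invertible C" "matrix_inv C = B"
proof -
  show "invertible C" using assms invertible_left_inverse by blast
  from inverse_matrix(2)[OF this] have "B ** (C ** matrix_inv C) = B" by simp
  then show "matrix_inv C = B" by (simp add: matrix_mul_assoc assms)
qed

text \<open>Cramer's rule writes the entries of the inverse as quotients of polynomials in the
  entries.\<close>

lemma continuous_on_matrix_inv:
  fixes f :: "'a::topological_space \<Rightarrow> real^'k^'k"
  assumes f: "continuous_on S f" and inv: "\<And>x. x \<in> S \<Longrightarrow> invertible (f x)"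
  shows "continuous_on S (\<lambda>x. matrix_inv (f x))"
proof -
  have nz: "det (f x) \<noteq> 0" if "x \<in> S" for x
    using inv[OF that] by (simp add: invertible_det_nz)
  have eq: "matrix_inv (f x) $ k $ j = det (\<chi> i l. if l = k then mat 1 $ i $ j else f x $ i $ l) / det (f x)"
    if x: "x \<in> S" for x k j
  proof -
    let ?b = "(\<chi> i. mat 1 $ i $ j) :: real^'k"
    have "f x *v (\<chi> i. matrix_inv (f x) $ i $ j) = (\<chi> i. (f x ** matrix_inv (f x)) $ i $ j)"
      by (simp add: matrix_vector_mult_def matrix_matrix_mult_def vec_eq_iff)
    also have "\<dots> = ?b" by (simp add: inverse_matrix(2)[OF inv[OF x]])
    finally have "(\<chi> i. matrix_inv (f x) $ i $ j) = (\<chi> k. det (\<chi> i l. if l = k then ?b $ i else f x $ i $ l) / det (f x))"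
      using cramer[OF nz[OF x]] by blast
    then have "(\<chi> i. matrix_inv (f x) $ i $ j) $ k = (\<chi> k. det (\<chi> i l. if l = k then ?b $ i else f x $ i $ l) / det (f x)) $ k"
      by (rule arg_cong)
    then show ?thesis by (simp cong: if_cong)
  qed
  have comp: "continuous_on S (\<lambda>x. if l = k then c else f x $ i $ l)" for l k i :: 'k and c :: real
    by (cases "l = k") (auto intro!: continuous_intros f)
  have "continuous_on S (\<lambda>x. \<chi> k j. det (\<chi> i l. if l = k then mat 1 $ i $ j else f x $ i $ l) / det (f x))"
    unfolding det_def
    by (intro continuous_intros) (use nz comp f in \<open>auto simp: det_def intro!: continuous_intros\<close>)
  then show ?thesis
    by (rule continuous_on_eq) (simp add: vec_eq_iff eq)
qed

lemma continuous_on_matrix_mult [continuous_intros]: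
  fixes f :: "'a::topological_space \<Rightarrow> real^'m^'l" and g :: "'a \<Rightarrow> real^'n^'m"
  shows "continuous_on S f \<Longrightarrow> continuous_on S g \<Longrightarrow> continuous_on S (\<lambda>x. f x ** g x)"
  unfolding matrix_matrix_mult_def by (intro continuous_intros)

lemma continuous_on_transpose [continuous_intros]:
  fixes f :: "'a::topological_space \<Rightarrow> real^'m^'l"
  shows "continuous_on S f \<Longrightarrow> continuous_on S (\<lambda>x. transpose (f x))"
  unfolding transpose_def by (intro continuous_intros)

section \<open>The Cayley chart around a frame\<close>

definition tangent :: "real^'n^'k \<Rightarrow> (real^'n^'k) set" where
  "tangent p = {w. w ** transpose p + p ** transpose w = 0}"

lemma subspace_tangent: "subspace (tangent p)"
proof (rule subspaceI)
  show "x + y \<in> tangent p" if "x \<in> tangent p" "y \<in> tangent p" for x y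
  proof -
    have "(x + y) ** transpose p + p ** transpose (x + y)
      = (x ** transpose p + p ** transpose x) + (y ** transpose p + p ** transpose y)"
      by (simp add: matrix_ring_simps transpose_simps)
    then show ?thesis using that by (simp add: tangent_def)
  qed
  show "c *\<^sub>R x \<in> tangent p" if "x \<in> tangent p" for c x
    using that by (simp add: tangent_def matrix_scaleR transpose_scalar flip: scaleR_add_right)
qed (simp add: tangent_def matrix_ring_simps transpose_simps)

lemma tangent_antisym:
  assumes "w \<in> tangent p"
  shows "transpose (w ** transpose p) = - (w ** transpose p)"
  using assms by (simp add: tangent_def matrix_transpose_mul add_eq_0_iff)

definition normal_part :: "real^'n^'k \<Rightarrow> real^'n^'k \<Rightarrow> real^'n^'k" where
  "normal_part p w = w - w ** transpose p ** p"

definition cayley_matrix :: "real^'n^'k \<Rightarrow> real^'n^'k \<Rightarrow> real^'k^'k" where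
  "cayley_matrix p w = mat 1 - w ** transpose p + normal_part p w ** transpose (normal_part p w)"

text \<open>A row-compressed form of the Cayley transform \<open>p (1 + B) (1 - B)\<^sup>-\<^sup>1\<close>, where \<open>B\<close> is the
  antisymmetric matrix of size \<open>n\<close> that corresponds to the tangent vector \<open>w\<close>.\<close>

definition cayley :: "real^'n^'k \<Rightarrow> real^'n^'k \<Rightarrow> real^'n^'k" where
  "cayley p w = matrix_inv (cayley_matrix p w) ** ((p + normal_part p w) + (p + normal_part p w)) - p"

definition cayley_domain :: "real^'n^'k \<Rightarrow> (real^'n^'k) set" where
  "cayley_domain p = {x \<in> stiefel. invertible (mat 1 + x ** transpose p)}"

text \<open>For \<open>x = cayley p w\<close> the matrix \<open>mat 1 + x ** transpose p\<close> is
  twice the inverse of \<open>cayley_matrix p w\<close>. Solving the chart formula for the normal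
  part gives this expression, and the matrix \<open>w ** transpose p\<close> can then be read off
  from \<open>cayley_matrix\<close>.\<close>

definition cayley_inv_normal :: "real^'n^'k \<Rightarrow> real^'n^'k \<Rightarrow> real^'n^'k" where
  "cayley_inv_normal p x = matrix_inv (mat 1 + x ** transpose p) ** (x + p) - p"

definition cayley_inv :: "real^'n^'k \<Rightarrow> real^'n^'k \<Rightarrow> real^'n^'k" where
  "cayley_inv p x = (mat 1 + cayley_inv_normal p x ** transpose (cayley_inv_normal p x)
     - (matrix_inv (mat 1 + x ** transpose p) + matrix_inv (mat 1 + x ** transpose p))) ** p
     + cayley_inv_normal p x"

lemma normal_part_orth:
  assumes "p \<in> stiefel"
  shows "normal_part p w ** transpose p = 0" "p ** transpose (normal_part p w) = 0"
proof -
  have p: "p ** transpose p = mat 1" using assms by (simp add: stiefel_iff)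
  show *: "normal_part p w ** transpose p = 0"
    by (simp add: normal_part_def matrix_ring_simps p flip: matrix_mul_assoc)
  show "p ** transpose (normal_part p w) = 0"
    using arg_cong[OF *, of transpose] by (simp add: matrix_transpose_mul transpose_simps)
qed

text \<open>The antisymmetric part \<open>w ** transpose p\<close> contributes nothing to the
  quadratic form, and the Gram matrix of the normal part is positive semidefinite. The bound makes
  the chart defined on the whole tangent space and keeps the inverse matrix a contraction, which
  later yields Lipschitz estimates.\<close>

lemma inner_cayley_matrix:
  assumes w: "w \<in> tangent p"
  shows "u \<bullet> u \<le> u \<bullet> (cayley_matrix p w *v u)"
proof -
  let ?A = "w ** transpose p" and ?h = "normal_part p w"
  have "transpose ?A = - ?A"
    by (rule tangent_antisym[OF w])
  moreover have "u \<bullet> (?A *v u) = (transpose ?A *v u) \<bullet> u" by (simp add: dot_lmul_matrix)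
  moreover have "(- ?A) *v u = - (?A *v u)"
    by (simp add: matrix_vector_mult_def vec_eq_iff sum_negf)
  ultimately have "u \<bullet> (?A *v u) = - ((?A *v u) \<bullet> u)"
    by (simp only: inner_minus_left)
  then have "u \<bullet> (?A *v u) = - (u \<bullet> (?A *v u))" by (simp only: inner_commute)
  then have "u \<bullet> (?A *v u) = 0" by simp
  moreover have "u \<bullet> ((?h ** transpose ?h) *v u) \<ge> 0"
    by (simp add: matrix_vector_mul_assoc[symmetric] dot_lmul_matrix[symmetric])
  ultimately show ?thesis
    by (simp add: cayley_matrix_def matrix_vector_mult_add_rdistrib matrix_vector_mult_diff_rdistrib inner_add_right inner_diff_right)
qed

lemma invertible_cayley_matrix:
  assumes "w \<in> tangent p"
  shows "invertible (cayley_matrix p w)" "norm (matrix_inv (cayley_matrix p w) *v u) \<le> norm u"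
proof -
  let ?C = "cayley_matrix p w"
  have "u = 0" if "?C *v u = 0" for u
  proof -
    have "u \<bullet> u \<le> 0" using inner_cayley_matrix[OF assms, of u] that by simp
    then show ?thesis by (metis inner_gt_zero_iff linorder_not_less)
  qed
  then show inv: "invertible ?C" by (simp add: invertible_left_inverse matrix_left_invertible_ker)
  let ?v = "matrix_inv ?C *v u"
  have "?v \<bullet> ?v \<le> ?v \<bullet> (?C *v ?v)" by (rule inner_cayley_matrix[OF assms])
  also have "?C *v ?v = u" by (simp add: matrix_vector_mul_assoc inverse_matrix(2)[OF inv])
  also have "?v \<bullet> u \<le> norm ?v * norm u" by (rule norm_cauchy_schwarz)
  finally show "norm ?v \<le> norm u"
    by (cases "?v = 0") (auto simp: dot_square_norm power2_eq_square)
qed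

text \<open>With \<open>D = mat 1 + x ** transpose p\<close>, the second identity says that
  \<open>x\<close> is a frame exactly when the Gram matrix of \<open>x + p\<close> is
  \<open>D + transpose D\<close>. Both directions of the chart are verified through this
  relation.\<close>

lemma cayley_sum:
  assumes "p \<in> stiefel"
  shows "(x + p) ** transpose p = mat 1 + x ** transpose p"
    and "(x + p) ** transpose (x + p) = x ** transpose x - mat 1
       + ((mat 1 + x ** transpose p) + transpose (mat 1 + x ** transpose p))"
  using assms
  by (simp_all add: stiefel_iff matrix_ring_simps transpose_simps matrix_transpose_mul)

lemma cayley_in_domain:
  assumes p: "p \<in> stiefel" and w: "w \<in> tangent p"
  shows "cayley p w \<in> cayley_domain p" "cayley_inv p (cayley p w) = w"
proof -
  let ?h = "normal_part p w" and ?A = "w ** transpose p" and ?C = "cayley_matrix p w"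
  define N where "N = p + ?h"
  define Ci where "Ci = matrix_inv ?C"
  define x where "x = cayley p w"
  note inv = invertible_cayley_matrix(1)[OF w]
  have Ci: "Ci ** ?C = mat 1" "?C ** Ci = mat 1" using inverse_matrix[OF inv] by (simp_all add: Ci_def)
  have tCi: "transpose ?C ** transpose Ci = mat 1" by (simp add: matrix_transpose_mul[symmetric] Ci)
  have pp: "p ** transpose p = mat 1" using p by (simp add: stiefel_iff)
  have Np: "N ** transpose p = mat 1" by (simp add: N_def matrix_ring_simps normal_part_orth[OF p] pp)
  have NN: "N ** transpose N = mat 1 + ?h ** transpose ?h"
    by (simp add: N_def matrix_ring_simps transpose_simps normal_part_orth[OF p] pp)
  have tA: "transpose ?A = - ?A"
    by (rule tangent_antisym[OF w])
  have CC: "?C + transpose ?C = N ** transpose N + N ** transpose N"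
  proof -
    have "transpose (?h ** transpose ?h) = ?h ** transpose ?h" by (simp add: matrix_transpose_mul)
    then show ?thesis by (simp add: cayley_matrix_def transpose_simps tA NN)
  qed
  have xp: "x + p = Ci ** (N + N)" by (simp add: x_def cayley_def Ci_def N_def)
  have D: "mat 1 + x ** transpose p = Ci + Ci"
    unfolding cayley_sum(1)[OF p, symmetric] xp matrix_ring_simps matrix_mul_assoc[symmetric] Np
    by (simp only: matrix_mul_rid)
  have "(x + p) ** transpose (x + p) = Ci ** ((?C + transpose ?C) + (?C + transpose ?C)) ** transpose Ci"
    unfolding xp CC
    by (simp only: matrix_ring_simps transpose_simps matrix_transpose_mul matrix_mul_assoc add.assoc)
  also have "\<dots> = (Ci + Ci) + transpose (Ci + Ci)"
  proof -
    have "Ci ** transpose ?C ** transpose Ci = Ci" by (simp add: tCi flip: matrix_mul_assoc)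
    then show ?thesis
      by (simp only: matrix_ring_simps transpose_simps Ci matrix_mul_lid ac_simps)
  qed
  finally have "x ** transpose x = mat 1"
    using cayley_sum(2)[OF p, of x] D by simp
  moreover define E where "E = matrix_inv (mat 1 + x ** transpose p)"
  have invD: "invertible (mat 1 + x ** transpose p)"
  proof (rule inverse_matrix_unique)
    show "((1/2) *\<^sub>R ?C) ** (mat 1 + x ** transpose p) = mat 1"
      unfolding D matrix_ring_simps
      by (simp add: Ci flip: scalar_matrix_assoc scaleR_left_distrib)
  qed
  ultimately show "cayley p w \<in> cayley_domain p"
    by (simp add: cayley_domain_def stiefel_iff x_def)
  have "E ** (Ci + Ci) = mat 1" using inverse_matrix(1)[OF invD] by (simp add: E_def D)
  then have EC: "(E + E) ** Ci = mat 1" by (simp only: matrix_ring_simps)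
  then have "(E + E) ** Ci ** ?C = ?C" by simp
  then have EE: "E + E = ?C" by (simp add: Ci flip: matrix_mul_assoc)
  have "E ** (x + p) = (E + E) ** Ci ** N" by (simp only: xp matrix_ring_simps matrix_mul_assoc)
  then have "E ** (x + p) = N" by (simp only: EC matrix_mul_lid)
  then have h: "cayley_inv_normal p x = ?h" by (simp add: cayley_inv_normal_def E_def[symmetric] N_def)
  have "cayley_inv p x = ?A ** p + ?h"
    unfolding cayley_inv_def h E_def[symmetric] EE cayley_matrix_def by simp
  then show "cayley_inv p (cayley p w) = w" by (simp add: normal_part_def x_def)
qed

lemma cayley_inv_tangent:
  assumes p: "p \<in> stiefel" and x: "x \<in> cayley_domain p"
  shows "cayley_inv p x \<in> tangent p" "cayley p (cayley_inv p x) = x"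
proof -
  let ?D = "mat 1 + x ** transpose p"
  define E where "E = matrix_inv ?D"
  define h where "h = cayley_inv_normal p x"
  define A where "A = mat 1 + h ** transpose h - (E + E)"
  have pp: "p ** transpose p = mat 1" and xx: "x ** transpose x = mat 1" and inv: "invertible ?D"
    using p x by (simp_all add: stiefel_iff cayley_domain_def)
  have E: "E ** ?D = mat 1" "?D ** E = mat 1" using inverse_matrix[OF inv] by (simp_all add: E_def)
  have tE: "transpose ?D ** transpose E = mat 1" by (simp add: matrix_transpose_mul[symmetric] E)
  have hE: "p + h = E ** (x + p)" by (simp add: h_def cayley_inv_normal_def E_def)
  have "(p + h) ** transpose p = mat 1"
    unfolding hE by (simp add: cayley_sum(1)[OF p] E flip: matrix_mul_assoc)
  then have hp: "h ** transpose p = 0" by (simp add: matrix_ring_simps pp)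
  have ph: "p ** transpose h = 0"
    using arg_cong[OF hp, of transpose] by (simp add: matrix_transpose_mul transpose_simps)
  have "(p + h) ** transpose (p + h) = E ** (?D + transpose ?D) ** transpose E"
  proof -
    have "(p + h) ** transpose (p + h) = E ** ((x + p) ** transpose (x + p)) ** transpose E"
      unfolding hE by (simp add: matrix_transpose_mul matrix_mul_assoc)
    then show ?thesis unfolding cayley_sum(2)[OF p] xx by simp
  qed
  also have "\<dots> = transpose E + E"
    using E tE by (simp only: matrix_ring_simps(1,2)) (simp add: tE flip: matrix_mul_assoc)
  finally have hh: "mat 1 + h ** transpose h = transpose E + E"
    by (simp add: matrix_ring_simps transpose_simps hp ph pp)
  have w: "cayley_inv p x = A ** p + h" by (simp add: cayley_inv_def A_def E_def h_def)
  have wp: "cayley_inv p x ** transpose p = A"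
    by (simp add: w matrix_ring_simps hp pp flip: matrix_mul_assoc)
  have "A + transpose A = 0"
    unfolding A_def hh by (simp add: transpose_simps)
  moreover have "p ** transpose (cayley_inv p x) = transpose A"
    unfolding wp[symmetric] by (simp add: matrix_transpose_mul)
  ultimately show "cayley_inv p x \<in> tangent p" by (simp add: tangent_def wp)
  then have invC: "invertible (cayley_matrix p (cayley_inv p x))" by (rule invertible_cayley_matrix)
  have n: "normal_part p (cayley_inv p x) = h" by (simp add: normal_part_def wp) (simp add: w)
  have C: "cayley_matrix p (cayley_inv p x) = E + E"
    unfolding cayley_matrix_def n wp by (simp add: A_def)
  define Ci where "Ci = matrix_inv (E + E)"
  have "Ci ** (E + E) = mat 1" using inverse_matrix(1)[OF invC] by (simp add: C Ci_def)
  then have CE: "(Ci + Ci) ** E = mat 1" by (simp only: matrix_ring_simps)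
  have "Ci ** ((p + h) + (p + h)) = (Ci + Ci) ** E ** (x + p)"
    unfolding hE by (simp only: matrix_ring_simps matrix_mul_assoc ac_simps)
  then show "cayley p (cayley_inv p x) = x"
    unfolding cayley_def C n Ci_def[symmetric]
    by (simp only: CE matrix_mul_lid add_diff_cancel_right')
qed

lemma continuous_on_cayley: "continuous_on (tangent p) (cayley p)"
  unfolding cayley_def normal_part_def
  by (intro continuous_intros continuous_on_matrix_inv invertible_cayley_matrix)
    (simp_all add: cayley_matrix_def normal_part_def continuous_intros)

lemma continuous_on_cayley_inv: "continuous_on (cayley_domain p) (cayley_inv p)"
  unfolding cayley_inv_def cayley_inv_normal_def
  by (intro continuous_intros continuous_on_matrix_inv) (simp_all add: cayley_domain_def)

lemma homeomorphism_cayley: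
  "p \<in> stiefel \<Longrightarrow> homeomorphism (tangent p) (cayley_domain p) (cayley p) (cayley_inv p)"
  by (rule homeomorphismI) (auto simp: continuous_on_cayley continuous_on_cayley_inv cayley_in_domain cayley_inv_tangent)

lemma openin_cayley_domain: "openin (top_of_set stiefel) (cayley_domain p)"
proof -
  have "continuous_on stiefel (\<lambda>x. det (mat 1 + x ** transpose p))"
    unfolding det_def by (intro continuous_intros)
  then have "openin (top_of_set stiefel) (stiefel \<inter> (\<lambda>x. det (mat 1 + x ** transpose p)) -` (- {0}))"
    by (rule continuous_openin_preimage_gen) auto
  moreover have "stiefel \<inter> (\<lambda>x. det (mat 1 + x ** transpose p)) -` (- {0}) = cayley_domain p"
    by (auto simp: cayley_domain_def invertible_det_nz)
  ultimately show ?thesis by simp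
qed

text \<open>For \<open>u\<close> in the kernel of \<open>mat 1 + x ** transpose p\<close>, which is
  \<open>2 + (x - p) ** transpose p\<close>, one gets \<open>2 |u| \<le> |x - p| |u|\<close>,
  because \<open>transpose p\<close> preserves norms.\<close>

lemma cayley_domain_near:
  assumes p: "p \<in> stiefel" and x: "x \<in> stiefel" "dist x p < 2"
  shows "x \<in> cayley_domain p"
proof -
  let ?D = "mat 1 + x ** transpose p"
  have pp: "p ** transpose p = mat 1" using p by (simp add: stiefel_iff)
  have "u = 0" if u: "?D *v u = 0" for u
  proof (rule ccontr)
    assume "u \<noteq> 0"
    have eq: "?D = (mat 1 + mat 1) + (x - p) ** transpose p" by (simp add: matrix_ring_simps pp)
    have "u + u + (x - p) *v (transpose p *v u) = 0"
      using u unfolding eq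
      by (simp only: matrix_vector_mult_add_rdistrib matrix_vector_mul_lid matrix_vector_mul_assoc)
    then have "2 *\<^sub>R u = - ((x - p) *v (transpose p *v u))"
      by (simp only: eq_neg_iff_add_eq_0 scaleR_2)
    then have "2 * norm u = norm ((x - p) *v (transpose p *v u))"
      by (metis norm_minus_cancel norm_scaleR abs_numeral)
    also have "\<dots> \<le> norm (x - p) * norm (transpose p *v u)" by (rule norm_matrix_vector_le)
    also have "norm (transpose p *v u) = norm u"
    proof -
      have "(transpose p *v u) \<bullet> (transpose p *v u) = u \<bullet> (p *v (transpose p *v u))"
        using dot_lmul_matrix[of u p "transpose p *v u"] by simp
      also have "p *v (transpose p *v u) = u"
        by (simp only: matrix_vector_mul_assoc pp matrix_vector_mul_lid)
      finally show ?thesis by (simp only: norm_eq_sqrt_inner)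
    qed
    also have "norm (x - p) * norm u < 2 * norm u"
      using x(2) \<open>u \<noteq> 0\<close> by (simp add: dist_norm)
    finally show False by simp
  qed
  then have "invertible ?D" by (simp add: invertible_left_inverse matrix_left_invertible_ker)
  then show ?thesis using x by (simp add: cayley_domain_def)
qed

lemma stiefel_norm:
  assumes "v \<in> (stiefel :: (real^'n^'k) set)"
  shows "norm v = sqrt (CARD('k))"
proof -
  have "norm (v $ i) = 1" for i using assms by (simp add: stiefel_def norm_eq_1)
  then show ?thesis unfolding norm_vec_def[of v] L2_set_def by simp
qed

section \<open>The dimension of the Stiefel manifold\<close>

lemma inner_transpose: "transpose X \<bullet> transpose Y = (X :: real^'n^'m) \<bullet> Y"
  unfolding inner_vec_def transpose_def by (simp add: sum.swap[of _ "UNIV :: 'n set"])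

lemma norm_transpose: "norm (transpose X) = norm (X :: real^'n^'m)"
  by (simp add: norm_eq_sqrt_inner inner_transpose)

lemma inner_matrix_mult: "(S ** p) \<bullet> w = S \<bullet> (w ** transpose (p :: real^'n^'k))"
  by (simp add: inner_vec_def matrix_matrix_mult_def transpose_def sum_distrib_left sum_distrib_right
      mult.assoc mult.left_commute sum.swap[of _ "UNIV :: 'n set"] mult.commute)

definition symmetric_matrices :: "(real^'k^'k) set" where
  "symmetric_matrices = {S. transpose S = S}"

lemma subspace_symmetric_matrices: "subspace symmetric_matrices"
  by (auto simp: subspace_def symmetric_matrices_def transpose_simps transpose_scalar)

text \<open>The indicator matrices of the sets \<open>{i, j}\<close>, with one or two elements, have
  disjoint supports and form an orthogonal basis.\<close>

lemma dim_symmetric_matrices: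
  "dim (symmetric_matrices :: (real^'k::finite^'k) set) = CARD('k) + CARD('k) * (CARD('k) - 1) div 2"
proof -
  define I where "I = {s :: 'k set. card s = 1} \<union> {s. card s = 2}"
  define sy :: "'k set \<Rightarrow> real^'k^'k" where "sy s = (\<chi> i j. if {i, j} = s then 1 else 0)" for s
  have I: "\<exists>i j. s = {i, j}" if "s \<in> I" for s
    using that by (auto simp: I_def card_1_singleton_iff card_2_iff)
  have ijI: "{i, j} \<in> I" for i j by (cases "i = j") (auto simp: I_def)
  have nz: "sy s \<noteq> 0" if s: "s \<in> I" for s
  proof -
    obtain i j where "s = {i, j}" using I[OF s] by auto
    then have "sy s $ i $ j = 1" by (simp add: sy_def)
    then show ?thesis by auto
  qed
  have orth: "sy s \<bullet> sy t = 0" if "s \<noteq> t" for s t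
    unfolding inner_vec_def sy_def using that by (auto intro!: sum.neutral split: if_splits)
  have inj: "inj_on sy I"
  proof (rule inj_onI, rule ccontr)
    fix s t assume "s \<in> I" "t \<in> I" "sy s = sy t" "s \<noteq> t"
    then show False using orth[of s t] nz[of s] by simp
  qed
  have "pairwise orthogonal (sy ` I)"
  proof (rule pairwiseI)
    fix x y assume "x \<in> sy ` I" "y \<in> sy ` I" "x \<noteq> y"
    then obtain s t where "x = sy s" "y = sy t" "s \<noteq> t" by blast
    then show "orthogonal x y" using orth by (simp add: orthogonal_def)
  qed
  then have ind: "independent (sy ` I)"
    using nz by (intro pairwise_orthogonal_independent) auto
  have sub: "sy ` I \<subseteq> symmetric_matrices"
    by (auto simp: symmetric_matrices_def sy_def transpose_def vec_eq_iff insert_commute)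
  have span: "symmetric_matrices \<subseteq> span (sy ` I)"
  proof
    fix S :: "real^'k^'k" assume "S \<in> symmetric_matrices"
    then have sym: "S $ i $ j = S $ j $ i" for i j
      by (auto simp: symmetric_matrices_def transpose_def vec_eq_iff)
    define c where "c s = (SOME r. \<exists>i j. s = {i, j} \<and> r = S $ i $ j)" for s
    have c: "c {i, j} = S $ i $ j" for i j
      unfolding c_def using sym by (intro some_equality) (auto simp: doubleton_eq_iff)
    have "S $ i $ j = (\<Sum>s\<in>I. c s * (if {i, j} = s then 1 else 0))" for i j
    proof -
      have "(\<Sum>s\<in>I. c s * (if {i, j} = s then 1 else 0)) = (\<Sum>s\<in>I. if s = {i, j} then c s else 0)"
        by (rule sum.cong) auto
      then show ?thesis using ijI[of i j] c[of i j] by simp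
    qed
    then have "S = (\<Sum>s\<in>I. c s *\<^sub>R sy s)" by (simp add: vec_eq_iff sy_def)
    also have "\<dots> \<in> span (sy ` I)" by (intro span_sum span_scale span_base) auto
    finally show "S \<in> span (sy ` I)" .
  qed
  have "card I = card {s :: 'k set. card s = 1} + card {s :: 'k set. card s = 2}"
    unfolding I_def by (rule card_Un_disjoint) auto
  also have "\<dots> = (CARD('k) choose 1) + (CARD('k) choose 2)"
    using n_subsets[of "UNIV :: 'k set" 1] n_subsets[of "UNIV :: 'k set" 2] by simp
  finally have "card (sy ` I) = CARD('k) + CARD('k) * (CARD('k) - 1) div 2"
    by (simp add: card_image[OF inj] choose_two)
  then show ?thesis by (rule dim_unique[OF sub span ind])
qed

text \<open>The tangent space is the orthogonal complement of the matrices \<open>S ** p\<close>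
  with \<open>S\<close> symmetric: being orthogonal to all of them means that
  \<open>w ** transpose p\<close> is orthogonal to every symmetric matrix, hence
  antisymmetric.\<close>

lemma dim_tangent:
  fixes p :: "real^'n::finite^'k::finite"
  assumes p: "p \<in> stiefel"
  shows "dim (tangent p) = CARD('n) * CARD('k) - CARD('k) * (CARD('k) + 1) div 2"
proof -
  have pp: "p ** transpose p = mat 1" using p by (simp add: stiefel_iff)
  define A where "A = (\<lambda>S. S ** p) ` symmetric_matrices"
  have lin: "linear (\<lambda>S :: real^'k^'k. S ** p)"
    by (rule linearI) (simp_all add: matrix_ring_simps matrix_scaleR)
  have "inj (\<lambda>S :: real^'k^'k. S ** p)"
  proof (rule injI)
    fix S T :: "real^'k^'k" assume "S ** p = T ** p"
    then have "S ** p ** transpose p = T ** p ** transpose p" by simp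
    then show "S = T" by (simp add: pp flip: matrix_mul_assoc)
  qed
  then have dimA: "dim A = dim (symmetric_matrices :: (real^'k^'k) set)"
    unfolding A_def by (intro dim_image_eq[OF lin]) (auto intro: inj_on_subset)
  have subA: "subspace A" unfolding A_def by (intro linear_subspace_image lin subspace_symmetric_matrices)
  have "tangent p = {y \<in> UNIV. \<forall>x\<in>A. orthogonal x y}"
  proof (intro equalityI subsetI)
    fix w assume w: "w \<in> tangent p"
    let ?M = "w ** transpose p"
    have "S \<bullet> ?M = 0" if "transpose S = S" for S
      using inner_transpose[of S ?M] tangent_antisym[OF w] that by simp
    then show "w \<in> {y \<in> UNIV. \<forall>x\<in>A. orthogonal x y}"
      by (auto simp: A_def symmetric_matrices_def orthogonal_def inner_matrix_mult)
  next
    fix w assume w: "w \<in> {y \<in> UNIV. \<forall>x\<in>A. orthogonal x y}"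
    let ?M = "w ** transpose p"
    let ?S = "?M + transpose ?M"
    have sym: "transpose ?S = ?S" by (simp add: transpose_simps add.commute)
    then have "?S \<in> symmetric_matrices" by (simp add: symmetric_matrices_def)
    then have "?S \<bullet> ?M = 0" using w by (auto simp: A_def orthogonal_def inner_matrix_mult)
    moreover have "?S \<bullet> transpose ?M = ?S \<bullet> ?M" using inner_transpose[of ?S ?M] sym by simp
    ultimately have "?S \<bullet> ?S = 0" unfolding inner_add_right[of ?S ?M] by simp
    then have "?S = 0" by simp
    then show "w \<in> tangent p" by (simp add: tangent_def matrix_transpose_mul)
  qed
  then have "dim (tangent p) + dim A = dim (UNIV :: (real^'n^'k) set)"
    using dim_subspace_orthogonal_to_vectors[OF subA subspace_UNIV] by simp
  then have *: "dim (tangent p) + (CARD('k) + CARD('k) * (CARD('k) - 1) div 2) = CARD('k) * CARD('n)"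
    by (simp add: dimA dim_symmetric_matrices)
  have "CARD('k) * (CARD('k) + 1) div 2 = CARD('k) + CARD('k) * (CARD('k) - 1) div 2"
  proof -
    have "CARD('k) * (CARD('k) + 1) = CARD('k) * 2 + CARD('k) * (CARD('k) - 1)"
      by (cases "CARD('k)") (simp_all add: algebra_simps)
    then show ?thesis by simp
  qed
  then show ?thesis using * by (simp add: mult.commute)
qed

text \<open>If \<open>m < n\<close>, invariance of domain makes \<open>A\<close> open in the larger
  space, although it lies in the hyperplane where coordinate \<open>m\<close> is 0; moving that
  coordinate leaves \<open>A\<close>.\<close>

lemma homeomorphic_open_Euclidean_space_dim:
  assumes A: "openin (Euclidean_space m) A" and B: "openin (Euclidean_space n) B" "B \<noteq> {}"
    and hom: "subtopology (Euclidean_space m) A homeomorphic_space subtopology (Euclidean_space n) B"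
  shows "n \<le> m"
proof (rule ccontr)
  assume "\<not> n \<le> m"
  then have mn: "m < n" by simp
  obtain f where f: "homeomorphic_map (subtopology (Euclidean_space n) B) (subtopology (Euclidean_space m) A) f"
    using hom homeomorphic_space homeomorphic_space_sym by metis
  have E: "Euclidean_space m = subtopology (Euclidean_space n) {x. \<forall>i\<ge>m. x i = 0}"
    unfolding Euclidean_space_def subtopology_subtopology
    by (rule arg_cong[where f = "subtopology _"]) (use mn in auto)
  have tB: "topspace (subtopology (Euclidean_space n) B) = B"
    using openin_subset[OF B(1)] by auto
  have tA: "topspace (subtopology (Euclidean_space m) A) = A"
    using openin_subset[OF A] by auto
  have fB: "f ` B = A" and inj: "inj_on f B"
    using homeomorphic_imp_surjective_map[OF f] homeomorphic_imp_injective_map[OF f] by (simp_all only: tA tB)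
  have "continuous_map (subtopology (Euclidean_space n) B) (Euclidean_space m) f"
    using homeomorphic_imp_continuous_map[OF f] by (rule continuous_map_into_fulltopology)
  then have "continuous_map (subtopology (Euclidean_space n) B) (Euclidean_space n) f"
    unfolding E by (rule continuous_map_into_fulltopology)
  then have op: "openin (Euclidean_space n) A"
    using invariance_of_domain_Euclidean_space[OF B(1) _ inj] fB by simp
  obtain x where x: "x \<in> A" using B(2) fB by auto
  have x0: "x i = 0" if "m \<le> i" for i
    using openin_subset[OF A] x that by (auto simp: topspace_Euclidean_space)
  have eq: "(\<lambda>t. x(m := t)) = (\<lambda>t i. if i < n then (if i = m then t else x i) else 0)"
    using x0 mn by (auto simp: fun_eq_iff)
  have "continuous_map euclideanreal (Euclidean_space n) (\<lambda>t. x(m := t))"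
    unfolding eq continuous_map_componentwise_Euclidean_space by (auto simp: continuous_map_iff_continuous2)
  then have "openin euclideanreal {t \<in> topspace euclideanreal. x(m := t) \<in> A}"
    using op by (rule openin_continuous_map_preimage)
  then have "open {t. x(m := t) \<in> A}" by simp
  moreover have "0 \<in> {t. x(m := t) \<in> A}" using x x0[of m] by (simp add: fun_upd_idem)
  ultimately obtain e where e: "e > 0" "ball 0 e \<subseteq> {t. x(m := t) \<in> A}"
    using open_contains_ball by blast
  then have "e / 2 \<in> {t. x(m := t) \<in> A}" by (auto simp: subset_iff dist_norm)
  then have "\<forall>i\<ge>m. (x(m := e / 2)) i = 0"
    using openin_subset[OF A] unfolding topspace_Euclidean_space by blast
  then show False using e(1) by (auto dest: spec[of _ m])
qed

lemma second_countable_euclidean: "second_countable (euclidean :: 'a::second_countable_topology topology)"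
proof -
  obtain \<B> :: "'a set set" where \<B>: "countable \<B>" "topological_basis \<B>"
    using ex_countable_basis by (elim exE conjE)
  have "\<exists>V\<in>\<B>. x \<in> V \<and> V \<subseteq> U" if "openin euclidean U \<and> x \<in> U" for U x
  proof -
    have "open U" "x \<in> U" using that by auto
    then obtain V where "V \<in> \<B>" "x \<in> V" "V \<subseteq> U" by (rule topological_basisE[OF \<B>(2)])
    then show ?thesis by (intro bexI conjI)
  qed
  moreover have "openin euclidean V" if "V \<in> \<B>" for V
    using topological_basis_open[OF \<B>(2) that] by simp
  ultimately show ?thesis
    unfolding second_countable_def using \<B>(1) by (intro exI[of _ \<B>]) simp
qed

theorem manifold_dim_stiefel:
  fixes V :: "(real^'n::finite^'k::finite) topology"
  assumes V: "V = stiefel_space" and ne: "stiefel \<noteq> ({} :: (real^'n^'k) set)"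
  shows "manifold_dim V = CARD('n) * CARD('k) - CARD('k) * (CARD('k) + 1) div 2"
proof -
  let ?d = "CARD('n) * CARD('k) - CARD('k) * (CARD('k) + 1) div 2"
  let ?S = "stiefel :: (real^'n^'k) set"
  have chart: "subtopology V (cayley_domain p) homeomorphic_space Euclidean_space ?d" if p: "p \<in> ?S" for p
  proof -
    have "cayley_domain p homeomorphic tangent p"
      using homeomorphism_cayley[OF p] homeomorphic_sym homeomorphic_def by blast
    then have "top_of_set (cayley_domain p) homeomorphic_space top_of_set (tangent p)"
      by simp
    also have "top_of_set (tangent p) homeomorphic_space Euclidean_space (dim (tangent p))"
      by (rule homeomorphic_subspace_Euclidean_space_dim[OF subspace_tangent])
    finally have "top_of_set (cayley_domain p) homeomorphic_space Euclidean_space ?d"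
      by (simp add: dim_tangent[OF p])
    moreover have "stiefel \<inter> cayley_domain p = cayley_domain p" by (auto simp: cayley_domain_def)
    then have "subtopology V (cayley_domain p) = top_of_set (cayley_domain p)"
      by (simp add: V stiefel_space_def subtopology_subtopology)
    ultimately show ?thesis by simp
  qed
  have near: "p \<in> cayley_domain p" if "p \<in> ?S" for p
    using cayley_domain_near[OF that that] by simp
  have op: "openin V (cayley_domain p)" for p
    using openin_cayley_domain by (simp add: V stiefel_space_def)
  have mani: "topological_manifold ?d V"
    unfolding topological_manifold_def
  proof (intro conjI ballI)
    show "Hausdorff_space V" by (simp add: V stiefel_space_def Hausdorff_space_subtopology)
    show "second_countable V"
      unfolding V stiefel_space_def by (intro second_countable_subtopology second_countable_euclidean)
    fix p assume "p \<in> topspace V"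
    then have p: "p \<in> ?S" by (simp add: V)
    show "\<exists>U W. openin V U \<and> p \<in> U \<and> openin (Euclidean_space ?d) W \<and>
        subtopology V U homeomorphic_space subtopology (Euclidean_space ?d) W"
      using chart[OF p] near[OF p] op[of p]
      by (intro exI[of _ "cayley_domain p"] exI[of _ "topspace (Euclidean_space ?d)"]) simp
  qed
  \<comment> \<open>\<open>manifold_dim\<close> is a definite description, so every other dimension
    has to be excluded; both charts are restricted to a common neighbourhood of a point.\<close>
  have "d' = ?d" if d': "topological_manifold d' V" for d'
  proof -
    obtain p where p: "p \<in> ?S" using ne by auto
    then obtain U W where U: "openin V U" "p \<in> U" "openin (Euclidean_space d') W"
      "subtopology V U homeomorphic_space subtopology (Euclidean_space d') W"
      using d' unfolding topological_manifold_def V by auto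
    let ?O = "U \<inter> cayley_domain p"
    have opO: "openin V ?O" using U(1) op by blast
    have local_chart: "\<exists>B. openin (Euclidean_space m) B \<and> B \<noteq> {} \<and>
        subtopology V ?O homeomorphic_space subtopology (Euclidean_space m) B"
      if T: "openin V T" "?O \<subseteq> T" "openin (Euclidean_space m) C"
        "subtopology V T homeomorphic_space subtopology (Euclidean_space m) C" for T C m
    proof -
      obtain f where f: "homeomorphic_map (subtopology V T) (subtopology (Euclidean_space m) C) f"
        using T(4) homeomorphic_space by blast
      have OT: "openin (subtopology V T) ?O"
        unfolding openin_subtopology using opO T(2) by (intro exI[of _ ?O]) auto
      have fO: "openin (subtopology (Euclidean_space m) C) (f ` ?O)"
        using homeomorphic_map_openness_eq[OF f] OT by blast
      then have "openin (Euclidean_space m) (f ` ?O)" using T(3) openin_trans_full by blast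
      moreover have "homeomorphic_map (subtopology (subtopology V T) ?O) (subtopology (subtopology (Euclidean_space m) C) (f ` ?O)) f"
        using openin_subset[OF OT] openin_subset[OF fO]
        by (intro homeomorphic_map_subtopologies[OF f]) (simp only: inf.absorb2)
      moreover have "subtopology (subtopology V T) ?O = subtopology V ?O"
        "subtopology (subtopology (Euclidean_space m) C) (f ` ?O) = subtopology (Euclidean_space m) (f ` ?O)"
        using T(2) openin_subset[OF fO] by (simp_all add: subtopology_subtopology inf.absorb2)
      ultimately have "openin (Euclidean_space m) (f ` ?O)"
        "subtopology V ?O homeomorphic_space subtopology (Euclidean_space m) (f ` ?O)"
        using homeomorphic_map_imp_homeomorphic_space by auto
      moreover have "f ` ?O \<noteq> {}" using U(2) near[OF p] by auto
      ultimately show ?thesis by blast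
    qed
    obtain B where B: "openin (Euclidean_space d') B" "B \<noteq> {}"
      "subtopology V ?O homeomorphic_space subtopology (Euclidean_space d') B"
      using local_chart[OF U(1) _ U(3,4)] by blast
    obtain C where C: "openin (Euclidean_space ?d) C" "C \<noteq> {}"
      "subtopology V ?O homeomorphic_space subtopology (Euclidean_space ?d) C"
      using local_chart[OF op[of p] _ openin_topspace] chart[OF p] by auto
    have "subtopology (Euclidean_space d') B homeomorphic_space subtopology (Euclidean_space ?d) C"
      using B(3) C(3) homeomorphic_space_sym homeomorphic_space_trans by blast
    then show ?thesis
      using homeomorphic_open_Euclidean_space_dim[OF B(1) C(1,2)]
        homeomorphic_open_Euclidean_space_dim[OF C(1) B(1,2)] homeomorphic_space_sym
      by (intro le_antisym) blast+
  qed
  then show ?thesis unfolding manifold_dim_def using mani by (intro the_equality)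
qed

section \<open>The orbit space and the comparison of genus and category\<close>

lemma norm_matrix_contraction:
  fixes C :: "real^'m^'l" and M :: "real^'n^'m"
  assumes "\<And>u. norm (C *v u) \<le> norm u"
  shows "norm (C ** M) \<le> norm M"
proof -
  have "norm (transpose (C ** M)) \<le> norm (transpose M)"
  proof (rule norm_le_componentwise_cart)
    fix c
    have "transpose (C ** M) $ c = C *v (transpose M $ c)"
      by (simp add: transpose_def matrix_matrix_mult_def matrix_vector_mult_def vec_eq_iff)
    then show "norm (transpose (C ** M) $ c) \<le> norm (transpose M $ c)"
      using assms by simp
  qed
  then show ?thesis by (simp add: norm_transpose)
qed

abbreviation (input) SP :: "(real^'k^'k) set" where
  "SP \<equiv> carrier signed_perm_group"

lemma signed_perm_closed:
  shows "g \<in> SP \<Longrightarrow> h \<in> SP \<Longrightarrow> g ** h \<in> (SP :: (real^'k^'k) set)"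
    and "mat 1 \<in> (SP :: (real^'k^'k) set)"
    and "g \<in> SP \<Longrightarrow> transpose g \<in> (SP :: (real^'k^'k) set)"
    and "g \<in> SP \<Longrightarrow> g ** transpose g = (mat 1 :: real^'k^'k)"
    and "g \<in> SP \<Longrightarrow> transpose g ** g = (mat 1 :: real^'k^'k)"
proof -
  interpret G: group "signed_perm_group :: (real^'k^'k) monoid" by (rule group_signed_perm_group)
  show "g \<in> SP \<Longrightarrow> h \<in> SP \<Longrightarrow> g ** h \<in> (SP :: (real^'k^'k) set)"
    using G.m_closed[of g h] by (simp add: signed_perm_group_def)
  show "mat 1 \<in> (SP :: (real^'k^'k) set)"
    using G.one_closed by (simp add: signed_perm_group_def)
  assume g: "g \<in> (SP :: (real^'k^'k) set)"
  then obtain \<epsilon> \<sigma> where *: "g = signed_perm_matrix \<epsilon> \<sigma>" "\<forall>i. \<epsilon> i \<in> {1, -1}" "bij \<sigma>"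
    by (auto simp: signed_perm_group_def)
  show "g ** transpose g = (mat 1 :: real^'k^'k)" "transpose g ** g = (mat 1 :: real^'k^'k)"
    using signed_perm_orthogonal(1)[OF *(2,3)] *(1) by (simp_all add: orthogonal_matrix_def)
  show "transpose g \<in> SP"
    unfolding *(1) signed_perm_orthogonal(2)[OF *(2,3)] signed_perm_group_def
    using *(2) bij_imp_bij_inv[OF *(3)] by fastforce
qed

lemma signed_perm_stiefel:
  assumes "g \<in> SP" "v \<in> stiefel"
  shows "g ** v \<in> stiefel"
proof -
  have "(g ** v) ** transpose (g ** v) = g ** (v ** transpose v) ** transpose g"
    by (simp add: matrix_transpose_mul matrix_mul_assoc)
  then show ?thesis using assms signed_perm_closed(4)[OF assms(1)] by (simp add: stiefel_iff)
qed

lemma signed_perm_dist: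
  fixes x y :: "real^'n^'k"
  assumes g: "g \<in> SP"
  shows "dist (g ** x) (g ** y) = dist x y"
proof -
  have *: "norm (h ** z) \<le> norm z" if "h \<in> SP" for h and z :: "real^'n^'k"
  proof (rule norm_matrix_contraction)
    fix u
    have "orthogonal_matrix h" using signed_perm_closed(4,5)[OF that] by (simp add: orthogonal_matrix_def)
    then show "norm (h *v u) \<le> norm u"
      using orthogonal_transformation_matrix[of "(*v) h"] by (simp add: orthogonal_transformation_norm)
  qed
  have "norm (x - y) = norm (transpose g ** (g ** (x - y)))"
    by (simp add: matrix_mul_assoc signed_perm_closed(5)[OF g])
  also have "\<dots> \<le> norm (g ** (x - y))" by (rule *[OF signed_perm_closed(3)[OF g]])
  finally show ?thesis using *[OF g, of "x - y"] by (simp add: dist_norm matrix_ring_simps)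
qed

text \<open>Right multiplication by a frame preserves norms, so the distance equals
  \<open>norm (g - h)\<close>, and two different matrices with entries in \<open>{0, 1, -1}\<close>
  differ by at least 1 in some entry.\<close>

lemma signed_perm_separated:
  fixes x :: "real^'n^'k"
  assumes x: "x \<in> stiefel" and g: "g \<in> SP" "h \<in> SP" "g \<noteq> h"
  shows "1 \<le> dist (g ** x) (h ** x)"
proof -
  obtain i j where ij: "g $ i $ j \<noteq> h $ i $ j" using g(3) by (auto simp: vec_eq_iff)
  have entry: "m $ i $ j \<in> {0, 1, -1}" if "m \<in> SP" for m
  proof -
    obtain \<epsilon> \<sigma> where "m = signed_perm_matrix \<epsilon> \<sigma>" "\<epsilon> i \<in> {1, -1}"
      using \<open>m \<in> SP\<close> by (auto simp: signed_perm_group_def)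
    then show ?thesis by (simp add: signed_perm_matrix_def)
  qed
  have "1 \<le> \<bar>(g - h) $ i $ j\<bar>" using ij entry[OF g(1)] entry[OF g(2)] by auto
  also have "\<dots> \<le> norm ((g - h) $ i)" by (rule component_le_norm_cart)
  also have "\<dots> \<le> norm (g - h)"
    unfolding norm_vec_def[of "g - h"] by (rule member_le_L2_set) auto
  also have "(g - h) \<bullet> (g - h) = ((g - h) ** x) \<bullet> ((g - h) ** x)"
    using x by (simp add: inner_matrix_mult stiefel_iff flip: matrix_mul_assoc)
  then have "norm (g - h) = dist (g ** x) (h ** x)"
    by (simp add: norm_eq_sqrt_inner dist_norm matrix_ring_simps)
  finally show ?thesis .
qed

section \<open>The orbit space as a metric quotient and as the base of a covering\<close>

definition sp_orbit :: "real^'n^'k \<Rightarrow> (real^'n^'k) set" where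
  "sp_orbit x = (\<lambda>g. g ** x) ` SP"

lemma orbit_eq_sp_orbit: "x \<in> stiefel \<Longrightarrow> orbit signed_perm_group frame_action x = sp_orbit x"
  by (auto simp: orbit_def sp_orbit_def frame_action_eq_matrix_mult image_iff) (metis frame_action_eq_matrix_mult)

lemma sp_orbit_finite: "finite (sp_orbit x)"
  by (simp add: sp_orbit_def finite_signed_perm_group)

lemma sp_orbit_self: "x \<in> sp_orbit x"
  unfolding sp_orbit_def using signed_perm_closed(2) by (auto intro!: image_eqI[of _ _ "mat 1"])

lemma sp_orbit_mult:
  assumes g: "g \<in> SP"
  shows "sp_orbit (g ** x) = sp_orbit x"
proof -
  have sub: "sp_orbit (g ** x) \<subseteq> sp_orbit x" if "g \<in> SP" for g x
    using that by (auto simp: sp_orbit_def matrix_mul_assoc signed_perm_closed(1))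
  have "sp_orbit (transpose g ** (g ** x)) \<subseteq> sp_orbit (g ** x)"
    by (rule sub[OF signed_perm_closed(3)[OF g]])
  then show ?thesis using sub[OF g, of x] by (simp add: matrix_mul_assoc signed_perm_closed(5)[OF g])
qed

lemma sp_orbit_image:
  assumes g: "g \<in> SP"
  shows "(\<lambda>z. g ** z) ` sp_orbit x = sp_orbit x"
proof -
  have sub: "(\<lambda>z. g ** z) ` sp_orbit x \<subseteq> sp_orbit x" if "g \<in> SP" for g
    using that by (auto simp: sp_orbit_def matrix_mul_assoc signed_perm_closed(1))
  have "z \<in> (\<lambda>z. g ** z) ` sp_orbit x" if "z \<in> sp_orbit x" for z
  proof (rule image_eqI)
    show "z = g ** (transpose g ** z)" by (simp add: matrix_mul_assoc signed_perm_closed(4)[OF g])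
    show "transpose g ** z \<in> sp_orbit x" using sub[OF signed_perm_closed(3)[OF g]] that by auto
  qed
  then show ?thesis using sub[OF g] by blast
qed

lemma infdist_sp_orbit_mult: "g \<in> SP \<Longrightarrow> infdist (g ** x) (sp_orbit y) = infdist x (sp_orbit y)"
proof -
  assume g: "g \<in> SP"
  have "infdist (g ** x) (sp_orbit y) = infdist (g ** x) ((\<lambda>z. g ** z) ` sp_orbit y)"
    by (simp add: sp_orbit_image[OF g])
  also have "\<dots> = infdist x (sp_orbit y)" by (simp add: infdist_def image_image signed_perm_dist[OF g] sp_orbit_def)
  finally show ?thesis .
qed

lemma infdist_sp_orbit_attained: "\<exists>g\<in>SP. infdist x (sp_orbit y) = dist x (g ** y)"
  using infdist_attains_inf[OF finite_imp_closed[OF sp_orbit_finite], of y x] sp_orbit_self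
  by (metis empty_iff imageE sp_orbit_def)

lemma infdist_sp_orbit_le: "g \<in> SP \<Longrightarrow> infdist x (sp_orbit y) \<le> dist x (g ** y)"
  by (rule infdist_le) (auto simp: sp_orbit_def)

lemma infdist_sp_orbit_triangle:
  "infdist y (sp_orbit x) \<le> infdist y (sp_orbit z) + infdist x (sp_orbit z)"
proof -
  obtain g where g: "g \<in> SP" "infdist x (sp_orbit z) = dist x (g ** z)" using infdist_sp_orbit_attained by blast
  obtain h where h: "h \<in> SP" "infdist y (sp_orbit z) = dist y (h ** z)" using infdist_sp_orbit_attained by blast
  let ?m = "h ** transpose g"
  have m: "?m \<in> SP" using g h by (simp add: signed_perm_closed)
  have "infdist y (sp_orbit x) \<le> dist y (?m ** x)" by (rule infdist_sp_orbit_le[OF m])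
  also have "\<dots> \<le> dist y (h ** z) + dist (?m ** (g ** z)) (?m ** x)"
  proof -
    have "?m ** (g ** z) = h ** z"
      using signed_perm_closed(5)[OF g(1)] by (metis matrix_mul_assoc matrix_mul_rid)
    then show ?thesis using dist_triangle by metis
  qed
  finally show ?thesis by (simp add: g(2) h(2) signed_perm_dist[OF m] dist_commute)
qed

lemma infdist_sp_orbit_commute: "infdist x (sp_orbit y) = infdist y (sp_orbit x)"
  using infdist_sp_orbit_triangle[of x y x] infdist_sp_orbit_triangle[of y x y]
  by (simp add: infdist_zero[OF sp_orbit_self])

text \<open>Realises the orbit space as a subset of a normed space, so that the lifting theorems for
  covering spaces apply to it.\<close>

definition orbit_embedding :: "real^'n^'k \<Rightarrow> (real^'n^'k) \<Rightarrow>\<^sub>C real" where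
  "orbit_embedding x = Bcontfun (\<lambda>y. min 1 (infdist y (sp_orbit x)))"

lemma orbit_embedding_apply: "apply_bcontfun (orbit_embedding x) y = min 1 (infdist y (sp_orbit x))"
proof -
  have "(\<lambda>y. min 1 (infdist y (sp_orbit x))) \<in> bcontfun"
    unfolding bcontfun_def bounded_iff
    by (auto intro!: continuous_intros exI[of _ 1] simp: infdist_nonneg)
  then show ?thesis by (simp add: orbit_embedding_def Bcontfun_inverse)
qed

text \<open>Kuratowski's argument: the triangle inequality bounds the difference of the two distance
  functions everywhere, and at \<open>y = x\<close> the bound is attained. Truncation at 1 keeps the
  functions bounded.\<close>

lemma dist_orbit_embedding: "dist (orbit_embedding x) (orbit_embedding z) = min 1 (infdist x (sp_orbit z))"
proof (rule order_antisym)
  show "dist (orbit_embedding x) (orbit_embedding z) \<le> min 1 (infdist x (sp_orbit z))"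
  proof (rule dist_bound)
    fix y
    show "dist (apply_bcontfun (orbit_embedding x) y) (apply_bcontfun (orbit_embedding z) y) \<le> min 1 (infdist x (sp_orbit z))"
      using infdist_sp_orbit_triangle[of y x z] infdist_sp_orbit_triangle[of y z x] infdist_sp_orbit_commute[of x z]
        infdist_nonneg[of y "sp_orbit x"] infdist_nonneg[of y "sp_orbit z"]
      by (auto simp: orbit_embedding_apply dist_real_def min_def abs_if)
  qed
  show "min 1 (infdist x (sp_orbit z)) \<le> dist (orbit_embedding x) (orbit_embedding z)"
    using dist_bounded[of "orbit_embedding x" x "orbit_embedding z"] infdist_nonneg[of x "sp_orbit z"] sp_orbit_self[of x]
    by (simp add: orbit_embedding_apply dist_real_def infdist_zero)
qed

lemma orbit_embedding_eq_iff: "orbit_embedding x = orbit_embedding z \<longleftrightarrow> x \<in> sp_orbit z"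
proof -
  have "orbit_embedding x = orbit_embedding z \<longleftrightarrow> min 1 (infdist x (sp_orbit z)) = 0"
    by (simp flip: dist_orbit_embedding)
  also have "\<dots> \<longleftrightarrow> infdist x (sp_orbit z) = 0" by (auto simp: min_def)
  also have "\<dots> \<longleftrightarrow> x \<in> sp_orbit z"
    using in_closed_iff_infdist_zero[OF finite_imp_closed[OF sp_orbit_finite]] sp_orbit_self by blast
  finally show ?thesis .
qed

lemma orbit_embedding_mult: "g \<in> SP \<Longrightarrow> orbit_embedding (g ** x) = orbit_embedding x"
  by (auto simp: orbit_embedding_eq_iff sp_orbit_def)

lemma continuous_on_orbit_embedding: "continuous_on S orbit_embedding"
proof -
  have "dist (orbit_embedding x) (orbit_embedding y) \<le> dist x y" for x y :: "real^'n^'k"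
    using infdist_le[OF sp_orbit_self[of y], of x] by (simp add: dist_orbit_embedding)
  then show ?thesis unfolding continuous_on_iff by (meson le_less_trans)
qed

text \<open>Every other translate of \<open>z\<close> has distance at least 1 from \<open>z\<close>,
  hence at least 1/2 from \<open>y\<close>, so \<open>z\<close> itself is a nearest point of its
  orbit.\<close>

lemma orbit_embedding_isometric:
  assumes "y \<in> stiefel" "z \<in> stiefel" "dist y z \<le> 1 / 2"
  shows "dist (orbit_embedding y) (orbit_embedding z) = dist y z"
proof -
  obtain g where g: "g \<in> SP" "infdist y (sp_orbit z) = dist y (g ** z)" using infdist_sp_orbit_attained by blast
  have "dist y z \<le> dist y (g ** z)"
  proof (cases "g = mat 1")
    case False
    then have "1 \<le> dist (mat 1 ** z) (g ** z)"
      using assms(2) g signed_perm_closed(2) by (intro signed_perm_separated) auto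
    then show ?thesis using assms(3) dist_triangle[of z "g ** z" y] by (simp add: dist_commute)
  qed simp
  moreover have "infdist y (sp_orbit z) \<le> dist y z" by (rule infdist_le[OF sp_orbit_self])
  ultimately show ?thesis using g assms(3) by (simp add: dist_orbit_embedding)
qed

lemma covering_space_orbit_embedding:
  "covering_space stiefel orbit_embedding (orbit_embedding ` (stiefel :: (real^'n^'k) set))"
proof (rule covering_spaceI)
  let ?S = "stiefel :: (real^'n^'k) set"
  fix t assume "t \<in> orbit_embedding ` ?S"
  then obtain x where x: "x \<in> ?S" "t = orbit_embedding x" by auto
  \<comment> \<open>With radius 1/4 two points of one ball are within the isometric range 1/2, balls
    around different translates are disjoint since these are 1 apart, and the truncation at 1 has no
    effect.\<close>
  define T where "T = orbit_embedding ` ?S \<inter> ball t (1/4)"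
  define u where "u g = ?S \<inter> ball (g ** x) (1/4)" for g :: "real^'k^'k"
  have iso: "dist (orbit_embedding y) (orbit_embedding z) = dist y z" if "y \<in> u g" "z \<in> u g" for g y z
  proof -
    have "dist y z \<le> 1/2"
      using that dist_triangle2[of y z "g ** x"] by (auto simp: u_def dist_commute)
    then show ?thesis using that by (intro orbit_embedding_isometric) (auto simp: u_def)
  qed
  have mem_T: "orbit_embedding y \<in> T \<longleftrightarrow> (\<exists>g\<in>SP. y \<in> u g)" if y: "y \<in> ?S" for y
  proof -
    have "orbit_embedding y \<in> T \<longleftrightarrow> infdist y (sp_orbit x) < 1/4"
      using y by (auto simp: T_def x(2) dist_orbit_embedding infdist_sp_orbit_commute[of x y] min_less_iff_disj)
    also have "\<dots> \<longleftrightarrow> (\<exists>g\<in>SP. dist y (g ** x) < 1/4)"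
    proof
      assume "infdist y (sp_orbit x) < 1/4"
      then show "\<exists>g\<in>SP. dist y (g ** x) < 1/4" using infdist_sp_orbit_attained[of y x] by auto
    next
      assume "\<exists>g\<in>SP. dist y (g ** x) < 1/4"
      then obtain g where "g \<in> SP" "dist y (g ** x) < 1/4" by blast
      then show "infdist y (sp_orbit x) < 1/4" using infdist_sp_orbit_le[of g y x] by simp
    qed
    finally show ?thesis using y by (auto simp: u_def dist_commute)
  qed
  have hom: "\<exists>q. homeomorphism (u g) T orbit_embedding q" if g: "g \<in> SP" for g
  proof -
    have sub: "orbit_embedding ` u g \<subseteq> T" using mem_T g by (auto simp: u_def)
    have "T \<subseteq> orbit_embedding ` u g"
    proof
      fix s assume s: "s \<in> T"
      then obtain y where y: "y \<in> ?S" "s = orbit_embedding y" by (auto simp: T_def)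
      then obtain h where h: "h \<in> SP" "y \<in> u h" using mem_T s by blast
      let ?m = "g ** transpose h"
      have m: "?m \<in> SP" using g h by (simp add: signed_perm_closed)
      have "?m ** (h ** x) = g ** x"
        using signed_perm_closed(5)[OF h(1)] by (metis matrix_mul_assoc matrix_mul_rid)
      then have "dist (g ** x) (?m ** y) = dist (h ** x) y" by (metis signed_perm_dist[OF m])
      then have "?m ** y \<in> u g" using h(2) signed_perm_stiefel[OF m y(1)] by (simp add: u_def)
      then show "s \<in> orbit_embedding ` u g" using y(2) orbit_embedding_mult[OF m] by (metis image_eqI)
    qed
    then have im: "orbit_embedding ` u g = T" using sub by blast
    have inj: "inj_on orbit_embedding (u g)"
    proof (rule inj_onI)
      fix y z assume "y \<in> u g" "z \<in> u g" "orbit_embedding y = orbit_embedding z"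
      then have "dist y z = 0" using iso[of y g z] by simp
      then show "y = z" by simp
    qed
    let ?q = "inv_into (u g) orbit_embedding"
    have "dist (?q s) (?q s') = dist s s'" if "s \<in> T" "s' \<in> T" for s s'
      using that iso[of "?q s" g "?q s'"] im by (simp add: inv_into_into f_inv_into_f)
    then have "continuous_on T ?q" unfolding continuous_on_iff by metis
    then have "homeomorphism (u g) T orbit_embedding ?q"
      using im inj continuous_on_orbit_embedding
      by (auto simp: homeomorphism_def inv_into_into f_inv_into_f)
    then show ?thesis by blast
  qed
  show "\<exists>T. t \<in> T \<and> openin (top_of_set (orbit_embedding ` ?S)) T \<and>
      (\<exists>v. \<Union>v = ?S \<inter> orbit_embedding -` T \<and> (\<forall>u\<in>v. openin (top_of_set ?S) u) \<and>
        pairwise disjnt v \<and> (\<forall>u\<in>v. \<exists>q. homeomorphism u T orbit_embedding q))"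
  proof (intro exI[of _ T] exI[of _ "u ` SP"] conjI)
    show "t \<in> T" using x by (simp add: T_def)
    show "openin (top_of_set (orbit_embedding ` ?S)) T" unfolding T_def by (rule openin_open_Int) simp
    show "\<Union> (u ` SP) = ?S \<inter> orbit_embedding -` T" using mem_T by (auto simp: u_def)
    show "\<forall>u\<in>u ` SP. openin (top_of_set ?S) u" unfolding u_def by (auto intro: openin_open_Int)
    show "\<forall>u\<in>u ` SP. \<exists>q. homeomorphism u T orbit_embedding q" using hom by blast
    show "pairwise disjnt (u ` SP)"
    proof (rule pairwiseI)
      fix a b assume "a \<in> u ` SP" "b \<in> u ` SP" "a \<noteq> b"
      then obtain g h where gh: "g \<in> SP" "h \<in> SP" "g \<noteq> h" "a = u g" "b = u h" by blast
      have "False" if "y \<in> u g" "y \<in> u h" for y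
        using signed_perm_separated[OF x(1) gh(1-3)] dist_triangle[of "g ** x" "h ** x" y] that
        by (auto simp: u_def dist_commute)
      then show "disjnt a b" by (auto simp: disjnt_def gh)
    qed
  qed
qed (simp_all add: continuous_on_orbit_embedding)

lemma orbit_frame_action_mult:
  assumes "g \<in> SP" "x \<in> stiefel"
  shows "orbit signed_perm_group frame_action (g ** x) = orbit signed_perm_group frame_action x"
  using assms by (simp add: orbit_eq_sp_orbit signed_perm_stiefel sp_orbit_mult)

text \<open>The homotopy is lifted starting from the identity and ends in the fibre over
  \<open>c\<close>, a single orbit. Comparing its end point with a fixed \<open>x0\<close> of that
  orbit gives the group element. It is equivariant because \<open>l (t, g ** x)\<close> and
  \<open>g ** l (t, x)\<close> lift the same path from the same point, and continuous because points
  of the fibre are 1 apart.\<close>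

lemma equivariant_map_of_nullhomotopic:
  fixes V :: "(real^'n::finite^'k::finite) topology"
  defines "V \<equiv> stiefel_space"
  defines "Q \<equiv> orbit_space signed_perm_group V frame_action"
  assumes U: "openin Q U" and hom: "homotopic_with (\<lambda>_. True) (subtopology Q U) Q id (\<lambda>_. c)"
  shows "\<exists>f. equivariant_map_to_group signed_perm_group
    (subtopology V {x \<in> stiefel. orbit signed_perm_group frame_action x \<in> U}) frame_action f"
proof -
  let ?S = "stiefel :: (real^'n^'k) set"
  let ?G = "signed_perm_group :: (real^'k^'k) monoid"
  let ?o = "orbit ?G frame_action :: real^'n^'k \<Rightarrow> _"
  let ?E = "orbit_embedding :: real^'n^'k \<Rightarrow> _"
  let ?I = "{0..1::real}"
  define W where "W = {x \<in> ?S. ?o x \<in> U}"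
  have WS: "W \<subseteq> ?S" by (auto simp: W_def)
  have q: "quotient_map V Q ?o" unfolding Q_def by (rule quotient_map_orbit_space)
  have tQ: "topspace Q = ?o ` ?S"
    using quotient_imp_surjective_map[OF q] by (simp add: V_def)
  obtain h where h: "continuous_map (prod_topology (top_of_set ?I) (subtopology Q U)) Q h"
    "\<And>x. x \<in> topspace (subtopology Q U) \<Longrightarrow> h (0, x) = x" "\<And>x. x \<in> topspace (subtopology Q U) \<Longrightarrow> h (1, x) = c"
    using hom unfolding homotopic_with_def by auto
  have tU: "topspace (subtopology Q U) = U" using openin_subset[OF U] by auto
  define E' where "E' = (\<lambda>b. ?E (SOME x. x \<in> ?S \<and> ?o x = b))"
  have E': "E' (?o x) = ?E x" if "x \<in> ?S" for x
  proof -
    define z where "z = (SOME y. y \<in> ?S \<and> ?o y = ?o x)"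
    have z: "z \<in> ?S \<and> ?o z = ?o x"
      unfolding z_def using that by (intro someI[of "\<lambda>y. y \<in> ?S \<and> ?o y = ?o x" x]) simp
    then have "sp_orbit z = sp_orbit x" using that by (metis orbit_eq_sp_orbit)
    then have "z \<in> sp_orbit x" using sp_orbit_self[of z] by simp
    then show ?thesis by (simp add: E'_def orbit_embedding_eq_iff flip: z_def)
  qed
  have contE': "continuous_map Q (top_of_set (?E ` ?S)) E'"
  proof (rule continuous_compose_quotient_map[OF q])
    have "continuous_map V (top_of_set (?E ` ?S)) ?E"
      using continuous_on_orbit_embedding by (simp add: V_def stiefel_space_def)
    then show "continuous_map V (top_of_set (?E ` ?S)) (E' \<circ> ?o)"
      by (rule continuous_map_eq) (simp add: V_def E')
  qed
  define k where "k = (\<lambda>z. E' (h (fst z, ?o (snd z))))"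
  have cont_o: "continuous_map (top_of_set W) (subtopology Q U) ?o"
  proof -
    have "continuous_map V Q ?o" using q by (rule quotient_imp_continuous_map)
    then have "continuous_map (subtopology V W) Q ?o" by (rule continuous_map_from_subtopology)
    moreover have "subtopology V W = top_of_set W"
      using WS by (simp add: V_def stiefel_space_def subtopology_subtopology inf.absorb2)
    ultimately show ?thesis using WS by (auto simp: continuous_map_in_subtopology W_def)
  qed
  have cm: "continuous_map (prod_topology (top_of_set ?I) (top_of_set W)) (top_of_set (?E ` ?S)) k"
  proof -
    have "continuous_map (prod_topology (top_of_set ?I) (top_of_set W)) (prod_topology (top_of_set ?I) (subtopology Q U)) (\<lambda>z. (fst z, ?o (snd z)))"
      by (intro continuous_map_pairedI continuous_map_fst
          continuous_map_compose[OF continuous_map_snd cont_o, unfolded comp_def])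
    from continuous_map_compose[OF continuous_map_compose[OF this h(1)] contE']
    show ?thesis by (simp only: k_def comp_def)
  qed
  then have k: "continuous_on (?I \<times> W) k" "k \<in> (?I \<times> W) \<rightarrow> ?E ` ?S"
    by (auto simp: image_subset_iff)
  have k0: "k (0, x) = ?E x" if "x \<in> W" for x
    using that h(2)[of "?o x"] E'[of x] unfolding tU by (simp add: k_def W_def)
  have k1: "k (1, x) = E' c" if "x \<in> W" for x
    using that h(3)[of "?o x"] unfolding tU by (simp add: k_def W_def)
  have kg: "k (t, g ** x) = k (t, x)" if "x \<in> W" "g \<in> SP" for t x g
    using that WS by (simp add: k_def orbit_frame_action_mult subset_iff)
  have Wg: "g ** x \<in> W" if "x \<in> W" "g \<in> SP" for x g
    using that by (simp add: W_def orbit_frame_action_mult signed_perm_stiefel)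
  obtain l where l: "continuous_on (?I \<times> W) l" "l \<in> (?I \<times> W) \<rightarrow> ?S"
    "\<And>x. x \<in> W \<Longrightarrow> l (0, x) = x" "\<And>z. z \<in> ?I \<times> W \<Longrightarrow> k z = ?E (l z)"
    by (rule covering_space_lift_homotopy[OF covering_space_orbit_embedding k, of "\<lambda>x. x"])
      (use k0 WS in \<open>auto intro: continuous_on_id\<close>)
  have lg: "l (1, g ** x) = g ** l (1, x)" if x: "x \<in> W" and g: "g \<in> SP" for x g
  proof -
    have lS: "l (t, y) \<in> ?S" if "t \<in> ?I" "y \<in> W" for t y using l(2) that by auto
    have cl: "continuous_on ?I (\<lambda>t. l (t, y))" if "y \<in> W" for y
      using that by (intro continuous_on_compose2[OF l(1)] continuous_intros) auto
    have "(\<lambda>t. l (t, g ** x)) 1 = (\<lambda>t. g ** l (t, x)) 1"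
    proof (rule covering_space_lift_unique[OF covering_space_orbit_embedding, where T = ?I and a = 0
          and f = "\<lambda>t. k (t, x)"])
      show "l (0, g ** x) = g ** l (0, x)" using l(3) x Wg[OF x g] by simp
      show "continuous_on ?I (\<lambda>t. k (t, x))"
        using x by (intro continuous_on_compose2[OF k(1)] continuous_intros) auto
      show "(\<lambda>t. k (t, x)) \<in> ?I \<rightarrow> ?E ` ?S" using k(2) x by auto
      show "continuous_on ?I (\<lambda>t. g ** l (t, x))" using cl[OF x] by (intro continuous_intros)
      show "k (t, x) = ?E (l (t, g ** x))" if "t \<in> ?I" for t
        using l(4)[of "(t, g ** x)"] kg[OF x g] Wg[OF x g] that by simp
      show "k (t, x) = ?E (g ** l (t, x))" if "t \<in> ?I" for t
        using l(4)[of "(t, x)"] x that by (simp add: orbit_embedding_mult[OF g])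
      show "(\<lambda>t. g ** l (t, x)) \<in> ?I \<rightarrow> ?S" using lS x signed_perm_stiefel[OF g] by blast
    qed (use cl lS x Wg[OF x g] in auto)
    then show ?thesis by simp
  qed
  have sub: "subtopology V W = top_of_set W"
    using WS by (simp add: V_def stiefel_space_def subtopology_subtopology inf.absorb2)
  show ?thesis
  proof (cases "W = {}")
    case True
    then show ?thesis
      unfolding W_def[symmetric] equivariant_map_to_group_def sub by (simp add: continuous_map_on_empty)
  next
    case False
    then obtain w where w: "w \<in> W" by auto
    then have "c = h (1, ?o w)" using h(3)[of "?o w"] unfolding tU by (simp add: W_def)
    moreover have "h (1, ?o w) \<in> topspace Q"
      using continuous_map_image_subset_topspace[OF h(1)] w tU by (auto simp: W_def image_subset_iff)
    ultimately obtain x0 where x0: "x0 \<in> ?S" "c = ?o x0" unfolding tQ by auto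
    have ex: "\<exists>g. g \<in> SP \<and> l (1, x) = g ** x0" if "x \<in> W" for x
    proof -
      have "?E (l (1, x)) = ?E x0" using k1[OF that] l(4)[of "(1, x)"] that E'[OF x0(1)] x0(2) by simp
      then show ?thesis by (auto simp: orbit_embedding_eq_iff sp_orbit_def)
    qed
    define f where "f x = (SOME g. g \<in> SP \<and> l (1, x) = g ** x0)" for x
    have f: "f x \<in> SP" "l (1, x) = f x ** x0" if "x \<in> W" for x
      using someI_ex[OF ex[OF that]] by (auto simp: f_def)
    have uniq: "g = f x" if "x \<in> W" "g \<in> SP" "dist (g ** x0) (l (1, x)) < 1" for x g
      using signed_perm_separated[OF x0(1) that(2) f(1)[OF that(1)]] that(3) f(2)[OF that(1)] by force
    have "continuous_map (top_of_set W) (discrete_topology (carrier ?G)) f"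
      unfolding continuous_map_def
    proof (intro conjI allI impI)
      show "f \<in> topspace (top_of_set W) \<rightarrow> topspace (discrete_topology SP)" using f(1) by auto
      fix A assume "openin (discrete_topology (carrier ?G)) A"
      then have A: "A \<subseteq> SP" by simp
      have "continuous_on W (\<lambda>x. l (1, x))"
        by (intro continuous_on_compose2[OF l(1)] continuous_intros) auto
      then have "openin (top_of_set W) (W \<inter> (\<lambda>x. l (1, x)) -` (\<Union>g\<in>A. ball (g ** x0) 1))"
        by (rule continuous_openin_preimage_gen) auto
      moreover have "W \<inter> (\<lambda>x. l (1, x)) -` (\<Union>g\<in>A. ball (g ** x0) 1) = {x \<in> topspace (top_of_set W). f x \<in> A}"
      proof (intro equalityI subsetI)
        fix x assume "x \<in> W \<inter> (\<lambda>x. l (1, x)) -` (\<Union>g\<in>A. ball (g ** x0) 1)"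
        then obtain g where "x \<in> W" "g \<in> A" "dist (g ** x0) (l (1, x)) < 1" by auto
        then show "x \<in> {x \<in> topspace (top_of_set W). f x \<in> A}" using uniq[of x g] A by auto
      next
        fix x assume "x \<in> {x \<in> topspace (top_of_set W). f x \<in> A}"
        then show "x \<in> W \<inter> (\<lambda>x. l (1, x)) -` (\<Union>g\<in>A. ball (g ** x0) 1)"
          using f(2) by (auto intro!: bexI[of _ "f x"])
      qed
      ultimately show "openin (top_of_set W) {x \<in> topspace (top_of_set W). f x \<in> A}" by simp
    qed
    moreover have "f (frame_action g x) = g \<otimes>\<^bsub>?G\<^esub> f x" if g: "g \<in> SP" and x: "x \<in> W" for g x
    proof -
      have "frame_action g x = g ** x" using g x WS by (intro frame_action_eq_matrix_mult) auto
      moreover have "g ** f x = f (g ** x)"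
      proof (rule uniq)
        show "g ** f x \<in> SP" using g f(1)[OF x] by (rule signed_perm_closed)
        show "dist (g ** f x ** x0) (l (1, g ** x)) < 1"
          unfolding lg[OF x g] f(2)[OF x] by (simp add: matrix_mul_assoc)
      qed (rule Wg[OF x g])
      ultimately show ?thesis by (simp add: signed_perm_group_def)
    qed
    ultimately have "equivariant_map_to_group ?G (top_of_set W) frame_action f"
      by (simp add: equivariant_map_to_group_def)
    then show ?thesis unfolding W_def[symmetric] sub by blast
  qed
qed

theorem genus_le_cat_stiefel:
  fixes V :: "(real^'n::finite^'k::finite) topology"
  assumes V: "V = stiefel_space"
  shows "schwarz_genus signed_perm_group V frame_action \<le> ls_cat (orbit_space signed_perm_group V frame_action)"
proof -
  let ?S = "stiefel :: (real^'n^'k) set"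
  let ?G = "signed_perm_group :: (real^'k^'k) monoid"
  let ?o = "orbit ?G frame_action :: real^'n^'k \<Rightarrow> _"
  let ?Q = "orbit_space ?G V frame_action"
  show ?thesis
    unfolding ls_cat_def
  proof (rule Inf_greatest)
    fix N assume "N \<in> {enat m | m. \<exists>U :: nat \<Rightarrow> (real^'n^'k) set set.
            (\<Union>i<m. U i) = topspace ?Q \<and>
            (\<forall>i<m. openin ?Q (U i) \<and> (\<exists>c. homotopic_with (\<lambda>_. True) (subtopology ?Q (U i)) ?Q id (\<lambda>_. c)))}"
    then obtain m U where m: "N = enat m" "(\<Union>i<m. U i) = topspace ?Q"
      "\<And>i. i < m \<Longrightarrow> openin ?Q (U i)"
      "\<And>i. i < m \<Longrightarrow> \<exists>c. homotopic_with (\<lambda>_. True) (subtopology ?Q (U i)) ?Q id (\<lambda>_. c)"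
      by blast
    define W where "W i = {x \<in> ?S. ?o x \<in> U i}" for i
    have "(\<Union>i<m. W i) = topspace V"
    proof -
      have "?o x \<in> topspace ?Q" if "x \<in> ?S" for x
        using that by (auto simp: topspace_orbit_space orbits_def V)
      then show ?thesis unfolding m(2)[symmetric] by (auto simp: W_def V)
    qed
    moreover have "openin V (W i) \<and> G_invariant ?G frame_action (W i) \<and>
        (\<exists>f. equivariant_map_to_group ?G (subtopology V (W i)) frame_action f)" if i: "i < m" for i
    proof (intro conjI)
      show "openin V (W i)" using m(3)[OF i] by (simp add: openin_orbit_space W_def V)
      show "G_invariant ?G frame_action (W i)"
        by (auto simp: G_invariant_def W_def frame_action_eq_matrix_mult signed_perm_stiefel orbit_frame_action_mult)
      obtain c where "homotopic_with (\<lambda>_. True) (subtopology ?Q (U i)) ?Q id (\<lambda>_. c)"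
        using m(4)[OF i] by blast
      then show "\<exists>f. equivariant_map_to_group ?G (subtopology V (W i)) frame_action f"
        using equivariant_map_of_nullhomotopic[of "U i" c] m(3)[OF i] unfolding W_def V by blast
    qed
    ultimately show "schwarz_genus ?G V frame_action \<le> N"
      unfolding schwarz_genus_def m(1) by (intro Inf_lower) blast
  qed
qed

section \<open>Box dimension and levels in general position\<close>

text \<open>Distances are measured inside \<open>S\<close> only, so the members may be unbounded
  slabs cut out by coordinates.\<close>

definition fine_cover :: "'a::metric_space set \<Rightarrow> real \<Rightarrow> 'a set set \<Rightarrow> bool" where
  "fine_cover S \<eta> \<P> \<longleftrightarrow> finite \<P> \<and> S \<subseteq> \<Union>\<P> \<and> (\<forall>P\<in>\<P>. \<forall>x\<in>P \<inter> S. \<forall>y\<in>P \<inter> S. dist x y \<le> \<eta>)"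

text \<open>Only the growth of the number of cells matters for the count of bad levels; it survives
  subsets, finite unions and Lipschitz images with a change of \<open>C\<close> alone.\<close>

definition box_dim_le :: "nat \<Rightarrow> 'a::metric_space set \<Rightarrow> bool" where
  "box_dim_le d S \<longleftrightarrow> (\<exists>C\<ge>0. \<forall>\<eta>. 0 < \<eta> \<longrightarrow> \<eta> \<le> 1 \<longrightarrow> (\<exists>\<P>. fine_cover S \<eta> \<P> \<and> real (card \<P>) \<le> C / \<eta> ^ d))"

lemma box_dim_leI:
  assumes "C \<ge> 0"
    "\<And>\<eta>. 0 < \<eta> \<Longrightarrow> \<eta> \<le> 1 \<Longrightarrow> \<exists>\<P>. fine_cover S \<eta> \<P> \<and> real (card \<P>) \<le> C / \<eta> ^ d"
  shows "box_dim_le d S"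
  using assms unfolding box_dim_le_def by (intro exI[of _ C]) simp

lemma fine_coverD:
  assumes "fine_cover S \<eta> \<P>"
  shows "finite \<P>" "S \<subseteq> \<Union>\<P>" "\<And>P x y. P \<in> \<P> \<Longrightarrow> x \<in> P \<Longrightarrow> x \<in> S \<Longrightarrow> y \<in> P \<Longrightarrow> y \<in> S \<Longrightarrow> dist x y \<le> \<eta>"
  using assms by (auto simp: fine_cover_def)

lemma fine_coverI:
  assumes "finite \<P>" "S \<subseteq> \<Union>\<P>" "\<And>P x y. P \<in> \<P> \<Longrightarrow> x \<in> P \<Longrightarrow> x \<in> S \<Longrightarrow> y \<in> P \<Longrightarrow> y \<in> S \<Longrightarrow> dist x y \<le> \<eta>"
  shows "fine_cover S \<eta> \<P>"
  using assms by (simp add: fine_cover_def)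

lemma box_dim_le_Un:
  assumes "box_dim_le d S" "box_dim_le d T"
  shows "box_dim_le d (S \<union> T)"
proof -
  obtain C where C: "C \<ge> 0" "\<And>\<eta>. 0 < \<eta> \<Longrightarrow> \<eta> \<le> 1 \<Longrightarrow> \<exists>\<P>. fine_cover S \<eta> \<P> \<and> real (card \<P>) \<le> C / \<eta> ^ d"
    using assms(1) unfolding box_dim_le_def by (elim exE conjE) (rule that, assumption, simp)
  obtain D where D: "D \<ge> 0" "\<And>\<eta>. 0 < \<eta> \<Longrightarrow> \<eta> \<le> 1 \<Longrightarrow> \<exists>\<P>. fine_cover T \<eta> \<P> \<and> real (card \<P>) \<le> D / \<eta> ^ d"
    using assms(2) unfolding box_dim_le_def by (elim exE conjE) (rule that, assumption, simp)
  show ?thesis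
  proof (rule box_dim_leI[of "C + D"])
    fix \<eta> :: real assume \<eta>: "0 < \<eta>" "\<eta> \<le> 1"
    obtain \<P> where P: "fine_cover S \<eta> \<P>" "real (card \<P>) \<le> C / \<eta> ^ d" using C(2)[OF \<eta>] by blast
    obtain \<Q> where Q: "fine_cover T \<eta> \<Q>" "real (card \<Q>) \<le> D / \<eta> ^ d" using D(2)[OF \<eta>] by blast
    let ?R = "(\<lambda>P. P \<inter> S) ` \<P> \<union> (\<lambda>P. P \<inter> T) ` \<Q>"
    note PD = fine_coverD[OF P(1)] and QD = fine_coverD[OF Q(1)]
    have "card ?R \<le> card \<P> + card \<Q>"
      using card_Un_le[of "(\<lambda>P. P \<inter> S) ` \<P>" "(\<lambda>P. P \<inter> T) ` \<Q>"]
        card_image_le[OF PD(1), of "\<lambda>P. P \<inter> S"] card_image_le[OF QD(1), of "\<lambda>P. P \<inter> T"] by linarith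
    then have "real (card ?R) \<le> (C + D) / \<eta> ^ d"
      using P(2) Q(2) by (simp add: add_divide_distrib)
    moreover have "fine_cover (S \<union> T) \<eta> ?R"
      by (rule fine_coverI) (use PD QD in \<open>auto\<close>)
    ultimately show "\<exists>\<P>. fine_cover (S \<union> T) \<eta> \<P> \<and> real (card \<P>) \<le> (C + D) / \<eta> ^ d" by blast
  qed (use C(1) D(1) in simp)
qed

lemma box_dim_le_Union:
  "finite \<S> \<Longrightarrow> (\<And>S. S \<in> \<S> \<Longrightarrow> box_dim_le d S) \<Longrightarrow> box_dim_le d (\<Union>\<S>)"
proof (induction \<S> rule: finite_induct)
  case empty
  show ?case
  proof (rule box_dim_leI[of 0])
    show "\<exists>\<P>. fine_cover (\<Union>{}) \<eta> \<P> \<and> real (card \<P>) \<le> 0 / \<eta> ^ d" for \<eta> :: real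
      by (intro exI[of _ "{}"]) (simp add: fine_cover_def)
  qed simp
qed (simp add: box_dim_le_Un)

lemma box_dim_le_subset:
  assumes "box_dim_le d S" "T \<subseteq> S"
  shows "box_dim_le d T"
proof -
  obtain C where C: "C \<ge> 0" "\<And>\<eta>. 0 < \<eta> \<Longrightarrow> \<eta> \<le> 1 \<Longrightarrow> \<exists>\<P>. fine_cover S \<eta> \<P> \<and> real (card \<P>) \<le> C / \<eta> ^ d"
    using assms(1) unfolding box_dim_le_def by (elim exE conjE) (rule that, assumption, simp)
  have "fine_cover T \<eta> \<P>" if "fine_cover S \<eta> \<P>" for \<eta> \<P>
  proof (rule fine_coverI)
    show "dist x y \<le> \<eta>" if "P \<in> \<P>" "x \<in> P" "x \<in> T" "y \<in> P" "y \<in> T" for P x y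
      by (rule fine_coverD(3)[OF \<open>fine_cover S \<eta> \<P>\<close>]) (use that assms(2) in auto)
  qed (use fine_coverD(1,2)[OF that] assms(2) in auto)
  then show ?thesis using C by (intro box_dim_leI[of C]) blast+
qed

lemma box_dim_le_lipschitz_image:
  assumes S: "box_dim_le d S" and f: "\<And>x y. x \<in> S \<Longrightarrow> y \<in> S \<Longrightarrow> dist (f x) (f y) \<le> L * dist x y"
  shows "box_dim_le d (f ` S)"
proof -
  define K where "K = max L 1"
  have K1: "K \<ge> 1" "L \<le> K" by (simp_all add: K_def)
  have K: "dist (f x) (f y) \<le> K * dist x y" if "x \<in> S" "y \<in> S" for x y
    using f[OF that] mult_right_mono[OF K1(2), of "dist x y"] by simp
  obtain C where C: "C \<ge> 0" "\<And>\<eta>. 0 < \<eta> \<Longrightarrow> \<eta> \<le> 1 \<Longrightarrow> \<exists>\<P>. fine_cover S \<eta> \<P> \<and> real (card \<P>) \<le> C / \<eta> ^ d"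
    using S unfolding box_dim_le_def by (elim exE conjE) (rule that, assumption, simp)
  show ?thesis
  proof (rule box_dim_leI[of "C * K ^ d"])
    fix \<eta> :: real assume \<eta>: "0 < \<eta>" "\<eta> \<le> 1"
    then have "0 < \<eta> / K" "\<eta> / K \<le> 1" using K1(1) by (auto simp: field_simps)
    then obtain \<P> where P: "fine_cover S (\<eta> / K) \<P>" "real (card \<P>) \<le> C / (\<eta> / K) ^ d" using C(2) by blast
    note PD = fine_coverD[OF P(1)]
    let ?R = "(\<lambda>P. f ` (P \<inter> S)) ` \<P>"
    have "real (card ?R) \<le> C * K ^ d / \<eta> ^ d"
      using card_image_le[OF PD(1), of "\<lambda>P. f ` (P \<inter> S)"] P(2) by (simp add: power_divide)
    moreover have "fine_cover (f ` S) \<eta> ?R"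
    proof (rule fine_coverI)
      show "f ` S \<subseteq> \<Union>?R" using PD(2) by auto
      fix P' x y assume "P' \<in> ?R" "x \<in> P'" "y \<in> P'"
      then obtain P a b where ab: "P \<in> \<P>" "a \<in> P" "a \<in> S" "b \<in> P" "b \<in> S" "x = f a" "y = f b" by auto
      then have "dist x y \<le> K * dist a b" using K by auto
      also have "\<dots> \<le> K * (\<eta> / K)" using PD(3)[OF ab(1-5)] K1(1) by (intro mult_left_mono) auto
      finally show "dist x y \<le> \<eta>" using K1(1) by simp
    qed (use PD(1) in simp)
    ultimately show "\<exists>\<P>. fine_cover (f ` S) \<eta> \<P> \<and> real (card \<P>) \<le> C * K ^ d / \<eta> ^ d" by blast
  qed (use C(1) K1(1) in simp)
qed

lemma box_dim_le_subspace_ball: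
  fixes T :: "'a::euclidean_space set"
  assumes T: "subspace T"
  shows "box_dim_le (dim T) (T \<inter> cball 0 1)"
proof -
  let ?d = "dim T"
  obtain B where B: "B \<subseteq> T" "pairwise orthogonal B" "\<And>b. b \<in> B \<Longrightarrow> norm b = 1" "independent B" "card B = ?d" "span B = T"
    using orthonormal_basis_subspace[OF T] by metis
  have finB: "finite B" using B(4) independent_imp_finite by blast
  have expand: "x = (\<Sum>b\<in>B. (x \<bullet> b) *\<^sub>R b)" if x: "x \<in> T" for x
  proof -
    obtain u where u: "x = (\<Sum>b\<in>B. u b *\<^sub>R b)" using x[unfolded B(6)[symmetric] span_finite[OF finB]] by (elim imageE)
    have "x \<bullet> b = u b" if b: "b \<in> B" for b
    proof -
      have "x \<bullet> b = (\<Sum>c\<in>B. if c = b then u c else 0)"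
        unfolding u inner_sum_left
      proof (rule sum.cong)
        fix c assume c: "c \<in> B"
        show "u c *\<^sub>R c \<bullet> b = (if c = b then u c else 0)"
          using B(2) B(3)[OF b] b c by (auto simp: pairwise_def orthogonal_def dot_square_norm)
      qed simp
      then show ?thesis using finB b by simp
    qed
    then show ?thesis using u by simp
  qed
  show ?thesis
  \<comment> \<open>Side length \<open>\<eta> / (?d + 1)\<close> makes the sum over the basis at
    most \<open>\<eta>\<close>; each coordinate then meets at most
    \<open>2 M + 1 \<le> 2 / s + 3 \<le> 5 / s\<close> intervals.\<close>
  proof (rule box_dim_leI[of "(5 * real (?d + 1)) ^ ?d"])
    fix \<eta> :: real assume \<eta>: "0 < \<eta>" "\<eta> \<le> 1"
    define s where "s = \<eta> / real (?d + 1)"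
    have s: "0 < s" "s \<le> 1" using \<eta> by (auto simp: s_def field_simps)
    define M where "M = \<lceil>1 / s\<rceil>"
    have M: "0 \<le> M" "1 / s \<le> M" "M \<le> 1 / s + 1" 
    proof -
      have "0 < 1 / s" using s by simp
      then show "0 \<le> M" "1 / s \<le> M" "M \<le> 1 / s + 1" unfolding M_def by linarith+
    qed
    define J where "J = (PiE B (\<lambda>_. {-M..M}))"
    define P where "P j = {x. \<forall>b\<in>B. \<lfloor>x \<bullet> b / s\<rfloor> = j b}" for j
    have "real (card J) = (2 * real_of_int M + 1) ^ ?d"
      using M(1) by (simp add: J_def card_PiE finB B(5))
    also have "\<dots> \<le> (5 / s) ^ ?d"
    proof (rule power_mono)
      have "1 \<le> 1 / s" using s by simp
      then show "2 * real_of_int M + 1 \<le> 5 / s" using M(3) by (simp add: field_simps)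
    qed (use M(1) in simp)
    also have "\<dots> = (5 * real (?d + 1)) ^ ?d / \<eta> ^ ?d" by (simp add: s_def power_divide)
    finally have "real (card J) \<le> (5 * real (?d + 1)) ^ ?d / \<eta> ^ ?d" .
    moreover have finJ: "finite J" unfolding J_def by (intro finite_PiE finB) simp
    ultimately have "real (card (P ` J)) \<le> (5 * real (?d + 1)) ^ ?d / \<eta> ^ ?d"
      using card_image_le[OF finJ, of P] by linarith
    moreover have "fine_cover (T \<inter> cball 0 1) \<eta> (P ` J)"
    proof (rule fine_coverI)
      show "T \<inter> cball 0 1 \<subseteq> \<Union>(P ` J)"
      proof
      fix x assume x: "x \<in> T \<inter> cball 0 1"
      define j where "j = (\<lambda>b\<in>B. \<lfloor>x \<bullet> b / s\<rfloor>)"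
      have "\<lfloor>x \<bullet> b / s\<rfloor> \<in> {-M..M}" if "b \<in> B" for b
      proof -
        have "\<bar>x \<bullet> b\<bar> \<le> 1" using Cauchy_Schwarz_ineq2[of x b] x B(3)[OF that] by simp
        then have "x \<bullet> b / s \<le> 1 / s" "(- 1) / s \<le> x \<bullet> b / s"
          using s divide_right_mono[of "x \<bullet> b" 1 s] divide_right_mono[of "- 1" "x \<bullet> b" s] by (simp_all add: abs_le_iff)
        then have "x \<bullet> b / s \<le> M" "- real_of_int M \<le> x \<bullet> b / s" using M(2) by linarith+
        then show ?thesis by (simp add: floor_le_iff le_floor_iff)
      qed
      then have "j \<in> J" by (auto simp: J_def j_def)
      moreover have "x \<in> P j" by (simp add: P_def j_def)
      ultimately show "x \<in> \<Union>(P ` J)" by blast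
    qed
      fix Q x y assume "Q \<in> P ` J" "x \<in> Q" "x \<in> T \<inter> cball 0 1" "y \<in> Q" "y \<in> T \<inter> cball 0 1"
      then obtain j where xy: "x \<in> P j" "y \<in> P j" "x \<in> T" "y \<in> T" by auto
      have "x - y = (\<Sum>b\<in>B. ((x - y) \<bullet> b) *\<^sub>R b)"
        using expand[of "x - y"] subspace_diff[OF T xy(3,4)] by simp
      then have "norm (x - y) \<le> (\<Sum>b\<in>B. norm (((x - y) \<bullet> b) *\<^sub>R b))" by (metis norm_sum)
      also have "\<dots> \<le> (\<Sum>b\<in>B. s)"
      proof (rule sum_mono)
        fix b assume b: "b \<in> B"
        have "\<lfloor>x \<bullet> b / s\<rfloor> = \<lfloor>y \<bullet> b / s\<rfloor>" using xy b by (simp add: P_def)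
        then have "\<bar>x \<bullet> b / s - y \<bullet> b / s\<bar> \<le> 1" by linarith
        then have "\<bar>(x - y) \<bullet> b / s\<bar> \<le> 1" by (simp add: inner_diff_left diff_divide_distrib)
        then show "norm (((x - y) \<bullet> b) *\<^sub>R b) \<le> s" using s B(3)[OF b] by (simp add: field_simps)
      qed
      also have "\<dots> \<le> \<eta>" using \<eta> B(5) by (simp add: s_def field_simps)
      finally show "dist x y \<le> \<eta>" by (simp add: dist_norm)
    qed (use finJ in simp)
    ultimately show "\<exists>\<P>. fine_cover (T \<inter> cball 0 1) \<eta> \<P> \<and> real (card \<P>) \<le> (5 * real (?d + 1)) ^ ?d / \<eta> ^ ?d" by blast
  qed simp
qed

text \<open>General position by counting: levels are taken from a grid of mesh \<open>1 / K\<close>, and a tuple of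
  \<open>d + 1\<close> of them is hit within one small cell in one out of \<open>K\<^sup>d\<^sup>+\<^sup>1\<close> cases, while there are only
  \<open>O(K\<^sup>d)\<close> cells.\<close>

lemma levels_in_general_position:
  fixes f :: "nat \<Rightarrow> 'a::metric_space \<Rightarrow> real"
  assumes S: "box_dim_le d S" and f: "\<And>i x y. i < N \<Longrightarrow> \<bar>f i x - f i y\<bar> \<le> dist x y" and ab: "a < b" "b \<le> a + 1"
  shows "\<exists>c. (\<forall>i<N. a \<le> c i \<and> c i \<le> b) \<and> (\<forall>x\<in>S. card {i. i < N \<and> f i x = c i} \<le> d)"
proof (cases "N \<le> d")
  \<comment> \<open>Any levels do when there are at most \<open>d\<close> functions; otherwise the
    exponent \<open>N - Suc d\<close> below is a true difference.\<close>
  case True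
  have "card {i. i < N \<and> f i x = a} \<le> d" for x
  proof -
    have "card {i. i < N \<and> f i x = a} \<le> card {..<N}" by (rule card_mono) auto
    then show ?thesis using True by simp
  qed
  then show ?thesis using ab by (intro exI[of _ "\<lambda>_. a"]) auto
next
  case False
  obtain C where C: "C \<ge> 0" "\<And>\<eta>. 0 < \<eta> \<Longrightarrow> \<eta> \<le> 1 \<Longrightarrow> \<exists>\<P>. fine_cover S \<eta> \<P> \<and> real (card \<P>) \<le> C / \<eta> ^ d"
    using S unfolding box_dim_le_def by (elim exE conjE) (rule that, assumption, simp)
  \<comment> \<open>There are at most \<open>2 ^ N\<close> choices of \<open>T\<close> and
    \<open>C (3 K / (b - a)) ^ d\<close> cells, each pair spoiling at most
    \<open>K ^ (N - Suc d)\<close> of the \<open>K ^ N\<close> level tuples; this bound on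
    \<open>K\<close> leaves a good tuple.\<close>
  obtain K0 :: nat where K0: "2 ^ N * C * (3 / (b - a)) ^ d < real K0" using reals_Archimedean2 by blast
  define K where "K = Suc K0"
  have K: "K > 0" "2 ^ N * C * (3 / (b - a)) ^ d < real K" using K0 by (simp_all add: K_def)
  define s where "s = (b - a) / real K"
  have s: "0 < s" "s \<le> 1" using ab K(1) by (auto simp: s_def field_simps K_def)
  obtain \<P> where P': "fine_cover S (s / 3) \<P>" "real (card \<P>) \<le> C / (s / 3) ^ d" using C(2)[of "s / 3"] s by auto
  note P = fine_coverD(1)[OF P'(1)] P'(2) fine_coverD(2,3)[OF P'(1)]
  define grid where "grid j = a + s * real j" for j :: nat
  define J where "J = (PiE {..<N} (\<lambda>_. {..<K}))"
  define \<T> where "\<T> = {T. T \<subseteq> {..<N} \<and> card T = Suc d}"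
  define pt where "pt P = (SOME y. y \<in> P \<inter> S)" for P
  define bad where "bad T P = {j \<in> J. \<forall>i\<in>T. \<bar>f i (pt P) - grid (j i)\<bar> \<le> s / 3}" for T P
  have cardJ: "card J = K ^ N" "finite J" by (simp_all add: J_def card_PiE finite_PiE)
  have finT: "finite \<T>" "card \<T> \<le> 2 ^ N"
  proof -
    have "\<T> \<subseteq> Pow {..<N}" by (auto simp: \<T>_def)
    then show "finite \<T>" "card \<T> \<le> 2 ^ N"
      using finite_subset card_mono[of "Pow {..<N}" \<T>] by (auto simp: card_Pow)
  qed
  have card_bad: "card (bad T P) \<le> K ^ (N - Suc d)" if T: "T \<in> \<T>" for T P
  proof -
    define G where "G i = (if i \<in> T then {j. j < K \<and> \<bar>f i (pt P) - grid j\<bar> \<le> s / 3} else {..<K})" for i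
    \<comment> \<open>Two grid values within \<open>s / 3\<close> of the same number differ by less
      than the mesh \<open>s\<close>; hence cells of diameter \<open>s / 3\<close>.\<close>
    have le1: "card {j. j < K \<and> \<bar>r - grid j\<bar> \<le> s / 3} \<le> Suc 0" for r
    proof (rule card_le_Suc0_iff_eq[THEN iffD2])
      show "\<forall>j\<in>{j. j < K \<and> \<bar>r - grid j\<bar> \<le> s / 3}. \<forall>j'\<in>{j. j < K \<and> \<bar>r - grid j\<bar> \<le> s / 3}. j = j'"
      proof (intro ballI)
        fix j j' assume "j \<in> {j. j < K \<and> \<bar>r - grid j\<bar> \<le> s / 3}" "j' \<in> {j. j < K \<and> \<bar>r - grid j\<bar> \<le> s / 3}"
        then have "\<bar>grid j - grid j'\<bar> \<le> s / 3 + s / 3" unfolding mem_Collect_eq by linarith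
        also have "\<bar>grid j - grid j'\<bar> = s * \<bar>real j - real j'\<bar>"
          using s(1) by (simp add: grid_def abs_mult flip: right_diff_distrib)
        finally have "s * \<bar>real j - real j'\<bar> < s * 1" using s(1) by simp
        then have "\<bar>real j - real j'\<bar> < 1" using s(1) by (simp only: mult_less_cancel_left_pos)
        then show "j = j'" by linarith
      qed
    qed simp
    have "bad T P \<subseteq> PiE {..<N} G"
      by (auto simp: bad_def J_def G_def PiE_iff extensional_def)
    then have "card (bad T P) \<le> card (PiE {..<N} G)"
      by (intro card_mono finite_PiE) (auto simp: G_def)
    also have "\<dots> = (\<Prod>i<N. card (G i))" by (simp add: card_PiE)
    also have "\<dots> \<le> (\<Prod>i<N. if i \<in> T then 1 else K)"
      using le1 by (intro prod_mono) (auto simp: G_def)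
    also have "\<dots> = K ^ card ({..<N} - T)"
      using prod.inter_restrict[of "{..<N}" "\<lambda>_. K" "- T"] by (simp add: prod.If_cases Diff_eq)
    also have "card ({..<N} - T) = N - Suc d"
      using T by (subst card_Diff_subset) (auto simp: \<T>_def intro: finite_subset)
    finally show ?thesis .
  qed
  define bads where "bads = (\<Union>(T, P)\<in>\<T> \<times> \<P>. bad T P)"
  have "card bads \<le> (\<Sum>(T, P)\<in>\<T> \<times> \<P>. card (bad T P))"
    unfolding bads_def using card_UN_le[of "\<T> \<times> \<P>" "\<lambda>(T, P). bad T P"] finT P(1) by (simp add: case_prod_unfold)
  also have "\<dots> \<le> (\<Sum>(T, P)\<in>\<T> \<times> \<P>. K ^ (N - Suc d))"
    using card_bad by (intro sum_mono) auto
  also have "\<dots> = card \<T> * card \<P> * K ^ (N - Suc d)" by (simp add: card_cartesian_product case_prod_unfold)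
  also have "\<dots> \<le> 2 ^ N * card \<P> * K ^ (N - Suc d)" using finT(2) by simp
  finally have "real (card bads) \<le> real (2 ^ N * card \<P> * K ^ (N - Suc d))" by (rule of_nat_mono)
  also have "\<dots> = 2 ^ N * real (card \<P>) * real K ^ (N - Suc d)" by simp
  also have "\<dots> \<le> 2 ^ N * (C / (s / 3) ^ d) * real K ^ (N - Suc d)"
    using P(2) by (intro mult_right_mono mult_left_mono) auto
  also have "\<dots> = 2 ^ N * C * (3 / (b - a)) ^ d * (real K ^ d * real K ^ (N - Suc d))"
    using ab K(1) by (simp add: s_def power_divide power_mult_distrib field_simps)
  also have "\<dots> < real K * (real K ^ d * real K ^ (N - Suc d))"
    using K by (intro mult_strict_right_mono) auto
  also have "\<dots> = real K ^ (Suc d + (N - Suc d))" by (simp add: power_add)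
  also have "Suc d + (N - Suc d) = N" using False by simp
  finally have "card bads < card J" unfolding cardJ(1) by (simp flip: of_nat_power)
  then have "\<not> J \<subseteq> bads"
    using card_mono[of bads J] finT P(1) cardJ(2) by (auto simp: bads_def bad_def)
  then obtain j where j: "j \<in> J" "j \<notin> bads" by blast
  show ?thesis
  proof (intro exI[of _ "\<lambda>i. grid (j i)"] conjI allI impI ballI)
    fix i assume "i < N"
    then have "j i < K" using j(1) by (auto simp: J_def PiE_iff)
    then have "s * real (j i) \<le> s * real K" using s(1) by simp
    also have "\<dots> = b - a" using K(1) by (simp add: s_def)
    finally show "grid (j i) \<le> b" by (simp add: grid_def)
    show "a \<le> grid (j i)" using s(1) by (simp add: grid_def)
  next
    fix x assume x: "x \<in> S"
    show "card {i. i < N \<and> f i x = grid (j i)} \<le> d"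
    proof (rule ccontr)
      assume "\<not> ?thesis"
      then obtain T where T: "T \<subseteq> {i. i < N \<and> f i x = grid (j i)}" "card T = Suc d"
        by (metis not_less_eq_eq obtain_subset_with_card_n)
      obtain P where PP: "P \<in> \<P>" "x \<in> P" using P(3) x by auto
      have "pt P \<in> P \<inter> S" unfolding pt_def by (rule someI[of _ x]) (use PP x in simp)
      then have "dist x (pt P) \<le> s / 3" using P(4)[OF PP(1,2) x, of "pt P"] by auto
      then have "\<bar>f i (pt P) - grid (j i)\<bar> \<le> s / 3" if "i \<in> T" for i
        using f[of i "pt P" x] T(1) that by (auto simp: dist_commute)
      then have "j \<in> bad T P" using j(1) by (simp add: bad_def)
      moreover have "T \<in> \<T>" using T by (auto simp: \<T>_def)
      ultimately show False using j(2) PP(1) by (auto simp: bads_def)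
    qed
  qed
qed

section \<open>The Stiefel manifold has the right box dimension\<close>

lemma norm_matrix_mult_le:
  fixes A :: "real^'m^'l" and B :: "real^'n^'m"
  shows "norm (A ** B) \<le> norm A * norm B"
proof -
  have "norm (A ** B) \<le> norm (\<chi> i. norm (A $ i) * norm B)"
  proof (rule norm_le_componentwise_cart)
    fix i
    have "(A ** B) $ i = (\<Sum>j\<in>UNIV. A $ i $ j *\<^sub>R B $ j)"
      by (simp add: matrix_matrix_mult_def vec_eq_iff)
    then have "norm ((A ** B) $ i) \<le> (\<Sum>j\<in>UNIV. norm (A $ i $ j *\<^sub>R B $ j))"
      by (metis norm_sum)
    also have "\<dots> = (\<Sum>j\<in>UNIV. \<bar>A $ i $ j\<bar> * \<bar>norm (B $ j)\<bar>)" by simp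
    also have "\<dots> \<le> L2_set (\<lambda>j. A $ i $ j) UNIV * L2_set (\<lambda>j. norm (B $ j)) UNIV"
      by (rule L2_set_mult_ineq)
    also have "\<dots> = norm (A $ i) * norm B"
      unfolding norm_vec_def[of B] norm_vec_def[of "A $ i"] by (simp add: L2_set_def)
    finally show "norm ((A ** B) $ i) \<le> norm ((\<chi> i. norm (A $ i) * norm B) $ i)" by simp
  qed
  also have "(\<chi> i. norm (A $ i) * norm B) = norm B *\<^sub>R (\<chi> i. norm (A $ i))"
    by (simp add: vec_eq_iff)
  also have "norm \<dots> = norm A * norm B"
    unfolding norm_scaleR norm_vec_def[of A] norm_vec_def[of "\<chi> i. norm (A $ i)"] by simp
  finally show ?thesis .
qed

text \<open>Difference of inverses: \<open>C' - C\<close> between the inverses of \<open>C\<close>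
  and \<open>C'\<close> gives the difference of these inverses. The inverses are contractions, so
  only \<open>C\<close> and the normal part, which are polynomial in \<open>w\<close>, need bounds
  on the unit ball.\<close>

lemma cayley_lipschitz:
  fixes p :: "real^'n^'k"
  shows "\<exists>L. \<forall>w\<in>tangent p \<inter> cball 0 1. \<forall>w'\<in>tangent p \<inter> cball 0 1. dist (cayley p w) (cayley p w') \<le> L * dist w w'"
proof -
  define P where "P = norm p"
  define H where "H = 1 + P * P"
  define D where "D = P + H * H + H * H"
  have P0: "P \<ge> 0" by (simp add: P_def)
  have H1: "H \<ge> 0" using P0 by (simp add: H_def)
  have normal: "norm (normal_part p w) \<le> H * norm w" for w
  proof -
    have "norm (w ** transpose p ** p) \<le> norm w * P * P"
      using norm_matrix_mult_le[of "w ** transpose p" p]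
        mult_right_mono[OF norm_matrix_mult_le[of w "transpose p"], of P] P0
      by (simp add: norm_transpose P_def)
    then show ?thesis
      using norm_triangle_ineq4[of w "w ** transpose p ** p"] by (simp add: normal_part_def H_def algebra_simps)
  qed
  have normal_diff: "normal_part p w - normal_part p w' = normal_part p (w - w')" for w w'
    by (simp add: normal_part_def matrix_ring_simps)
  have main: "dist (cayley p w) (cayley p w') \<le> (2 * H + D * (2 * (P + H))) * dist w w'"
    if w: "w \<in> tangent p" "norm w \<le> 1" and w': "w' \<in> tangent p" "norm w' \<le> 1" for w w'
  proof -
    let ?h = "normal_part p w" and ?h' = "normal_part p w'"
    let ?C = "cayley_matrix p w" and ?C' = "cayley_matrix p w'"
    let ?Ci = "matrix_inv ?C" and ?Ci' = "matrix_inv ?C'"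
    define r where "r = norm (w - w')"
    have r: "r \<ge> 0" by (simp add: r_def)
    have hH: "norm ?h \<le> H" "norm ?h' \<le> H"
      using normal[of w] normal[of w'] w(2) w'(2) H1 by (meson mult_left_le order_trans)+
    have hh: "norm (?h - ?h') \<le> H * r" unfolding normal_diff r_def by (rule normal)
    have "?C - ?C' = - ((w - w') ** transpose p) + ((?h - ?h') ** transpose ?h + ?h' ** transpose (?h - ?h'))"
      unfolding cayley_matrix_def by (simp only: matrix_ring_simps transpose_simps) simp
    then have "norm (?C - ?C') \<le> norm ((w - w') ** transpose p) + (norm ((?h - ?h') ** transpose ?h) + norm (?h' ** transpose (?h - ?h')))"
      by (metis (no_types, lifting) norm_minus_cancel norm_triangle_ineq norm_triangle_le add_left_mono order_trans)
    also have "\<dots> \<le> r * P + (H * r * H + H * (H * r))"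
    proof (intro add_mono)
      show "norm ((w - w') ** transpose p) \<le> r * P"
        using norm_matrix_mult_le[of "w - w'" "transpose p"] by (simp add: norm_transpose r_def P_def)
      show "norm ((?h - ?h') ** transpose ?h) \<le> H * r * H"
        using norm_matrix_mult_le[of "?h - ?h'" "transpose ?h"] mult_mono[OF hh hH(1)] H1 r by (simp add: norm_transpose)
      show "norm (?h' ** transpose (?h - ?h')) \<le> H * (H * r)"
        using norm_matrix_mult_le[of "?h'" "transpose (?h - ?h')"] mult_mono[OF hH(2) hh] H1 r by (simp add: norm_transpose)
    qed
    finally have CC: "norm (?C - ?C') \<le> D * r" by (simp add: D_def algebra_simps)
    define N where "N = (p + ?h) + (p + ?h)"
    define N' where "N' = (p + ?h') + (p + ?h')"
    have N': "norm N' \<le> 2 * (P + H)"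
      unfolding N'_def using norm_triangle_ineq[of "p + ?h'" "p + ?h'"] norm_triangle_ineq[of p ?h'] hH(2) by (simp add: P_def)
    have "N - N' = (?h - ?h') + (?h - ?h')" by (simp only: N_def N'_def) simp
    then have NN: "norm (N - N') \<le> 2 * (H * r)"
      using norm_triangle_ineq[of "?h - ?h'" "?h - ?h'"] hh by simp
    have contr: "norm (?Ci ** M) \<le> norm M" "norm (?Ci' ** M) \<le> norm M" for M :: "real^'n^'k"
      using invertible_cayley_matrix(2) w(1) w'(1) by (auto intro!: norm_matrix_contraction)
    have "?Ci ** (N - N') + ?Ci ** ((?C' - ?C) ** (?Ci' ** N'))
      = ?Ci ** N - ?Ci ** N' + (?Ci ** (?C' ** ?Ci') ** N' - (?Ci ** ?C) ** ?Ci' ** N')"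
      by (simp only: matrix_ring_simps matrix_mul_assoc)
    also have "\<dots> = ?Ci ** N - ?Ci' ** N'"
      using inverse_matrix[OF invertible_cayley_matrix(1)[OF w(1)]] inverse_matrix[OF invertible_cayley_matrix(1)[OF w'(1)]]
      by simp
    finally have eq: "cayley p w - cayley p w' = ?Ci ** (N - N') + ?Ci ** ((?C' - ?C) ** (?Ci' ** N'))"
      by (simp add: cayley_def N_def N'_def)
    have "norm (?Ci ** ((?C' - ?C) ** (?Ci' ** N'))) \<le> norm (?C' - ?C) * norm (?Ci' ** N')"
      using contr(1) norm_matrix_mult_le order_trans by blast
    also have "\<dots> \<le> (D * r) * (2 * (P + H))"
    proof (rule mult_mono)
      show "norm (?C' - ?C) \<le> D * r" using CC by (simp add: norm_minus_commute)
      show "norm (?Ci' ** N') \<le> 2 * (P + H)" using contr(2) N' order_trans by blast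
      show "0 \<le> D * r" using P0 H1 r by (simp add: D_def)
    qed simp
    finally have "dist (cayley p w) (cayley p w') \<le> 2 * (H * r) + (D * r) * (2 * (P + H))"
      unfolding dist_norm eq using contr(1)[of "N - N'"] NN norm_triangle_ineq[of "?Ci ** (N - N')" "?Ci ** ((?C' - ?C) ** (?Ci' ** N'))"]
      by linarith
    then show ?thesis by (simp add: dist_norm r_def[symmetric] algebra_simps)
  qed
  show ?thesis by (rule exI, intro ballI, rule main) auto
qed

lemma cayley_inv_self:
  assumes p: "p \<in> stiefel"
  shows "cayley_inv p p = 0"
proof -
  have 0: "0 \<in> tangent p" by (rule subspace_0[OF subspace_tangent])
  have n: "normal_part p 0 = 0" by (simp add: normal_part_def matrix_ring_simps)
  have C: "cayley_matrix p 0 = mat 1" by (simp add: cayley_matrix_def n matrix_ring_simps)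
  have "matrix_inv (mat 1 :: real^'b^'b) = mat 1" by (rule inverse_matrix_unique(2)) simp
  then have "cayley p 0 = p" by (simp only: cayley_def C n matrix_mul_lid) simp
  then show ?thesis using cayley_in_domain(2)[OF p 0] by simp
qed

lemma compact_stiefel: "compact (stiefel :: (real^'n^'k) set)"
proof -
  have "bounded (stiefel :: (real^'n^'k) set)"
    by (rule boundedI[of _ "sqrt (CARD('k))"]) (simp add: stiefel_norm)
  then show ?thesis
    using closed_stiefel by (simp add: compact_eq_bounded_closed)
qed

lemma box_dim_stiefel:
  "box_dim_le (CARD('n) * CARD('k) - CARD('k) * (CARD('k) + 1) div 2) (stiefel :: (real^'n::finite^'k::finite) set)"
proof -
  let ?d = "CARD('n) * CARD('k) - CARD('k) * (CARD('k) + 1) div 2"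
  let ?S = "stiefel :: (real^'n^'k) set"
  define B where "B p = cayley p ` (tangent p \<inter> cball 0 1)" for p :: "real^'n^'k"
  define W where "W p = {x \<in> cayley_domain p. norm (cayley_inv p x) < 1}" for p :: "real^'n^'k"
  have dim: "box_dim_le ?d (B p)" if p: "p \<in> ?S" for p
  proof -
    obtain L where L: "\<forall>w\<in>tangent p \<inter> cball 0 1. \<forall>w'\<in>tangent p \<inter> cball 0 1. dist (cayley p w) (cayley p w') \<le> L * dist w w'"
      using cayley_lipschitz by blast
    show ?thesis
      using box_dim_le_subspace_ball[OF subspace_tangent[of p]] L
      unfolding B_def dim_tangent[OF p] by (intro box_dim_le_lipschitz_image[of _ _ _ L]) auto
  qed
  have WB: "W p \<subseteq> B p" if "p \<in> ?S" for p
  proof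
    fix x assume "x \<in> W p"
    then show "x \<in> B p"
      using cayley_inv_tangent[OF that, of x] by (auto simp: W_def B_def intro!: image_eqI[of _ _ "cayley_inv p x"])
  qed
  have Wop: "openin (top_of_set ?S) (W p)" for p
  proof -
    have "continuous_on (cayley_domain p) (\<lambda>x. norm (cayley_inv p x))"
      by (intro continuous_intros continuous_on_cayley_inv)
    then have "openin (top_of_set (cayley_domain p)) (cayley_domain p \<inter> (\<lambda>x. norm (cayley_inv p x)) -` {..<1})"
      by (rule continuous_openin_preimage_gen) simp
    moreover have "cayley_domain p \<inter> (\<lambda>x. norm (cayley_inv p x)) -` {..<1} = W p" by (auto simp: W_def)
    ultimately show ?thesis using openin_cayley_domain openin_trans by metis
  qed
  have "p \<in> W p" if "p \<in> ?S" for p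
    using cayley_domain_near[OF that that] cayley_inv_self[OF that] by (simp add: W_def)
  then have "?S \<subseteq> \<Union>(W ` ?S)" by auto
  then obtain \<D> where D: "\<D> \<subseteq> W ` ?S" "finite \<D>" "?S \<subseteq> \<Union>\<D>"
    using compact_stiefel[where 'n = 'n and 'k = 'k] Wop unfolding compact_eq_openin_cover by (metis (no_types, lifting) imageE)
  have "box_dim_le ?d (\<Union>\<D>)"
    using D WB dim box_dim_le_subset by (intro box_dim_le_Union) blast+
  then show ?thesis using D(3) by (rule box_dim_le_subset)
qed

text \<open>In the Leibniz expansion the sum over signs splits row by row. Row \<open>i\<close>
  gives \<open>e (e + z)\<close> summed over both signs, which is 2, if the permutation fixes
  \<open>i\<close>, and 0 otherwise; only the identity survives.\<close>

lemma sum_signs_det: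
  fixes Z :: "real^'k::finite^'k"
  shows "(\<Sum>e\<in>UNIV \<rightarrow>\<^sub>E {1, -1}. (\<Prod>i\<in>UNIV. e i) * det (\<chi> i j. (if j = i then e i else 0) + Z $ i $ j)) = 2 ^ CARD('k)"
proof -
  let ?E = "(UNIV :: 'k set) \<rightarrow>\<^sub>E {1, -1 :: real}"
  define F where "F \<pi> i e = e * ((if \<pi> i = i then e else 0) + Z $ i $ \<pi> i)" for \<pi> and i :: 'k and e :: real
  have "(\<Sum>e\<in>?E. (\<Prod>i\<in>UNIV. e i) * det (\<chi> i j. (if j = i then e i else 0) + Z $ i $ j))
    = (\<Sum>e\<in>?E. \<Sum>\<pi> | \<pi> permutes UNIV. of_int (sign \<pi>) * (\<Prod>i\<in>UNIV. F \<pi> i (e i)))"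
    by (intro sum.cong refl) (simp add: det_def sum_distrib_left prod.distrib F_def mult.left_commute)
  also have "\<dots> = (\<Sum>\<pi> | \<pi> permutes UNIV. of_int (sign \<pi>) * (\<Sum>e\<in>?E. \<Prod>i\<in>UNIV. F \<pi> i (e i)))"
    by (subst sum.swap) (simp add: sum_distrib_left)
  also have "\<dots> = (\<Sum>\<pi> | \<pi> permutes UNIV. of_int (sign \<pi>) * (\<Prod>i\<in>UNIV. \<Sum>e\<in>{1, -1}. F \<pi> i e))"
    by (subst prod_sum_PiE) auto
  also have "\<dots> = (\<Sum>\<pi> | \<pi> permutes (UNIV :: 'k set). if \<pi> = id then 2 ^ CARD('k) else 0)"
  proof (rule sum.cong)
    fix \<pi> :: "'k \<Rightarrow> 'k"
    have s: "(\<Sum>e\<in>{1, -1}. F \<pi> i e) = (if \<pi> i = i then 2 else 0)" for i by (simp add: F_def)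
    show "of_int (sign \<pi>) * (\<Prod>i\<in>UNIV. \<Sum>e\<in>{1, -1}. F \<pi> i e) = (if \<pi> = id then 2 ^ CARD('k) else 0)"
    proof (cases "\<pi> = id")
      case True
      then show ?thesis unfolding s by (simp add: sign_id)
    next
      case False
      then obtain i where "\<pi> i \<noteq> i" by (metis eq_id_iff)
      then show ?thesis unfolding s using False by (auto intro!: prod_zero)
    qed
  qed simp
  also have "\<dots> = 2 ^ CARD('k)" by (simp add: permutes_id finite_permutations)
  finally show ?thesis .
qed

text \<open>By \<open>sum_signs_det\<close> some diagonal sign matrix \<open>g\<close> makes
  \<open>g + q ** transpose p\<close> invertible, and multiplying by \<open>g\<close>, its own
  inverse, gives the matrix that defines the domain.\<close>

lemma orbit_meets_cayley_domain:
  fixes p q :: "real^'n::finite^'k::finite"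
  assumes q: "q \<in> stiefel"
  shows "\<exists>g\<in>SP. g ** q \<in> cayley_domain p"
proof -
  define Z where "Z = q ** transpose p"
  obtain e :: "'k \<Rightarrow> real" where e: "e \<in> UNIV \<rightarrow>\<^sub>E {1, -1}" "det (\<chi> i j. (if j = i then e i else 0) + Z $ i $ j) \<noteq> 0"
  proof (rule ccontr)
    assume "\<not> thesis"
    then have "(\<Sum>e\<in>UNIV \<rightarrow>\<^sub>E {1, -1}. (\<Prod>i\<in>UNIV. e i) * det (\<chi> i j. (if j = i then e i else 0) + Z $ i $ j)) = 0"
      using that by (intro sum.neutral) auto
    then show False unfolding sum_signs_det by simp
  qed
  define g where "g = signed_perm_matrix e id"
  have sgn: "\<forall>i. e i \<in> {1, -1}" using e(1) by (auto simp: PiE_iff)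
  then have g: "g \<in> SP" by (auto simp: g_def signed_perm_group_def)
  have "g + Z = (\<chi> i j. (if j = i then e i else 0) + Z $ i $ j)"
    by (simp add: g_def signed_perm_matrix_def vec_eq_iff)
  then have "invertible (g + Z)" using e(2) by (simp add: invertible_det_nz)
  moreover have "invertible g"
    using signed_perm_closed(5)[OF g] by (rule inverse_matrix_unique(1))
  ultimately have "invertible (g ** (g + Z))" by (intro invertible_mult)
  moreover have "g ** (g + Z) = mat 1 + (g ** q) ** transpose p"
  proof -
    have "g ** g = signed_perm_matrix (\<lambda>i. e i * e i) id" by (simp add: g_def signed_perm_mult)
    also have "\<dots> = mat 1"
    proof -
      have "e i * e i = 1" for i using sgn[rule_format, of i] by auto
      then show ?thesis by (simp add: signed_perm_one)
    qed
    finally show ?thesis by (simp add: matrix_ring_simps Z_def matrix_mul_assoc)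
  qed
  ultimately show ?thesis using g signed_perm_stiefel[OF g q] by (auto simp: cayley_domain_def)
qed

section \<open>The upper bound for the category\<close>

lemma homotopic_with_True_iff:
  "homotopic_with (\<lambda>_. True) X Y p q \<longleftrightarrow> (\<exists>h. continuous_map (prod_topology (top_of_set {0..1::real}) X) Y h \<and>
     (\<forall>x\<in>topspace X. h (0, x) = p x) \<and> (\<forall>x\<in>topspace X. h (1, x) = q x))"
  by (subst homotopic_with) auto

text \<open>The homotopies are glued over disjoint open pieces; the end point \<open>c\<close> must
  be common to all of them.\<close>

lemma nullhomotopic_disjoint_union:
  assumes fin: "\<And>a. a \<in> I \<Longrightarrow> openin X (B a)" and disj: "\<And>a b. a \<in> I \<Longrightarrow> b \<in> I \<Longrightarrow> a \<noteq> b \<Longrightarrow> B a \<inter> B b = {}"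
    and hom: "\<And>a. a \<in> I \<Longrightarrow> homotopic_with (\<lambda>_. True) (subtopology X (B a)) X id (\<lambda>_. c)"
  shows "homotopic_with (\<lambda>_. True) (subtopology X (\<Union>a\<in>I. B a)) X id (\<lambda>_. c)"
proof -
  let ?J = "top_of_set {0..1::real}"
  let ?U = "\<Union>a\<in>I. B a"
  have "\<exists>h. continuous_map (prod_topology ?J (subtopology X (B a))) X h \<and>
      (\<forall>x\<in>B a. h (0, x) = x \<and> h (1, x) = c)" if "a \<in> I" for a
    using hom[OF that] openin_subset[OF fin[OF that]] unfolding homotopic_with_def by auto
  then obtain h where h: "\<And>a. a \<in> I \<Longrightarrow> continuous_map (prod_topology ?J (subtopology X (B a))) X (h a)"
    "\<And>a x. a \<in> I \<Longrightarrow> x \<in> B a \<Longrightarrow> h a (0, x) = x" "\<And>a x. a \<in> I \<Longrightarrow> x \<in> B a \<Longrightarrow> h a (1, x) = c"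
    by metis
  define ix where "ix x = (THE a. a \<in> I \<and> x \<in> B a)" for x
  have ix: "ix x = a" if "a \<in> I" "x \<in> B a" for a x
    unfolding ix_def using that disj by (intro the_equality) blast+
  define H where "H z = h (ix (snd z)) z" for z
  have tU: "topspace (subtopology X ?U) = ?U" using openin_subset fin by fastforce
  have "continuous_map (prod_topology ?J (subtopology X ?U)) X H"
  proof (rule pasting_lemma[where I = I and T = "\<lambda>a. {0..1} \<times> B a" and f = h])
    fix a assume a: "a \<in> I"
    have "openin (subtopology X ?U) (B a)"
      using fin[OF a] a by (auto simp: openin_subtopology intro!: exI[of _ "B a"])
    moreover have "openin ?J {0..1}" using openin_topspace[of ?J] by simp
    ultimately show "openin (prod_topology ?J (subtopology X ?U)) ({0..1} \<times> B a)"
      by (simp add: openin_prod_Times_iff)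
    have "subtopology (prod_topology ?J (subtopology X ?U)) ({0..1} \<times> B a) = prod_topology ?J (subtopology X (B a))"
    proof -
      have "?U \<inter> B a = B a" using a by auto
      then show ?thesis
        unfolding prod_topology_subtopology[symmetric] 
        by (simp add: subtopology_Times subtopology_subtopology)
    qed
    then show "continuous_map (subtopology (prod_topology ?J (subtopology X ?U)) ({0..1} \<times> B a)) X (h a)"
      using h(1)[OF a] by simp
  next
    fix a b z assume "a \<in> I" "b \<in> I" "z \<in> topspace (prod_topology ?J (subtopology X ?U)) \<inter> {0..1} \<times> B a \<inter> {0..1} \<times> B b"
    then show "h a z = h b z" using disj by (cases "a = b") auto
  next
    fix z assume "z \<in> topspace (prod_topology ?J (subtopology X ?U))"
    then obtain a where "a \<in> I" "snd z \<in> B a" "fst z \<in> {0..1}" by auto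
    then show "\<exists>a. a \<in> I \<and> z \<in> {0..1} \<times> B a \<and> H z = h a z"
      using ix by (intro exI[of _ a]) (auto simp: H_def mem_Times_iff)
  qed
  moreover have "H (0, x) = x" "H (1, x) = c" if "x \<in> ?U" for x
    using that h(2,3) ix by (auto simp: H_def)
  ultimately show ?thesis
    unfolding homotopic_with_True_iff tU by (intro exI[of _ H]) simp
qed

lemma open_map_orbit:
  assumes W: "openin (top_of_set stiefel) W"
  shows "openin (orbit_space signed_perm_group stiefel_space frame_action)
    (orbit signed_perm_group frame_action ` (W :: (real^'n::finite^'k::finite) set))"
proof -
  let ?o = "orbit signed_perm_group frame_action :: real^'n^'k \<Rightarrow> _"
  have WS: "W \<subseteq> stiefel" using openin_subset[OF W] by simp
  have sat: "{x \<in> stiefel. ?o x \<in> ?o ` W} = (\<Union>g\<in>SP. {x \<in> stiefel. g ** x \<in> W})"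
  proof (intro equalityI subsetI)
    fix x assume "x \<in> {x \<in> stiefel. ?o x \<in> ?o ` W}"
    then obtain w where w: "x \<in> stiefel" "w \<in> W" "?o x = ?o w" by auto
    then have "sp_orbit x = sp_orbit w" using WS by (metis orbit_eq_sp_orbit subsetD)
    then have "w \<in> sp_orbit x" using sp_orbit_self[of w] by simp
    then show "x \<in> (\<Union>g\<in>SP. {x \<in> stiefel. g ** x \<in> W})" using w by (auto simp: sp_orbit_def)
  next
    fix x assume "x \<in> (\<Union>g\<in>SP. {x \<in> stiefel. g ** x \<in> W})"
    then obtain g where "g \<in> SP" "x \<in> stiefel" "g ** x \<in> W" by auto
    then show "x \<in> {x \<in> stiefel. ?o x \<in> ?o ` W}"
      using orbit_frame_action_mult[of g x] by (metis (mono_tags, lifting) image_eqI mem_Collect_eq)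
  qed
  have "openin (top_of_set stiefel) {x \<in> stiefel. g ** x \<in> W}" if g: "g \<in> SP" for g
  proof -
    have "continuous_map (top_of_set stiefel) (top_of_set stiefel) (\<lambda>x. g ** x)"
      using signed_perm_stiefel[OF g] by (auto intro!: continuous_intros)
    from openin_continuous_map_preimage[OF this W] show ?thesis by simp
  qed
  then have "openin (top_of_set stiefel) (\<Union>g\<in>SP. {x \<in> stiefel. g ** x \<in> W})" by blast
  then have "openin stiefel_space {x \<in> stiefel. ?o x \<in> ?o ` W}"
    unfolding sat by (simp add: stiefel_space_def)
  then show ?thesis using WS by (auto simp: openin_orbit_space orbits_def)
qed

text \<open>The domain of the chart at \<open>p\<close> is homeomorphic to a vector space and meets
  the orbit of \<open>q\<close>, so its image joins the two orbits even when the frames themselves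
  lie in different components.\<close>

lemma path_component_orbit_space:
  fixes p q :: "real^'n::finite^'k::finite"
  assumes p: "p \<in> stiefel" and q: "q \<in> stiefel"
  shows "path_component_of (orbit_space signed_perm_group stiefel_space frame_action)
    (orbit signed_perm_group frame_action p) (orbit signed_perm_group frame_action q)"
proof -
  let ?Q = "orbit_space signed_perm_group (stiefel_space :: (real^'n^'k) topology) frame_action"
  let ?o = "orbit signed_perm_group frame_action :: real^'n^'k \<Rightarrow> _"
  obtain g where g: "g \<in> SP" "g ** q \<in> cayley_domain p" using orbit_meets_cayley_domain[OF q] by blast
  have "path_connected (cayley_domain p)"
    using homeomorphism_cayley[OF p] subspace_tangent[of p]
    by (metis convex_imp_path_connected homeomorphic_def homeomorphic_path_connectedness subspace_imp_convex)
  then have "path_connectedin stiefel_space (cayley_domain p)"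
    by (simp add: stiefel_space_def path_connectedin_subtopology) (auto simp: cayley_domain_def)
  moreover have "continuous_map stiefel_space ?Q ?o"
    by (rule quotient_imp_continuous_map[OF quotient_map_orbit_space])
  ultimately have "path_connectedin ?Q (?o ` cayley_domain p)"
    using path_connectedin_continuous_map_image by blast
  moreover have "p \<in> cayley_domain p" using cayley_domain_near[OF p p] by simp
  moreover have "?o q \<in> ?o ` cayley_domain p"
    using g orbit_frame_action_mult[OF g(1) q] by (metis image_eqI)
  ultimately show ?thesis unfolding path_component_of by blast
qed

text \<open>Radius 1/2 makes the projection injective, since translates are 1 apart, and keeps the
  ball in the contractible chart around \<open>p\<close>. The contraction is made there, pushed
  down, and followed by a path to the orbit of \<open>q\<close>.\<close>

lemma ball_nullhomotopic:
  fixes p q :: "real^'n::finite^'k::finite"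
  assumes p: "p \<in> stiefel" and q: "q \<in> stiefel"
  defines "Q \<equiv> orbit_space signed_perm_group (stiefel_space :: (real^'n^'k) topology) frame_action"
    and "orb \<equiv> orbit signed_perm_group frame_action :: real^'n^'k \<Rightarrow> _"
  shows "homotopic_with (\<lambda>_. True) (subtopology Q (orb ` (stiefel \<inter> ball p (1/2)))) Q id (\<lambda>_. orb q)"
proof -
  let ?V = "stiefel_space :: (real^'n^'k) topology"
  let ?B = "stiefel \<inter> ball p (1/2)"
  have B: "openin ?V ?B" by (auto simp: stiefel_space_def intro: openin_open_Int)
  have subB: "subtopology ?V ?B = top_of_set ?B"
    by (simp add: stiefel_space_def subtopology_subtopology Int_assoc[symmetric])
  have qm: "quotient_map ?V Q orb" unfolding Q_def orb_def by (rule quotient_map_orbit_space)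
  have cm: "continuous_map ?V Q orb" by (rule quotient_imp_continuous_map[OF qm])
  have om: "open_map ?V Q orb"
    unfolding open_map_def Q_def orb_def using open_map_orbit by (auto simp: stiefel_space_def)
  have inj: "inj_on orb ?B"
  proof (rule inj_onI)
    fix x y assume xy: "x \<in> ?B" "y \<in> ?B" "orb x = orb y"
    then have "sp_orbit x = sp_orbit y" by (simp add: orb_def orbit_eq_sp_orbit)
    then have "x \<in> sp_orbit y" using sp_orbit_self[of x] by simp
    then obtain g where g: "g \<in> SP" "x = g ** y" by (auto simp: sp_orbit_def)
    have "dist x y < 1" using xy dist_triangle_half_r[of p x 1 y] by (auto simp: dist_commute)
    then have "g = mat 1"
      using signed_perm_separated[of y g "mat 1"] g signed_perm_closed(2) xy by fastforce
    then show "x = y" using g by simp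
  qed
  have oB: "orb ` ?B \<subseteq> topspace Q"
    using quotient_imp_surjective_map[OF qm] by auto
  have "homeomorphic_map (subtopology ?V ?B) (subtopology Q (orb ` ?B)) orb"
  proof (rule bijective_open_imp_homeomorphic_map)
    show "continuous_map (subtopology ?V ?B) (subtopology Q (orb ` ?B)) orb"
      using continuous_map_from_subtopology[OF cm, of ?B] by (auto simp: continuous_map_in_subtopology)
    show "open_map (subtopology ?V ?B) (subtopology Q (orb ` ?B)) orb"
      unfolding open_map_def
    proof (intro allI impI)
      fix T assume T: "openin (subtopology ?V ?B) T"
      then have "openin ?V T" "T \<subseteq> ?B" using B openin_trans_full openin_subset by fastforce+
      then have "openin Q (orb ` T)" "orb ` T = orb ` T \<inter> orb ` ?B" using om by (auto simp: open_map_def)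
      then show "openin (subtopology Q (orb ` ?B)) (orb ` T)" unfolding openin_subtopology by blast
    qed
  qed (use oB inj in \<open>auto simp: inf.absorb2\<close>)
  then obtain s where s: "homeomorphic_maps (subtopology ?V ?B) (subtopology Q (orb ` ?B)) orb s"
    using homeomorphic_map_maps by blast
  have contr: "contractible (cayley_domain p)"
    using homeomorphism_cayley[OF p] subspace_tangent[of p]
    by (metis convex_imp_contractible homeomorphic_contractible_eq homeomorphic_def subspace_imp_convex)
  have Bc: "?B \<subseteq> cayley_domain p"
    using cayley_domain_near[OF p] by (auto simp: dist_commute)
  have pc: "p \<in> cayley_domain p" using cayley_domain_near[OF p p] by simp
  have "homotopic_with_canon (\<lambda>_. True) ?B (cayley_domain p) id (\<lambda>_. p)"
    using Bc pc by (intro homotopic_into_contractible contr) (auto simp: id_def)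
  then have 1: "homotopic_with (\<lambda>_. True) (subtopology ?V ?B) (top_of_set (cayley_domain p)) id (\<lambda>_. p)"
    by (simp add: subB)
  have "continuous_map (top_of_set (cayley_domain p)) Q orb"
  proof -
    have "subtopology ?V (cayley_domain p) = top_of_set (cayley_domain p)"
      by (simp add: stiefel_space_def subtopology_subtopology)
        (auto simp: cayley_domain_def intro: arg_cong[where f = "subtopology euclidean"])
    then show ?thesis using continuous_map_from_subtopology[OF cm] by metis
  qed
  from homotopic_with_compose_continuous_map_left[OF 1 this, of "\<lambda>_. True"]
  have 2: "homotopic_with (\<lambda>_. True) (subtopology ?V ?B) Q (orb \<circ> id) (orb \<circ> (\<lambda>_. p))" by simp
  have sc: "continuous_map (subtopology Q (orb ` ?B)) (subtopology ?V ?B) s"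
    using s by (simp add: homeomorphic_maps_def)
  from homotopic_with_compose_continuous_map_right[OF 2 this, of "\<lambda>_. True"]
  have 3: "homotopic_with (\<lambda>_. True) (subtopology Q (orb ` ?B)) Q (orb \<circ> s) (\<lambda>_. orb p)" by (simp add: comp_def)
  have "homotopic_with (\<lambda>_. True) (subtopology Q (orb ` ?B)) Q id (orb \<circ> s)"
  proof (rule homotopic_with_equal)
    show "continuous_map (subtopology Q (orb ` ?B)) Q id" by (simp add: continuous_map_from_subtopology)
    show "id x = (orb \<circ> s) x" if "x \<in> topspace (subtopology Q (orb ` ?B))" for x
      using s that by (simp add: homeomorphic_maps_def)
  qed simp_all
  moreover have "homotopic_with (\<lambda>_. True) (subtopology Q (orb ` ?B)) Q (\<lambda>_. orb p) (\<lambda>_. orb q)"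
    using path_component_orbit_space[OF p q] by (simp add: homotopic_constant_maps Q_def orb_def)
  ultimately show ?thesis using 3 homotopic_with_trans by blast
qed

theorem cat_le_stiefel:
  fixes V :: "(real^'n::finite^'k::finite) topology"
  assumes V: "V = stiefel_space" and ne: "stiefel \<noteq> ({} :: (real^'n^'k) set)"
  shows "ls_cat (orbit_space signed_perm_group V frame_action)
    \<le> enat (CARD('n) * CARD('k) - CARD('k) * (CARD('k) + 1) div 2 + 1)"
proof -
  let ?d = "CARD('n) * CARD('k) - CARD('k) * (CARD('k) + 1) div 2"
  let ?S = "stiefel :: (real^'n^'k) set"
  let ?Q = "orbit_space signed_perm_group V frame_action"
  let ?o = "orbit signed_perm_group frame_action :: real^'n^'k \<Rightarrow> _"
  obtain q where q: "q \<in> ?S" using ne by auto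
  obtain F where F: "F \<subseteq> ?S" "finite F" "?S \<subseteq> (\<Union>p\<in>F. ball p (1/4))"
    using compactE_image[OF compact_stiefel, of ?S "\<lambda>p. ball p (1/4)"] by (metis (no_types, lifting) UN_iff centre_in_ball divide_pos_pos open_ball subsetI zero_less_numeral zero_less_one)
  obtain ps :: "(real^'n^'k) list" where ps: "set ps = F" using finite_list[OF F(2)] by blast
  define N where "N = length ps"
  have psS: "ps ! i \<in> ?S" if "i < N" for i using that ps F(1) nth_mem by (auto simp: N_def)
  define f where "f i x = infdist x (sp_orbit (ps ! i))" for i x
  have f_lip: "\<bar>f i x - f i y\<bar> \<le> dist x y" for i x y
    using infdist_triangle_abs[of x "sp_orbit (ps ! i)" y] by (simp add: f_def)
  have f_g: "f i (g ** x) = f i x" if "g \<in> SP" for i x g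
    by (simp add: f_def infdist_sp_orbit_mult[OF that])
  have f_cont: "continuous_on ?S (f i)" for i unfolding f_def by (intro continuous_intros)
  \<comment> \<open>The balls of radius 1/4 already cover, so levels of at least 1/4 still cover;
    levels of at most 3/8 leave a margin of 1/8 below the radius 1/2 of nullhomotopic balls.\<close>
  have ex: "\<exists>c. (\<forall>i<N. 1/4 \<le> c i \<and> c i \<le> 3/8) \<and> (\<forall>x\<in>?S. card {i. i < N \<and> f i x = c i} \<le> ?d)"
    by (rule levels_in_general_position[OF box_dim_stiefel]) (use f_lip in auto)
  obtain c where c0: "(\<forall>i<N. 1/4 \<le> c i \<and> c i \<le> 3/8) \<and> (\<forall>x\<in>?S. card {i. i < N \<and> f i x = c i} \<le> ?d)"
    using ex by (elim exE)
  then have c: "1/4 \<le> c i" "c i \<le> 3/8" if "i < N" for i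
    using that by auto
  have c_card: "card {i. i < N \<and> f i x = c i} \<le> ?d" if "x \<in> ?S" for x
    using c0 that by blast
  \<comment> \<open>\<open>A\<close> lists the spheres that are closest to \<open>x\<close>,
    \<open>B\<close> the remaining balls that contain \<open>x\<close>. Different \<open>A\<close>
    of equal size contradict each other's strict inequalities, and for equal \<open>A\<close>
    different \<open>B\<close> disagree on a side, so the sets for one \<open>m\<close> are
    disjoint.\<close>
  define W where "W = (\<lambda>(A, B). {x \<in> ?S. (\<forall>j\<in>B. f j x < c j) \<and> (\<forall>j\<in>{..<N} - A - B. c j < f j x) \<and>
    (\<forall>i\<in>A. \<bar>f i x - c i\<bar> < 1/8) \<and> (\<forall>i\<in>A. \<forall>j\<in>{..<N} - A. \<bar>f i x - c i\<bar> < \<bar>f j x - c j\<bar>)})"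
  define Ix where "Ix m = {(A, B). A \<subseteq> {..<N} \<and> card A = m \<and> B \<subseteq> {..<N} - A}" for m
  define U where "U m = (\<Union>a\<in>Ix m. ?o ` W a)" for m
  have W_open: "openin (top_of_set ?S) (W a)" if "a \<in> Ix m" for a m
  proof -
    obtain A B where a: "a = (A, B)" by (cases a)
    have fin: "finite A" "finite B" using that a by (auto simp: Ix_def intro: finite_subset[of _ "{..<N}"])
    have lt: "openin (top_of_set ?S) {x \<in> ?S. u x < v x}" if "continuous_on ?S u" "continuous_on ?S v" for u v :: "_ \<Rightarrow> real"
    proof -
      have "continuous_on ?S (\<lambda>x. v x - u x)" using that by (intro continuous_intros)
      then have "openin (top_of_set ?S) (?S \<inter> (\<lambda>x. v x - u x) -` {0<..})"
        by (rule continuous_openin_preimage_gen) simp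
      moreover have "?S \<inter> (\<lambda>x. v x - u x) -` {0<..} = {x \<in> ?S. u x < v x}" by auto
      ultimately show ?thesis by simp
    qed
    have all: "openin (top_of_set ?S) {x \<in> ?S. \<forall>i\<in>I. R i x}"
      if "finite I" "\<And>i. i \<in> I \<Longrightarrow> openin (top_of_set ?S) {x \<in> ?S. R i x}" for I :: "nat set" and R
      using that
    proof (induction I rule: finite_induct)
      case (insert i I)
      have eq: "{x \<in> ?S. \<forall>j\<in>insert i I. R j x} = {x \<in> ?S. R i x} \<inter> {x \<in> ?S. \<forall>j\<in>I. R j x}" by auto
      have "openin (top_of_set ?S) {x \<in> ?S. \<forall>j\<in>I. R j x}"
        by (rule insert.IH) (use insert.prems in simp)
      moreover have "openin (top_of_set ?S) {x \<in> ?S. R i x}" using insert.prems by simp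
      ultimately show ?case unfolding eq by (intro openin_Int)
    qed (use openin_topspace[of "top_of_set ?S"] in simp)
    have "W a = {x \<in> ?S. \<forall>j\<in>B. f j x < c j} \<inter> {x \<in> ?S. \<forall>j\<in>{..<N} - A - B. c j < f j x} \<inter>
      {x \<in> ?S. \<forall>i\<in>A. \<bar>f i x - c i\<bar> < 1/8} \<inter> {x \<in> ?S. \<forall>i\<in>A. \<forall>j\<in>{..<N} - A. \<bar>f i x - c i\<bar> < \<bar>f j x - c j\<bar>}"
      by (auto simp: W_def a)
    then show ?thesis
      using fin by (simp only:) (intro openin_Int all lt finite_Diff continuous_intros f_cont, auto)
  qed
  have W_null: "homotopic_with (\<lambda>_. True) (subtopology ?Q (?o ` W a)) ?Q id (\<lambda>_. ?o q)" if a: "a \<in> Ix m" for a m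
  proof -
    obtain A B where AB: "a = (A, B)" "A \<subseteq> {..<N}" "B \<subseteq> {..<N} - A" using a by (auto simp: Ix_def)
    show ?thesis
    proof (cases "W a = {}")
      case False
      have "\<exists>i<N. \<forall>x\<in>W a. f i x < 1/2"
      \<comment> \<open>The first case is void: no frame lies strictly outside all the
        balls.\<close>
      proof (cases "A = {} \<and> B = {}")
        case True
        obtain x where x: "x \<in> W a" using False by auto
        then have "x \<in> ?S" by (auto simp: W_def AB)
        then obtain p where p: "p \<in> F" "dist p x < 1/4" using F(3) by auto
        then obtain i where i: "i < N" "p = ps ! i" using ps by (metis N_def in_set_conv_nth)
        have "f i x \<le> dist x p" unfolding f_def i(2) by (rule infdist_le[OF sp_orbit_self])
        then have "f i x < c i" using c(1)[OF i(1)] p(2) by (simp add: dist_commute)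
        moreover have "c i < f i x" using x True i(1) by (auto simp: W_def AB)
        ultimately show ?thesis by simp
      next
        case False
        then obtain i where "i \<in> A \<or> i \<in> B" by auto
        moreover have "f i x < 1/2" if "x \<in> W a" "i \<in> A" for x
          using that c(2)[of i] AB(2) by (force simp: W_def AB(1))
        moreover have "f i x < 1/2" if "x \<in> W a" "i \<in> B" for x
          using that c(2)[of i] AB(3) by (force simp: W_def AB(1))
        ultimately show ?thesis using AB(2,3) by blast
      qed
      then obtain i where i: "i < N" "\<And>x. x \<in> W a \<Longrightarrow> f i x < 1/2" by blast
      have "?o ` W a \<subseteq> ?o ` (?S \<inter> ball (ps ! i) (1/2))"
      proof
        fix b assume "b \<in> ?o ` W a"
        then obtain x where x: "x \<in> W a" "b = ?o x" by auto
        then have xS: "x \<in> ?S" by (auto simp: W_def AB)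
        obtain g where g: "g \<in> SP" "f i x = dist x (g ** ps ! i)"
          unfolding f_def using infdist_sp_orbit_attained by blast
        let ?h = "transpose g"
        have h: "?h \<in> SP" by (rule signed_perm_closed(3)[OF g(1)])
        have "dist (ps ! i) (?h ** x) = dist (?h ** (g ** ps ! i)) (?h ** x)"
          by (simp add: matrix_mul_assoc signed_perm_closed(5)[OF g(1)])
        also have "\<dots> < 1/2" using i(2)[OF x(1)] g(2) by (simp add: signed_perm_dist[OF h] dist_commute)
        finally have "?h ** x \<in> ?S \<inter> ball (ps ! i) (1/2)" using signed_perm_stiefel[OF h xS] by simp
        then show "b \<in> ?o ` (?S \<inter> ball (ps ! i) (1/2))"
          using orbit_frame_action_mult[OF h xS] x(2) by (metis image_eqI)
      qed
      then have eq: "subtopology ?Q (?o ` W a) = subtopology (subtopology ?Q (?o ` (?S \<inter> ball (ps ! i) (1/2)))) (?o ` W a)"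
        by (simp add: subtopology_subtopology inf.absorb2)
      have "continuous_map (subtopology ?Q (?o ` W a)) (subtopology ?Q (?o ` (?S \<inter> ball (ps ! i) (1/2)))) id"
        unfolding eq by (rule continuous_map_from_subtopology) simp
      from homotopic_with_compose_continuous_map_right[OF ball_nullhomotopic[OF psS[OF i(1)] q] this[unfolded V], of "\<lambda>_. True"]
      show ?thesis by (simp add: V comp_def id_def)
    next
      case True
      then show ?thesis unfolding homotopic_with_True_iff by (simp add: continuous_map_on_empty)
    qed
  qed
  have W_g: "g ** x \<in> W a" if "g \<in> SP" "x \<in> W a" for g x a
    using that by (auto simp: W_def f_g signed_perm_stiefel split: prod.splits)
  have W_disj: "?o ` W a \<inter> ?o ` W b = {}" if ab: "a \<in> Ix m" "b \<in> Ix m" "a \<noteq> b" for a b m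
  proof -
    obtain A B where AB: "a = (A, B)" "A \<subseteq> {..<N}" "card A = m" "B \<subseteq> {..<N} - A" using ab(1) by (auto simp: Ix_def)
    obtain A' B' where AB': "b = (A', B')" "A' \<subseteq> {..<N}" "card A' = m" "B' \<subseteq> {..<N} - A'" using ab(2) by (auto simp: Ix_def)
    have fin: "finite A" "finite A'" using AB(2) AB'(2) finite_subset by blast+
    have disj: False if x: "x \<in> W a" "x \<in> W b" for x
    proof (cases "A = A'")
      case True
      then have "B \<noteq> B'" using ab(3) AB(1) AB'(1) by simp
      then obtain j where "j \<in> B \<and> j \<notin> B' \<or> j \<in> B' \<and> j \<notin> B" by blast
      then show False
      proof
        assume j: "j \<in> B \<and> j \<notin> B'"
        then have "f j x < c j" using x(1) by (simp add: W_def AB(1))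
        moreover have "j \<in> {..<N} - A' - B'" using j AB(4) True by auto
        then have "c j < f j x" using x(2) unfolding AB'(1) W_def by blast
        ultimately show False by simp
      next
        assume j: "j \<in> B' \<and> j \<notin> B"
        then have "f j x < c j" using x(2) by (simp add: W_def AB'(1))
        moreover have "j \<in> {..<N} - A - B" using j AB'(4) True by auto
        then have "c j < f j x" using x(1) unfolding AB(1) W_def by blast
        ultimately show False by simp
      qed
    next
      case False
      then obtain i where i: "i \<in> A" "i \<notin> A'" using card_subset_eq[OF fin(2), of A] AB(3) AB'(3) by auto
      obtain j where j: "j \<in> A'" "j \<notin> A" using False card_subset_eq[OF fin(1), of A'] AB(3) AB'(3) by auto
      have "\<bar>f i x - c i\<bar> < \<bar>f j x - c j\<bar>" using x(1) i(1) j AB'(2) by (auto simp: W_def AB(1))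
      moreover have "\<bar>f j x - c j\<bar> < \<bar>f i x - c i\<bar>" using x(2) j(1) i AB(2) by (auto simp: W_def AB'(1))
      ultimately show False by simp
    qed
    have WS: "W a \<subseteq> ?S" "W b \<subseteq> ?S" by (auto simp: W_def AB(1) AB'(1))
    show ?thesis
    proof (rule ccontr)
      assume "?o ` W a \<inter> ?o ` W b \<noteq> {}"
      then obtain x y where xy: "x \<in> W a" "y \<in> W b" "?o x = ?o y" by auto
      then have "sp_orbit x = sp_orbit y" using WS by (metis orbit_eq_sp_orbit subsetD)
      then have "x \<in> sp_orbit y" using sp_orbit_self[of x] by simp
      then obtain g where "g \<in> SP" "x = g ** y" by (auto simp: sp_orbit_def)
      then have "x \<in> W b" using W_g[of g y b] xy(2) by simp
      then show False using disj xy(1) by blast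
    qed
  qed
  have oS: "?o ` ?S = topspace ?Q" by (auto simp: topspace_orbit_space orbits_def V)
  have "(\<Union>m<Suc ?d. U m) = topspace ?Q"
  proof (intro equalityI subsetI)
    fix b assume "b \<in> topspace ?Q"
    then obtain x where x: "x \<in> ?S" "b = ?o x" using oS by auto
    \<comment> \<open>For the spheres through \<open>x\<close> the deviation is 0, which is strictly
      smaller than the deviation from all others.\<close>
    define A where "A = {i. i < N \<and> f i x = c i}"
    define B where "B = {j. j < N \<and> f j x < c j}"
    have "(A, B) \<in> Ix (card A)" by (auto simp: Ix_def A_def B_def)
    moreover have "x \<in> W (A, B)" using x(1) by (auto simp: W_def A_def B_def)
    moreover have "card A \<le> ?d" unfolding A_def by (rule c_card[OF x(1)])
    ultimately show "b \<in> (\<Union>m<Suc ?d. U m)"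
      unfolding x(2) U_def by (intro UN_I[of "card A"]) auto
  next
    fix b assume "b \<in> (\<Union>m<Suc ?d. U m)"
    then show "b \<in> topspace ?Q" unfolding oS[symmetric] by (auto simp: U_def W_def)
  qed
  moreover have "openin ?Q (U m)" for m
    unfolding U_def V using open_map_orbit[OF W_open] by blast
  moreover have "\<exists>c. homotopic_with (\<lambda>_. True) (subtopology ?Q (U m)) ?Q id (\<lambda>_. c)" for m
    unfolding U_def
    by (rule exI, rule nullhomotopic_disjoint_union[OF _ W_disj W_null]) (use open_map_orbit[OF W_open] V in auto)
  ultimately have "(\<Union>m<Suc ?d. U m) = topspace ?Q \<and> (\<forall>m<Suc ?d. openin ?Q (U m) \<and>
      (\<exists>c. homotopic_with (\<lambda>_. True) (subtopology ?Q (U m)) ?Q id (\<lambda>_. c)))"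
    by simp
  then have "enat (Suc ?d) \<in> {enat m | m. \<exists>U :: nat \<Rightarrow> (real^'n^'k) set set.
      (\<Union>i<m. U i) = topspace ?Q \<and> (\<forall>i<m. openin ?Q (U i) \<and>
        (\<exists>c. homotopic_with (\<lambda>_. True) (subtopology ?Q (U i)) ?Q id (\<lambda>_. c)))}"
    by (intro CollectI exI[of _ "Suc ?d"] conjI[OF refl] exI[of _ U])
  then have "ls_cat ?Q \<le> enat (Suc ?d)" unfolding ls_cat_def by (rule Inf_lower)
  then show ?thesis by simp
qed

lemma stiefel_nonempty:
  assumes "CARD('k) \<le> CARD('n)"
  shows "stiefel \<noteq> ({} :: (real^'n::finite^'k::finite) set)"
proof -
  obtain f :: "'k \<Rightarrow> 'n" where "inj f"
    using card_le_inj[of "UNIV :: 'k set" "UNIV :: 'n set"] assms by auto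
  then have "(\<chi> i. axis (f i) (1 :: real)) \<in> stiefel"
    by (simp add: stiefel_def inner_axis_axis inj_eq)
  then show ?thesis by blast
qed

theorem corollary2p6:
  assumes "CARD('n::finite) \<ge> 3" and "1 \<le> CARD('k::finite)" and "CARD('k) \<le> CARD('n)"
  defines "V \<equiv> (stiefel_space :: (real^'n^'k) topology)"
  shows "schwarz_genus signed_perm_group V frame_action
           = ls_cat (orbit_space signed_perm_group V frame_action)
       \<and> ls_cat (orbit_space signed_perm_group V frame_action) = enat (manifold_dim V + 1)
       \<and> manifold_dim V + 1 = CARD('n) * CARD('k) - CARD('k) * (CARD('k) + 1) div 2 + 1"
proof -
  have V: "V = stiefel_space" by (simp add: V_def)
  note ne = stiefel_nonempty[OF assms(3)]
  note dim = manifold_dim_stiefel[OF V ne]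
  have "enat (manifold_dim V + 1) \<le> schwarz_genus signed_perm_group V frame_action"
    unfolding dim by (rule stiefel_genus_ge[OF assms(3) V])
  moreover have "schwarz_genus signed_perm_group V frame_action
      \<le> ls_cat (orbit_space signed_perm_group V frame_action)"
    by (rule genus_le_cat_stiefel[OF V])
  moreover have "ls_cat (orbit_space signed_perm_group V frame_action) \<le> enat (manifold_dim V + 1)"
    unfolding dim by (rule cat_le_stiefel[OF V ne])
  ultimately show ?thesis
    unfolding dim by (meson order_antisym order_trans)
qed

end
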